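(* Let $x,y,z$ be non-negative integers and let $\mathbf a=(a_1,\dots,a_m)$, $\mathbf b=(b_1,\dots,b_n)$ be two sequences of non-negative integers. Put $\mu=2\lfloor\frac{m+1}{2}\rfloor$, $\mu'=2\lceil\frac{m-1}{2}\rceil$, $\nu=2\lfloor\frac{n+1}{2}\rfloor$, $\nu'=2\lceil\frac{n-1}{2}\rceil$, and $$\mathbf t^{+}=(a_1,\dots,a_{\mu'},\,a_{\mu'+1}+x+y+b_{\nu},\,b_{\nu-1},\dots,b_1),\qquad \mathbf t^{-}=(0,a_1,\dots,a_{\mu-1},\,a_{\mu}+x+y+b_{\nu'+1},\,b_{\nu'},\dots,b_1,z).$$ Then $$M(R^{(2)}_{x,y,z}(\mathbf a;\mathbf b))=\frac{M(R^{(2)}_{x+y,0,z}(\mathbf a;\mathbf b))\,M(R^{(2)}_{0,y,z}(\mathbf a;\mathbf b))}{M(R^{(2)}_{y,0,z}(\mathbf a;\mathbf b))}\cdot\frac{T(x+1,2a+b+2y+z-1,y)\,V(2x+2a+3,b+2y+z-2,y)}{T(1,2a+b+2y+z-1,y)\,V(2a+3,b+2y+z-2,y)}$$ $$=K(\mathbf t^{+})\,K(\mathbf t^{-})\cdot\frac{(2a-1)!!}{(2a+2y-1)!!}\cdot\frac{H_2(2e_a+2o_b)\,H_2(2o_a+2e_b+2z)}{H_2(2e_a+2o_b+2y)\,H_2(2o_a+2e_b+2y+2z)}\cdot\frac{H(2a+b+2y+z)\,H(b+y+z)}{H(2a+b+y+z)\,H(b+z)}$$ $$\cdot\frac{T(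x+1,2a+b+2y+z-1,y)\,V(2x+2a+3,b+2y+z-2,y)}{T(1,2a+b+2y+z-1,y)\,V(2a+3,b+2y+z-2,y)}.$$
   Context: Lattice and tilings. For real $u,k$ let $[u;k]$ be the point of the plane with Cartesian coordinates $(u,\frac{\sqrt3}{2}k)$. The triangular lattice has as vertices all $[u;k]$ with $k\in\mathbb Z$, $u-k/2\in\mathbb Z$; its faces are unit equilateral triangles, up-pointing or down-pointing. A region is a finite union of unit triangles. A lozenge is the union of two unit triangles sharing an edge; it is vertical if that edge is horizontal. A tiling of a region is a covering of it by lozenges contained in it, without gaps or overlaps. $M(R)$ is the number of tilings of $R$; $M(\emptyset)=1$. Sequences. $a=\sum a_i$, $b=\sum b_j$; $o_a,e_a$ are the sums of the $a_i$ with $i$ odd, resp. even; $o_b,e_b$ likewise. $a_i=0$ for $i>m$, $b_j=0$ for $j>n$; an empty sequence is treated as the one-term sequence $(0)$. Functions. $H(n)=\prod_{i=0}^{n-1}i!$; $H_2(n)=\prod_{i=1}^{\lfloor n/2\rfloor}(n-2i)!$; for $n\ge0$, $(x)_n=x(x+1)\cdots(x+n-1)$ and $[x]_n=x(x+2)\cdots(x+2n-2)$ (both $1$ for $n=0$); $T(x,n,m)=\prod_{i=0}^{m-1}(x+i)_{n-2i}$, $V(x,n,m)=\prod_{i=0}^{m-1}[x+2i]_{n-2i}$; $(2n+1)!!=1\cdot3\cdots(2n+1)$, $(-1)!!=1$. Empty products are $1$. Quartered hexagons. For a sequence $\mathbf t=(t_1,\dots,t_{2l})$ of non-negative integers let $s_k=t_1+\dots+t_k$,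 $o_t=\sum_{i\text{ odd}}t_i$, $e_t=\sum_{i\text{ even}}t_i$. If $e_t\ge1$, take the region bounded by the base from $[0;0]$ to $[o_t+e_t;0]$, the segment from $[o_t+e_t;0]$ to $[o_t+\frac12;2e_t-1]$, the north side from there to $[\frac12;2e_t-1]$, and the west zigzag through $[0;0],[\frac12;1],[0;2],[\frac12;3],\dots,[\frac12;2e_t-1]$; remove from it, for each $1\le i\le l$, the up-pointing triangle with base from $[s_{2i-1};0]$ to $[s_{2i};0]$. $K(\mathbf t)$ is the number of tilings of the resulting region; if $e_t=0$, $K(\mathbf t)=1$. The region $R^{(2)}_{x,y,z}(\mathbf a;\mathbf b)$. Let $L=x+y+a+b$, $A=2(y+e_a+o_b)-1$, $B=2(y+z+o_a+e_b)-1$, and let $\ell$ be the line $k=0$. Upper part (empty if $A=-1$): bounded by $\ell$ between $[0;0]$ and $[L;0]$, the segment from $[L;0]$ to $[L-\frac A2;A]$, the horizontal north side at height $k=A$, and the west zigzag through the points $[\alpha(k);k]$, $0\le k\le A$, with $\alpha(k)=0$ for $k$ even and $\frac12$ for $k$ odd. Lower part (empty if $B=-1$): bounded by $\ell$ between $[0;0]$ and $[L;0]$, the segments from $[L;0]$ to $[L+\frac z2;-z]$ and from there to $[L+z-\frac B2;-B]$, the horizontal south side at $k=-B$, and the west zigzag through $[\beta(k);-k]$, $0\le k\le B$, with $\beta(k)=0$ for $k$ even and $\frac12$ for $k$ odd. The region is the union of the two parts (lozenges may cross $\ell$) after removing: (i) from the lower part, everything at points $[u;-k]$ with $u<a_1-k/2$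 (a down-pointing half triangle of side $2a_1$); (ii) for $2\le i\le m$, the triangle of side $a_i$ having a side on $\ell$ from $[a_1+\dots+a_{i-1};0]$ to $[a_1+\dots+a_i;0]$, up-pointing (above $\ell$) if $i$ is even, down-pointing (below $\ell$) if $i$ is odd; (iii) for $1\le j\le n$, the triangle of side $b_j$ having a side on $\ell$ from $[L-b_1-\dots-b_j;0]$ to $[L-b_1-\dots-b_{j-1};0]$, up-pointing (above $\ell$) if $j$ is odd, down-pointing (below $\ell$) if $j$ is even. (The underlying halved hexagon has north, northeast, southeast, south sides $x+o_a+e_b$, $2y+z+2e_a+2o_b-1$, $2y+z+2o_a+2e_b-1$, $x+e_a+o_b$.) *)

theory Defs
  imports Complex_Main "HOL-Library.Disjoint_Sets"
begin

section \<open>Lozenge tilings of regions of the triangular lattice\<close>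

text \<open>
  The lattice vertex \<open>[u;k]\<close>, with Cartesian coordinates \<open>(u, sqrt 3 / 2 * k)\<close>, is represented by
  the pair of integers \<open>(u - k/2, k)\<close>.
\<close>

type_synonym vertex = "int \<times> int"

definition abscissa :: "vertex \<Rightarrow> real" where
  "abscissa v = of_int (fst v) + of_int (snd v) / 2"

datatype face = Up int int | Down int int

fun vertices :: "face \<Rightarrow> vertex set" where
  "vertices (Up i k) = {(i, k), (i + 1, k), (i, k + 1)}"
| "vertices (Down i k) = {(i, k + 1), (i + 1, k + 1), (i + 1, k)}"

text \<open>A region is given by its set of unit triangles, a lozenge by the set of its two triangles.\<close>

definition lozenge :: "face set \<Rightarrow> bool" where
  "lozenge l \<longleftrightarrow> (\<exists>f g. l = {f, g} \<and> card (vertices f \<inter> vertices g) = 2)"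

definition tilings :: "face set \<Rightarrow> face set set set" where
  "tilings R = {P. partition_on R P \<and> (\<forall>l\<in>P. lozenge l)}"

definition num_tilings :: "face set \<Rightarrow> nat" where
  "num_tilings R = card (tilings R)"

text \<open>
  \<open>faces_within Q\<close> consists of the unit triangles all of whose vertices \<open>[u;k]\<close> satisfy \<open>Q u k\<close>.
  In all uses below, the shape described by \<open>Q\<close> is bounded, in each strip between two consecutive
  lattice heights, by straight segments and is convex there (the zigzag, and the sides of the
  halved hexagon, only bend at integer heights). Hence a unit triangle is contained in the shape
  iff its three vertices are.
\<close>

definition faces_within :: "(real \<Rightarrow> int \<Rightarrow> bool) \<Rightarrow> face set" where
  "faces_within Q = {f. \<forall>v\<in>vertices f. Q (abscissa v) (snd v)}"

definition zigzag :: "int \<Rightarrow> real" where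
  "zigzag k = (if even k then 0 else 1 / 2)"

definition upper_part :: "nat \<Rightarrow> int \<Rightarrow> face set" where
  "upper_part L A = faces_within (\<lambda>u k. 0 \<le> k \<and> k \<le> A \<and> zigzag k \<le> u \<and> u \<le> L - k / 2)"

text \<open>Points below the line are \<open>[u;k]\<close> with \<open>k \<le> 0\<close>, so that their depth is \<open>-k\<close>.\<close>

definition lower_part :: "nat \<Rightarrow> nat \<Rightarrow> int \<Rightarrow> face set" where
  "lower_part L z B = faces_within (\<lambda>u k. - B \<le> k \<and> k \<le> 0 \<and> zigzag k \<le> u \<and>
     u \<le> (if - k \<le> int z then L + (- k) / 2 else L + z - (- k) / 2))"

text \<open>Triangles with horizontal side from \<open>[p;0]\<close> to \<open>[q;0]\<close>.\<close>

definition up_triangle :: "nat \<Rightarrow> nat \<Rightarrow> face set" where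
  "up_triangle p q = faces_within (\<lambda>u k. 0 \<le> k \<and> p + k / 2 \<le> u \<and> u \<le> q - k / 2)"

definition down_triangle :: "nat \<Rightarrow> nat \<Rightarrow> face set" where
  "down_triangle p q = faces_within (\<lambda>u k. k \<le> 0 \<and> p + (- k) / 2 \<le> u \<and> u \<le> q - (- k) / 2)"

text \<open>
  The part of the lower half plane to the left of the lattice line from \<open>[s;0]\<close> to \<open>[0;-2*s]\<close>;
  it is only used to be removed from a lower part, where it cuts off a half triangle of side
  \<open>2 * s\<close>.
\<close>

definition left_down :: "nat \<Rightarrow> face set" where
  "left_down s = faces_within (\<lambda>u k. k \<le> 0 \<and> u \<le> s - (- k) / 2)"

section \<open>Sequences\<close>

text \<open>Sequences are indexed from 1, and continued by 0.\<close>

definition entry :: "nat list \<Rightarrow> nat \<Rightarrow> nat" where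
  "entry t i = (if 1 \<le> i \<and> i \<le> length t then t ! (i - 1) else 0)"

definition psum :: "nat list \<Rightarrow> nat \<Rightarrow> nat" where
  "psum t k = (\<Sum>i = 1..k. entry t i)"

definition odd_sum :: "nat list \<Rightarrow> nat" where
  "odd_sum t = (\<Sum>i\<in>{i\<in>{1..length t}. odd i}. entry t i)"

definition even_sum :: "nat list \<Rightarrow> nat" where
  "even_sum t = (\<Sum>i\<in>{i\<in>{1..length t}. even i}. entry t i)"

section \<open>The regions\<close>

definition quartered_hexagon :: "nat list \<Rightarrow> face set" where
  "quartered_hexagon t =
     upper_part (odd_sum t + even_sum t) (2 * int (even_sum t) - 1)
     - (\<Union>i\<in>{1..length t div 2}. up_triangle (psum t (2 * i - 1)) (psum t (2 * i)))"

text \<open>Only used for sequences of even length.\<close>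

definition K :: "nat list \<Rightarrow> nat" where
  "K t = (if even_sum t = 0 then 1 else num_tilings (quartered_hexagon t))"

definition R2 :: "nat \<Rightarrow> nat \<Rightarrow> nat \<Rightarrow> nat list \<Rightarrow> nat list \<Rightarrow> face set" where
  "R2 x y z a b =
    (let L = x + y + sum_list a + sum_list b;
         A = 2 * int (y + even_sum a + odd_sum b) - 1;
         B = 2 * int (y + z + odd_sum a + even_sum b) - 1
     in (upper_part L A \<union> lower_part L z B)
        - (left_down (entry a 1)
           \<union> (\<Union>i\<in>{2..length a}.
                (if even i then up_triangle else down_triangle) (psum a (i - 1)) (psum a i))
           \<union> (\<Union>j\<in>{1..length b}.
                (if odd j then up_triangle else down_triangle) (L - psum b j) (L - psum b (j - 1)))))"

text \<open>
  In the sequences \<open>t_plus\<close> and \<open>t_minus\<close>, the maximum accounts for the convention that an empty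
  sequence is treated as the one-term sequence \<open>(0)\<close>, and \<open>2 * (m div 2)\<close> is
  \<open>2 * \<lceil>(m - 1) / 2\<rceil>\<close>.
\<close>

definition t_plus :: "nat \<Rightarrow> nat \<Rightarrow> nat list \<Rightarrow> nat list \<Rightarrow> nat list" where
  "t_plus x y a b =
    (let m = max 1 (length a); n = max 1 (length b);
         \<mu>' = 2 * (m div 2); \<nu> = 2 * ((n + 1) div 2)
     in map (entry a) [1..<\<mu>' + 1] @ [entry a (\<mu>' + 1) + x + y + entry b \<nu>]
        @ rev (map (entry b) [1..<\<nu>]))"

definition t_minus :: "nat \<Rightarrow> nat \<Rightarrow> nat \<Rightarrow> nat list \<Rightarrow> nat list \<Rightarrow> nat list" where
  "t_minus x y z a b =
    (let m = max 1 (length a); n = max 1 (length b);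
         \<mu> = 2 * ((m + 1) div 2); \<nu>' = 2 * (n div 2)
     in [0] @ map (entry a) [1..<\<mu>] @ [entry a \<mu> + x + y + entry b (\<nu>' + 1)]
        @ rev (map (entry b) [1..<\<nu>' + 1]) @ [z])"

section \<open>Product functions\<close>

definition H :: "nat \<Rightarrow> real" where
  "H n = (\<Prod>i<n. fact i)"

definition H2 :: "nat \<Rightarrow> real" where
  "H2 n = (\<Prod>i = 1..n div 2. fact (n - 2 * i))"

definition step2_pochhammer :: "real \<Rightarrow> nat \<Rightarrow> real" where
  "step2_pochhammer x n = (\<Prod>j<n. x + 2 * real j)"

text \<open>
  The second argument of \<open>T\<close> and \<open>V\<close> may be negative when the third one is 0; otherwise all
  arguments of \<open>nat\<close> are non-negative wherever \<open>T\<close> and \<open>V\<close> are used.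
\<close>

definition T :: "real \<Rightarrow> int \<Rightarrow> nat \<Rightarrow> real" where
  "T x n m = (\<Prod>i<m. pochhammer (x + real i) (nat (n - 2 * int i)))"

definition V :: "real \<Rightarrow> int \<Rightarrow> nat \<Rightarrow> real" where
  "V x n m = (\<Prod>i<m. step2_pochhammer (x + 2 * real i) (nat (n - 2 * int i)))"

text \<open>The double factorial of an odd integer \<open>k \<ge> -1\<close>.\<close>

definition odd_dfact :: "int \<Rightarrow> real" where
  "odd_dfact k = (\<Prod>j\<in>{j\<in>{1..k}. odd j}. of_int j)"

end

(*
  The idea: cut the region along the line. A tiling is determined by the set W of the y positions
  where lozenges cross the line and by a tiling of each half. Each half is a halved hexagon from which
  only unit dents at its base are missing, because every removed triangle is covered by forced lozenges
  once its base is dented. Peeling off rows two at a time shows that a halved hexagon with dents D has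
  vand D / H2 (2 * card D) tilings, where vand D is the Vandermonde product of the numbers d * (d + 1),
  d in D: interlacing dents of consecutive rows amount to taking discrete antiderivatives in a
  determinant. The quartered hexagons are of the same kind, so the number of tilings is
  K(t+) * K(t-) times quotients of H2 times the sum over W of vand(W)^2 with a product weight. By
  Andreief's identity this sum is a determinant of moments, i.e. of the sums for y = 1, which have a
  product formula; what remains is a Hankel determinant of quotients of Pochhammer symbols.
*)
theory Submission
  imports Defs "Jordan_Normal_Form.Determinant"
begin

section \<open>Determinants\<close>

text \<open>Call the positions between the dents of \<open>as\<close> and those of \<open>bs\<close>
  the gap. Once the base of the lower half is lengthened by \<open>z\<close> positions, every
  position outside the gap is a dent of exactly one half. So in the product of the two Vandermonde
  products a crossing is paired once with each position outside the gap and twice with each other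
  crossing. The weight therefore does not see how the dents are distributed over the halves: the sum
  over W depends only on a, b + z, x and y, and the finer structure of the sequences is left to
  K(t+), K(t-) and the quotients of H2. Since K(t+) and K(t-) depend on x and y only through x + y,
  the first form of the result follows from the second.

  The polynomials used in Andreief's identity vanish at successive positions at the two ends of the
  gap. Each entry of the determinant thus belongs to a shortened gap, and one evaluation with three
  free parameters yields the whole matrix.\<close>

definition fdet :: "nat \<Rightarrow> (nat \<Rightarrow> nat \<Rightarrow> 'a::comm_ring_1) \<Rightarrow> 'a" where
  "fdet n f = det (mat n n (\<lambda>(i, j). f i j))"

lemma fdet_leibniz:
  "fdet n f = (\<Sum>p | p permutes {0..<n}. signof p * (\<Prod>i=0..<n. f i (p i)))"
  unfolding fdet_def by (subst det_def'[of _ n]) (auto intro!: sum.cong prod.cong)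

lemma fdet_cong:
  assumes "\<And>i j. i < n \<Longrightarrow> j < n \<Longrightarrow> f i j = g i j"
  shows "fdet n f = fdet n g"
  unfolding fdet_def by (intro arg_cong[where f=det] cong_mat) (auto simp: assms)

lemma fdet_0 [simp]: "fdet 0 f = 1"
  unfolding fdet_def by (rule det_dim_zero) simp

lemma fdet_scale:
  "fdet n (\<lambda>i j. r i * c j * f i j) = (\<Prod>i<n. r i) * (\<Prod>j<n. c j) * fdet n f"
proof -
  have "signof p * (\<Prod>i=0..<n. r i * c (p i) * f i (p i)) =
      (\<Prod>i<n. r i) * (\<Prod>j<n. c j) * (signof p * (\<Prod>i=0..<n. f i (p i)))"
    if "p permutes {0..<n}" for p
    using prod.permute[OF that, of c] by (simp add: prod.distrib lessThan_atLeast0 o_def mult_ac)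
  then show ?thesis
    unfolding fdet_leibniz sum_distrib_left by (intro sum.cong) auto
qed

lemma fdet_transpose: "fdet n (\<lambda>i j. f j i) = fdet n f"
proof -
  have "fdet n f = det (transpose_mat (mat n n (\<lambda>(i, j). f i j)))"
    unfolding fdet_def by (rule det_transpose[symmetric]) auto
  also have "transpose_mat (mat n n (\<lambda>(i, j). f i j)) = mat n n (\<lambda>(i, j). f j i)" by auto
  finally show ?thesis by (simp add: fdet_def)
qed

lemma fdet_mult: "fdet n f * fdet n g = fdet n (\<lambda>i j. \<Sum>k<n. f i k * g k j)"
proof -
  have "fdet n f * fdet n g = det (mat n n (\<lambda>(i, j). f i j) * mat n n (\<lambda>(i, j). g i j))"
    unfolding fdet_def by (rule det_mult[symmetric]) auto
  also have "mat n n (\<lambda>(i, j). f i j) * mat n n (\<lambda>(i, j). g i j)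
      = mat n n (\<lambda>(i, j). \<Sum>k<n. f i k * g k j)"
    by (rule eq_matI) (auto simp: scalar_prod_def lessThan_atLeast0)
  finally show ?thesis by (simp add: fdet_def)
qed

lemma fdet_lower_triangular:
  assumes "\<And>i j. i < j \<Longrightarrow> j < n \<Longrightarrow> f i j = 0"
  shows "fdet n f = (\<Prod>i<n. f i i)"
proof -
  let ?A = "mat n n (\<lambda>(i, j). f i j)"
  have "det ?A = prod_list (diag_mat ?A)"
    by (rule det_lower_triangular[of n]) (auto simp: assms)
  also have "diag_mat ?A = map (\<lambda>i. f i i) [0..<n]"
    by (auto simp: diag_mat_def)
  also have "prod_list \<dots> = (\<Prod>i<n. f i i)"
    using prod.distinct_set_conv_list[of "[0..<n]" "\<lambda>i. f i i"] by (simp add: lessThan_atLeast0)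
  finally show ?thesis by (simp add: fdet_def)
qed

lemma fdet_upper_triangular:
  assumes "\<And>i j. j < i \<Longrightarrow> i < n \<Longrightarrow> f i j = 0"
  shows "fdet n f = (\<Prod>i<n. f i i)"
  unfolding fdet_transpose[of n f, symmetric] using assms by (intro fdet_lower_triangular) auto

lemma fdet_first_column:
  assumes "f 0 0 = 1" "\<And>i. i < n \<Longrightarrow> f (Suc i) 0 = 0"
  shows "fdet (Suc n) f = fdet n (\<lambda>i j. f (Suc i) (Suc j))"
proof -
  let ?A = "mat (Suc n) (Suc n) (\<lambda>(i, j). f i j)"
  have "det ?A = (\<Sum>i<Suc n. ?A $$ (i, 0) * cofactor ?A i 0)"
    by (rule laplace_expansion_column) auto
  also have "\<dots> = cofactor ?A 0 0"
    by (simp add: sum.lessThan_Suc_shift assms del: sum.lessThan_Suc)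
  also have "\<dots> = det (mat_delete ?A 0 0)" by (simp add: cofactor_def)
  also have "mat_delete ?A 0 0 = mat n n (\<lambda>(i, j). f (Suc i) (Suc j))"
    by (rule eq_matI) (auto simp: mat_delete_def)
  finally show ?thesis by (simp add: fdet_def)
qed

text \<open>Multiplication from the left by the unitriangular bidiagonal \<open>?D\<close> subtracts
  from every row its predecessor, and the column of ones becomes (1, 0, ..., 0). The tiling count
  uses the equation from left to right, to border a determinant of differences; the Pochhammer
  determinant uses it in the other direction, to lose a row.\<close>

lemma fdet_row_differences:
  assumes "\<And>i. i \<le> n \<Longrightarrow> f i 0 = 1"
  shows "fdet n (\<lambda>i j. f (Suc i) (Suc j) - f i (Suc j)) = fdet (Suc n) f"
proof -
  let ?D = "\<lambda>i k. if k = i then 1 else if Suc k = i then -1 else (0 :: 'a)"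
  let ?g = "\<lambda>i j. case i of 0 \<Rightarrow> f 0 j | Suc i' \<Rightarrow> f i j - f i' j"
  have "fdet (Suc n) ?D = 1"
    by (subst fdet_lower_triangular) auto
  then have "fdet (Suc n) f = fdet (Suc n) ?D * fdet (Suc n) f" by simp
  also have "\<dots> = fdet (Suc n) (\<lambda>i j. \<Sum>k<Suc n. ?D i k * f k j)" by (rule fdet_mult)
  also have "\<dots> = fdet (Suc n) ?g"
  proof (rule fdet_cong)
    fix i j assume i: "i < Suc n"
    show "(\<Sum>k<Suc n. ?D i k * f k j) = ?g i j"
    proof (cases i)
      case 0
      then show ?thesis by (simp add: sum.lessThan_Suc_shift del: sum.lessThan_Suc)
    next
      case (Suc i')
      have "(\<Sum>k<Suc n. ?D i k * f k j) = (\<Sum>k\<in>{i, i'}. ?D i k * f k j)"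
        using i Suc by (intro sum.mono_neutral_right) auto
      then show ?thesis using Suc by simp
    qed
  qed
  also have "\<dots> = fdet n (\<lambda>i j. ?g (Suc i) (Suc j))"
    by (rule fdet_first_column) (auto simp: assms)
  finally show ?thesis by simp
qed

text \<open>The matrix of values is the matrix of powers times the matrix of coefficients, and the
  latter is unitriangular.\<close>

lemma fdet_poly_monic:
  fixes x :: "nat \<Rightarrow> 'a::comm_ring_1"
  assumes "\<And>j. j < n \<Longrightarrow> degree (p j) = j" "\<And>j. j < n \<Longrightarrow> coeff (p j) j = 1"
  shows "fdet n (\<lambda>i j. poly (p j) (x i)) = fdet n (\<lambda>i k. x i ^ k)"
proof -
  have "fdet n (\<lambda>k j. coeff (p j) k) = (\<Prod>i<n. coeff (p i) i)"
    by (rule fdet_upper_triangular) (auto simp: assms coeff_eq_0)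
  also have "\<dots> = 1" by (simp add: assms)
  finally have "fdet n (\<lambda>i k. x i ^ k) = fdet n (\<lambda>i k. x i ^ k) * fdet n (\<lambda>k j. coeff (p j) k)" by simp
  also have "\<dots> = fdet n (\<lambda>i j. \<Sum>k<n. x i ^ k * coeff (p j) k)" by (rule fdet_mult)
  also have "\<dots> = fdet n (\<lambda>i j. poly (p j) (x i))"
  proof (rule fdet_cong)
    fix i j assume "j < n"
    then have "(\<Sum>k\<le>degree (p j). coeff (p j) k * x i ^ k) = (\<Sum>k<n. coeff (p j) k * x i ^ k)"
      by (intro sum.mono_neutral_left) (auto simp: assms coeff_eq_0)
    then show "(\<Sum>k<n. x i ^ k * coeff (p j) k) = poly (p j) (x i)"
      by (simp add: poly_altdef mult.commute)
  qed
  finally show ?thesis by simp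
qed

lemma degree_prod_linear:
  "degree (\<Prod>r<(j::nat). [:- y r, 1:]) = j \<and> coeff (\<Prod>r<j. [:- y r, 1 :: 'a::idom:]) j = 1"
proof -
  have "degree (\<Prod>r<j. [:- y r, 1 :: 'a:]) = (\<Sum>r<j. degree [:- y r, 1 :: 'a:])"
    by (rule degree_prod_eq_sum_degree) simp
  moreover have "lead_coeff (\<Prod>r<j. [:- y r, 1 :: 'a:]) = 1"
    by (rule trans[OF lead_coeff_prod]) simp
  ultimately show ?thesis by simp
qed

text \<open>Column \<open>j\<close> consists of values of a monic polynomial of degree
  \<open>j\<close>, so its roots \<open>y j r\<close> are arbitrary. With \<open>x r\<close> as the
  r-th root the matrix becomes lower triangular, and its diagonal gives the Vandermonde
  product.\<close>

lemma fdet_prod_linear: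
  fixes x :: "nat \<Rightarrow> 'a::idom"
  shows "fdet n (\<lambda>i j. \<Prod>r<j. x i - y j r) = (\<Prod>j<n. \<Prod>i<j. x j - x i)"
proof -
  have mono: "fdet n (\<lambda>i j. \<Prod>r<j. x i - z j r) = fdet n (\<lambda>i k. x i ^ k)" for z :: "nat \<Rightarrow> nat \<Rightarrow> 'a"
    using fdet_poly_monic[of n "\<lambda>j. \<Prod>r<j. [:- z j r, 1:]" x,
        OF conjunct1[OF degree_prod_linear] conjunct2[OF degree_prod_linear]]
    by (simp add: poly_prod)
  have "fdet n (\<lambda>i j. \<Prod>r<j. x i - x r) = (\<Prod>i<n. \<Prod>r<i. x i - x r)"
    by (rule fdet_lower_triangular) (auto intro!: prod_zero)
  then show ?thesis using mono[of y] mono[of "\<lambda>_. x"] by simp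
qed

section \<open>Andreief's identity\<close>

lemma fdet_sum_rows:
  assumes "finite S"
  shows "fdet n (\<lambda>i j. \<Sum>s\<in>S. p i s * q s j) =
    (\<Sum>f\<in>{0..<n} \<rightarrow>\<^sub>E S. (\<Prod>i=0..<n. p i (f i)) * fdet n (\<lambda>i j. q (f i) j))"
proof -
  have "fdet n (\<lambda>i j. \<Sum>s\<in>S. p i s * q s j) =
     (\<Sum>\<pi> | \<pi> permutes {0..<n}. signof \<pi> * (\<Sum>f\<in>{0..<n} \<rightarrow>\<^sub>E S. \<Prod>i=0..<n. p i (f i) * q (f i) (\<pi> i)))"
    unfolding fdet_leibniz by (subst prod_sum_PiE) (auto simp: assms)
  also have "\<dots> = (\<Sum>f\<in>{0..<n} \<rightarrow>\<^sub>E S. \<Sum>\<pi> | \<pi> permutes {0..<n}.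
       (\<Prod>i=0..<n. p i (f i)) * (signof \<pi> * (\<Prod>i=0..<n. q (f i) (\<pi> i))))"
    unfolding sum_distrib_left by (subst sum.swap) (simp add: prod.distrib mult_ac)
  finally show ?thesis unfolding fdet_leibniz by (simp add: sum_distrib_left)
qed

lemma fdet_permute_rows:
  assumes "\<pi> permutes {0..<n}"
  shows "fdet n (\<lambda>i j. f (\<pi> i) j) = signof \<pi> * fdet n f"
proof -
  have "mat n n (\<lambda>(i, j). f (\<pi> i) j) = mat n n (\<lambda>(i, j). mat n n (\<lambda>(i, j). f i j) $$ (\<pi> i, j))"
    using permutes_in_image[OF assms] by (intro cong_mat) auto
  then show ?thesis unfolding fdet_def using det_permute_rows[OF _ assms, of "mat n n (\<lambda>(i, j). f i j)"] by simp
qed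

lemma fdet_equal_rows:
  assumes "i < n" "i' < n" "i \<noteq> i'" "\<And>j. f i j = f i' j"
  shows "fdet n f = 0"
  unfolding fdet_def using assms by (intro det_identical_rows[of _ n i i']) (auto simp: row_def)

text \<open>Expanding the rows gives a sum over all functions from row indices to \<open>S\<close>.
  Those that are not injective produce two equal rows. An injective one with image \<open>D\<close>
  is the increasing enumeration of \<open>D\<close> composed with a permutation, and the sum over
  the permutations restores the determinant of \<open>p\<close>.\<close>

lemma fdet_andreief:
  fixes p :: "nat \<Rightarrow> 's::linorder \<Rightarrow> 'a::comm_ring_1"
  assumes S: "finite S"
  shows "fdet n (\<lambda>i j. \<Sum>s\<in>S. p i s * q j s) =
    (\<Sum>D | D \<subseteq> S \<and> card D = n. fdet n (\<lambda>i j. p j (sorted_list_of_set D ! i))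
       * fdet n (\<lambda>i j. q j (sorted_list_of_set D ! i)))"
proof -
  let ?e = "\<lambda>D i. sorted_list_of_set D ! i"
  let ?F = "\<lambda>f. (\<Prod>i=0..<n. p i (f i)) * fdet n (\<lambda>i j. q j (f i))"
  let ?I = "{f \<in> {0..<n} \<rightarrow>\<^sub>E S. inj_on f {0..<n}}"
  let ?P = "{\<pi>. \<pi> permutes {0..<n}}"
  let ?\<D> = "{D. D \<subseteq> S \<and> card D = n}"
  have fin: "finite ({0..<n} \<rightarrow>\<^sub>E S)" using S by (intro finite_PiE) auto
  have "fdet n (\<lambda>i j. \<Sum>s\<in>S. p i s * q j s) = (\<Sum>f\<in>{0..<n} \<rightarrow>\<^sub>E S. ?F f)"
    by (rule fdet_sum_rows[OF S, of n p "\<lambda>s j. q j s"])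
  also have "\<dots> = (\<Sum>f\<in>?I. ?F f)"
  proof (rule sum.mono_neutral_right[OF fin])
    show "\<forall>f\<in>({0..<n} \<rightarrow>\<^sub>E S) - ?I. ?F f = 0"
    proof
      fix f assume "f \<in> ({0..<n} \<rightarrow>\<^sub>E S) - ?I"
      then obtain i i' where "i < n" "i' < n" "i \<noteq> i'" "f i = f i'" by (auto simp: inj_on_def)
      then have "fdet n (\<lambda>i j. q j (f i)) = 0" by (intro fdet_equal_rows[of i n i']) auto
      then show "?F f = 0" by simp
    qed
  qed auto
  also have "\<dots> = (\<Sum>D\<in>?\<D>. \<Sum>f | f \<in> ?I \<and> f ` {0..<n} = D. ?F f)"
    by (rule sum.group[symmetric]) (use S fin in \<open>auto simp: card_image\<close>)
  also have "\<dots> = (\<Sum>D\<in>?\<D>. \<Sum>\<pi>\<in>?P. ?F (restrict (\<lambda>i. ?e D (\<pi> i)) {0..<n}))"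
  proof (intro sum.cong refl)
    fix D assume D: "D \<in> ?\<D>"
    then have fD: "finite D" using S finite_subset by blast
    have bij: "bij_betw (?e D) {0..<n} D"
      using bij_betw_nth[of "sorted_list_of_set D" "{0..<n}" D] D fD by (simp add: lessThan_atLeast0)
    show "(\<Sum>f | f \<in> ?I \<and> f ` {0..<n} = D. ?F f) = (\<Sum>\<pi>\<in>?P. ?F (restrict (\<lambda>i. ?e D (\<pi> i)) {0..<n}))"
    proof (rule sum.reindex_bij_betw[symmetric, where h="\<lambda>\<pi>. restrict (\<lambda>i. ?e D (\<pi> i)) {0..<n}"],
        intro bij_betw_imageI)
      show "inj_on (\<lambda>\<pi>. restrict (\<lambda>i. ?e D (\<pi> i)) {0..<n}) ?P"
      proof (rule inj_onI)
        fix \<pi> \<sigma> assume pi: "\<pi> \<in> ?P" "\<sigma> \<in> ?P"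
          and eq: "restrict (\<lambda>i. ?e D (\<pi> i)) {0..<n} = restrict (\<lambda>i. ?e D (\<sigma> i)) {0..<n}"
        have "\<pi> i = \<sigma> i" for i
        proof (cases "i < n")
          case True
          then have "?e D (\<pi> i) = ?e D (\<sigma> i)" using fun_cong[OF eq, of i] by simp
          moreover have "\<pi> i \<in> {0..<n}" "\<sigma> i \<in> {0..<n}"
            using pi True permutes_in_image[of _ "{0..<n}" i] by auto
          ultimately show ?thesis using bij by (auto simp: bij_betw_def inj_on_def)
        next
          case False then show ?thesis using pi by (auto simp: permutes_def)
        qed
        then show "\<pi> = \<sigma>" by auto
      qed
      show "(\<lambda>\<pi>. restrict (\<lambda>i. ?e D (\<pi> i)) {0..<n}) ` ?P = {f. f \<in> ?I \<and> f ` {0..<n} = D}"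
      proof (intro equalityI subsetI)
        fix f assume "f \<in> (\<lambda>\<pi>. restrict (\<lambda>i. ?e D (\<pi> i)) {0..<n}) ` ?P"
        then obtain \<pi> where pi: "\<pi> permutes {0..<n}" and f: "f = restrict (\<lambda>i. ?e D (\<pi> i)) {0..<n}" by auto
        have "bij_betw (\<lambda>i. ?e D (\<pi> i)) {0..<n} D"
          using bij_betw_trans[OF permutes_imp_bij[OF pi] bij] by (simp add: o_def)
        then have "bij_betw f {0..<n} D" unfolding f by (subst bij_betw_restrict_eq) auto
        then show "f \<in> {f. f \<in> ?I \<and> f ` {0..<n} = D}" using D f by (auto simp: bij_betw_def)
      next
        fix f assume f: "f \<in> {f. f \<in> ?I \<and> f ` {0..<n} = D}"
        \<comment> \<open>The permutation sends \<open>i\<close> to the place of \<open>f i\<close>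
          in the increasing list of \<open>D\<close>, and fixes everything outside the index
          range.\<close>
        define \<pi> where "\<pi> = (\<lambda>i. if i \<in> {0..<n} then the_inv_into {0..<n} (?e D) (f i) else i)"
        have bf: "bij_betw f {0..<n} D" using f by (auto simp: bij_betw_def)
        have "bij_betw (the_inv_into {0..<n} (?e D) \<circ> f) {0..<n} {0..<n}"
          by (rule bij_betw_trans[OF bf bij_betw_the_inv_into[OF bij]])
        then have "bij_betw \<pi> {0..<n} {0..<n}"
          by (rule iffD1[OF bij_betw_cong, rotated]) (simp add: \<pi>_def)
        then have pi: "\<pi> permutes {0..<n}" by (rule bij_imp_permutes) (simp add: \<pi>_def)
        have "f = restrict (\<lambda>i. ?e D (\<pi> i)) {0..<n}"
        proof
          fix i show "f i = restrict (\<lambda>i. ?e D (\<pi> i)) {0..<n} i"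
            using f bf by (cases "i < n")
              (auto simp: \<pi>_def f_the_inv_into_f_bij_betw[OF bij] bij_betw_apply PiE_def extensional_def)
        qed
        then show "f \<in> (\<lambda>\<pi>. restrict (\<lambda>i. ?e D (\<pi> i)) {0..<n}) ` ?P" using pi by auto
      qed
    qed
  qed
  also have "\<dots> = (\<Sum>D\<in>?\<D>. fdet n (\<lambda>i j. p j (?e D i)) * fdet n (\<lambda>i j. q j (?e D i)))"
  proof (intro sum.cong refl)
    fix D
    have "?F (restrict (\<lambda>i. ?e D (\<pi> i)) {0..<n})
        = signof \<pi> * (\<Prod>i=0..<n. p i (?e D (\<pi> i))) * fdet n (\<lambda>i j. q j (?e D i))" if "\<pi> \<in> ?P" for \<pi>
    proof -
      have "fdet n (\<lambda>i j. q j (restrict (\<lambda>i. ?e D (\<pi> i)) {0..<n} i)) = fdet n (\<lambda>i j. q j (?e D (\<pi> i)))"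
        by (rule fdet_cong) simp
      also have "\<dots> = signof \<pi> * fdet n (\<lambda>i j. q j (?e D i))"
        using that fdet_permute_rows[of \<pi> n "\<lambda>i j. q j (?e D i)"] by simp
      finally show ?thesis by (simp add: mult_ac)
    qed
    \<comment> \<open>The sign released by the permuted rows of \<open>q\<close> turns the products
      of \<open>p\<close> into a Leibniz sum, with the rows indexed by the functions
      \<open>p i\<close>; hence the transposition below.\<close>
    then have "(\<Sum>\<pi>\<in>?P. ?F (restrict (\<lambda>i. ?e D (\<pi> i)) {0..<n})) =
       fdet n (\<lambda>i j. p i (?e D j)) * fdet n (\<lambda>i j. q j (?e D i))"
      unfolding fdet_leibniz[of n "\<lambda>i j. p i (?e D j)"] sum_distrib_right by (intro sum.cong) auto
    then show "(\<Sum>\<pi>\<in>?P. ?F (restrict (\<lambda>i. ?e D (\<pi> i)) {0..<n})) =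
       fdet n (\<lambda>i j. p j (?e D i)) * fdet n (\<lambda>i j. q j (?e D i))"
      by (simp only: fdet_transpose[of n "\<lambda>i j. p i (?e D j)", symmetric])
  qed
  finally show ?thesis .
qed

text \<open>
  Differences of consecutive rows turn the determinant of size \<open>n + 1\<close> for \<open>(\<alpha>, \<beta>)\<close> into a multiple
  of the one of size \<open>n\<close> for \<open>(\<alpha> + 1, \<beta> + 2)\<close>.
\<close>

lemma fdet_pochhammer_quotient:
  fixes \<alpha> \<beta> :: real
  assumes "\<beta> > 0"
  shows "fdet n (\<lambda>i j. pochhammer (\<alpha> + real i) j / pochhammer (\<beta> + real i) j) =
    (\<Prod>i<n. fact i * pochhammer (\<beta> - \<alpha>) i / pochhammer (\<beta> + real i) (n - 1))"
  using assms
proof (induction n arbitrary: \<alpha> \<beta>)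
  case 0
  then show ?case by simp
next
  case (Suc n)
  define G where "G = (\<lambda>i j. pochhammer (\<alpha> + real i) j / pochhammer (\<beta> + real i) j)"
  define r where "r = (\<lambda>i. 1 / ((\<beta> + real i) * (\<beta> + real i + 1)))"
  define c where "c = (\<lambda>j::nat. (real j + 1) * (\<beta> - \<alpha>))"
  have pos: "pochhammer (\<beta> + real i) k > 0" for i k
    using Suc.prems by (intro pochhammer_pos) simp
  have diff: "G (Suc i) (Suc j) - G i (Suc j)
      = r i * c j * (pochhammer (\<alpha> + 1 + real i) j / pochhammer (\<beta> + 2 + real i) j)" for i j
  proof -
    define A B where "A = \<alpha> + real i" and "B = \<beta> + real i"
    define P where "P = pochhammer (A + 1) j"
    define Q where "Q = pochhammer (B + 1 + 1) j"
    have B: "B > 0" using Suc.prems by (simp add: B_def)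
    then have Q: "Q > 0" unfolding Q_def by (intro pochhammer_pos) simp
    have q1: "pochhammer (B + 1) (Suc j) = (B + 1) * Q"
      by (simp add: pochhammer_rec Q_def)
    have q2: "(B + 1 + real j) * pochhammer B (Suc j) = B * pochhammer (B + 1) (Suc j)"
      by (simp add: pochhammer_rec'[of "B + 1"] pochhammer_rec[of B])
    have q3: "pochhammer B (Suc j) = B * ((B + 1) * Q) / (B + 1 + real j)"
      using q2 q1 B by (simp add: field_simps)
    have "G (Suc i) (Suc j) - G i (Suc j) = P * (A + 1 + real j) / ((B + 1) * Q)
        - A * P * (B + 1 + real j) / (B * ((B + 1) * Q))"
      unfolding G_def using q1 q3
      by (simp add: A_def B_def P_def add_ac pochhammer_rec[of A] pochhammer_rec'[of "A + 1"] mult_ac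
          pochhammer_rec[of "\<alpha> + real i"] pochhammer_rec'[of "1 + (\<alpha> + real i)"])
    \<comment> \<open>The common numerator is
      \<open>B * (A + 1 + j) - A * (B + 1 + j) = (j + 1) * (B - A)\<close>. It separates into a row
      factor and a column factor.\<close>
    also have "\<dots> = (real j + 1) * (B - A) / (B * (B + 1)) * (P / Q)"
      using B Q by (simp add: divide_simps) (simp add: algebra_simps)
    finally show ?thesis by (simp add: A_def B_def P_def Q_def r_def c_def add_ac)
  qed
  have "fdet (Suc n) G = fdet n (\<lambda>i j. G (Suc i) (Suc j) - G i (Suc j))"
    by (rule fdet_row_differences[symmetric]) (simp add: G_def)
  also have "\<dots> = (\<Prod>i<n. r i) * (\<Prod>j<n. c j) *
      (\<Prod>i<n. fact i * pochhammer (\<beta> + 2 - (\<alpha> + 1)) i / pochhammer (\<beta> + 2 + real i) (n - 1))"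
    unfolding diff fdet_scale using Suc.prems by (subst Suc.IH) auto
  also have "\<dots> = (\<Prod>i<n. c i * (fact i * pochhammer (\<beta> - \<alpha> + 1) i)) *
      (\<Prod>i<n. r i / pochhammer (\<beta> + 2 + real i) (n - 1))"
    by (simp add: prod.distrib prod_dividef mult_ac diff_diff_eq2 algebra_simps)
  also have "(\<Prod>i<n. c i * (fact i * pochhammer (\<beta> - \<alpha> + 1) i)) = (\<Prod>i<Suc n. fact i * pochhammer (\<beta> - \<alpha>) i)"
    unfolding prod.lessThan_Suc_shift by (simp add: c_def pochhammer_rec mult_ac add_ac)
  \<comment> \<open>The two factors of \<open>1 / r i\<close> lengthen
    \<open>pochhammer (\<beta> + 2 + i) (n - 1)\<close> to \<open>n + 1\<close> factors starting at
    \<open>\<beta> + i\<close>. Their last factors \<open>\<beta> + n + i\<close> together form the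
    factor of the longer product at index \<open>n\<close>.\<close>
  also have "(\<Prod>i<n. r i / pochhammer (\<beta> + 2 + real i) (n - 1)) = (\<Prod>i<Suc n. 1 / pochhammer (\<beta> + real i) n)"
  proof (cases n)
    case (Suc k)
    have "r i / pochhammer (\<beta> + 2 + real i) (n - 1) = 1 / (pochhammer (\<beta> + real i) n * (\<beta> + real n + real i))" for i
    proof -
      have "pochhammer (\<beta> + real i) (Suc n) = (\<beta> + real i) * ((\<beta> + real i + 1) * pochhammer (\<beta> + real i + 1 + 1) k)"
        unfolding Suc by (simp only: pochhammer_rec)
      then show ?thesis
        by (simp add: Suc r_def pochhammer_Suc add_ac mult_ac)
    qed
    then have "(\<Prod>i<n. r i / pochhammer (\<beta> + 2 + real i) (n - 1)) =
       (\<Prod>i<n. 1 / pochhammer (\<beta> + real i) n) * (1 / pochhammer (\<beta> + real n) n)"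
      by (simp add: prod_dividef pochhammer_prod[of _ n] prod.distrib lessThan_atLeast0)
    then show ?thesis by simp
  qed simp
  finally show ?case by (simp add: G_def prod_dividef prod.distrib)
qed

section \<open>The sum over the lozenges crossing the line\<close>

text \<open>This is \<open>(s + 1/2)^2 - 1/4\<close>, where \<open>s + 1/2\<close> is the abscissa
  of the midpoint of the base edge at position \<open>s\<close>. It is unchanged when that point is
  reflected in the vertical axis.\<close>

definition lam :: "nat \<Rightarrow> real" where
  "lam s = real s * (real s + 1)"

text \<open>The double factorial (2m - 1)!!, indexed by its number of factors, so that (-1)!! is
  \<open>df 0\<close>.\<close>

definition df :: "nat \<Rightarrow> real" where
  "df m = (\<Prod>r<m. 2 * real r + 1)"

definition vand :: "nat set \<Rightarrow> real" where
  "vand D = (\<Prod>t\<in>D. \<Prod>s\<in>{s\<in>D. s < t}. lam t - lam s)"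

text \<open>The contribution of a crossing at \<open>s\<close> through its pairs with all positions
  outside the gap from \<open>a\<close> to \<open>N\<close>. For \<open>s\<close> in the gap every
  factor is positive.\<close>

definition gap_weight :: "nat \<Rightarrow> nat \<Rightarrow> nat \<Rightarrow> nat \<Rightarrow> real" where
  "gap_weight a c N s = (\<Prod>f<a. lam s - lam f) * (\<Prod>f=N..<N+c. lam f - lam s)"

definition gap_sum :: "nat \<Rightarrow> nat \<Rightarrow> nat \<Rightarrow> nat \<Rightarrow> real" where
  "gap_sum n a c N = (\<Sum>D | D \<subseteq> {a..<N} \<and> card D = n. (vand D)\<^sup>2 * (\<Prod>s\<in>D. gap_weight a c N s))"

definition moment :: "nat \<Rightarrow> nat \<Rightarrow> nat \<Rightarrow> real" where
  "moment a c N = (\<Sum>s=a..<N. gap_weight a c N s)"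

section \<open>Closed form of the moments\<close>

lemma df_Suc [simp]: "df (Suc m) = df m * (2 * real m + 1)"
  and df_0 [simp]: "df 0 = 1"
  by (simp_all add: df_def)

lemma df_pos [simp]: "df m > 0"
  unfolding df_def by (intro prod_pos) auto

lemma df_nonzero [simp]: "df m \<noteq> 0"
  by (metis df_pos less_irrefl)

lemma lam_diff: "lam s - lam t = (real s - real t) * (real s + real t + 1)"
  by (simp add: lam_def algebra_simps)

lemma lam_strict_mono: "s < t \<Longrightarrow> lam s < lam t"
  using lam_diff[of t s] by (smt (verit) mult_pos_pos of_nat_0_le_iff of_nat_less_iff)

lemma df_add: "df (m + n) = df m * 2 ^ n * pochhammer (real m + 1 / 2) n"
  by (induction n) (auto simp: pochhammer_Suc field_simps)

text \<open>By \<open>lam_diff\<close> each factor is \<open>(s - f) * (s + f + 1)\<close>; the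
  first factors make up s! / (s - a)!, the second ones (s + a)! / s!.\<close>

lemma prod_lam_below:
  "a \<le> s \<Longrightarrow> (\<Prod>f<a. lam s - lam f) = fact (s + a) / fact (s - a)"
proof (induction a)
  case (Suc a)
  then obtain t where t: "s = Suc a + t" by (metis le_Suc_ex)
  have "(\<Prod>f<Suc a. lam s - lam f) = fact (s + a) / fact (Suc t) * (lam s - lam a)"
    using Suc t by simp
  also have "\<dots> = fact (s + Suc a) / fact (s - Suc a)"
    by (simp add: t lam_diff divide_simps)
  finally show ?case .
qed simp

text \<open>With \<open>c + 1\<close> right-hand factors, the weights for \<open>N\<close> and
  \<open>N + 1\<close> share the \<open>c\<close> factors of the weight for \<open>c\<close> and
  \<open>N + 1\<close>; they differ only in one factor, and \<open>lam s\<close> cancels from the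
  difference. The extra summand at \<open>s = N\<close> vanishes because the weight for
  \<open>N\<close> contains \<open>lam N - lam N\<close>.\<close>

lemma moment_step:
  "moment a (Suc c) (Suc N) = moment a (Suc c) N + (lam (N + 1 + c) - lam N) * moment a c (Suc N)"
proof -
  have w: "gap_weight a (Suc c) (Suc N) s - gap_weight a (Suc c) N s
      = (lam (N + 1 + c) - lam N) * gap_weight a c (Suc N) s" for s
  proof -
    define Q where "Q = (\<Prod>f=Suc N..<Suc N + c. lam f - lam s)"
    have l: "(\<Prod>f=N..<N + Suc c. lam f - lam s) = (lam N - lam s) * Q"
      unfolding Q_def by (subst prod.atLeast_Suc_lessThan) simp_all
    have u: "(\<Prod>f=Suc N..<Suc N + Suc c. lam f - lam s) = Q * (lam (N + 1 + c) - lam s)"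
      unfolding Q_def by simp
    show ?thesis unfolding gap_weight_def l u Q_def[symmetric] by (simp only: algebra_simps)
  qed
  have z: "gap_weight a (Suc c) N N = 0"
  proof -
    have "(\<Prod>f=N..<N + Suc c. lam f - lam N) = 0" by (rule prod_zero) auto
    then show ?thesis by (simp add: gap_weight_def del: prod.op_ivl_Suc)
  qed
  show ?thesis
  proof (cases "a \<le> N")
    case True
    have "moment a (Suc c) (Suc N) = (\<Sum>s=a..<Suc N. gap_weight a (Suc c) N s
        + (lam (N + 1 + c) - lam N) * gap_weight a c (Suc N) s)"
      unfolding moment_def by (intro sum.cong refl) (use w in \<open>simp add: algebra_simps\<close>)
    also have "\<dots> = (\<Sum>s=a..<Suc N. gap_weight a (Suc c) N s) + (lam (N + 1 + c) - lam N) * moment a c (Suc N)"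
      by (simp only: sum.distrib sum_distrib_left moment_def)
    also have "(\<Sum>s=a..<Suc N. gap_weight a (Suc c) N s) = moment a (Suc c) N"
      using True z by (simp add: moment_def)
    finally show ?thesis .
  qed (auto simp: moment_def)
qed

text \<open>Outer induction on \<open>c\<close>, inner induction on the length \<open>X + 1\<close>
  of the gap; \<open>moment_step\<close> links the two. For \<open>c = 0\<close> the weight is (2a +
  t)! / t!, whose partial sums telescope.\<close>

lemma moment_closed:
  "moment a c (a + Suc X) = fact c * fact (X + 2 * a + c + 1) * df (X + a + c + 1) * df a
     / (fact X * df (X + a + 1) * df (a + c + 1))"
proof (induction c arbitrary: X)
  case 0
  have w: "gap_weight a 0 N (a + t) = fact (2 * a + t) / fact t" for N t
    using prod_lam_below[of a "a + t"] by (simp add: gap_weight_def add_ac mult_2)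
  have "moment a 0 (a + Suc X) = fact (X + 2 * a + 1) / (fact X * (2 * real a + 1))"
  proof (induction X)
    case 0
    show ?case using w[of "Suc a" 0] by (simp add: moment_def add.commute)
  next
    case (Suc X)
    have "moment a 0 (a + Suc (Suc X)) = moment a 0 (a + Suc X) + fact (2 * a + Suc X) / fact (Suc X)"
      using w[of _ "Suc X"] by (simp add: moment_def gap_weight_def)
    then show ?case unfolding Suc
      by (simp add: divide_simps add_ac) (simp add: algebra_simps)
  qed
  then show ?case by (simp add: divide_simps)
next
  case (Suc c)
  note IH = Suc
  define P where "P = (\<lambda>X. (fact (Suc c) * fact (X + 2 * a + Suc c + 1) * df (X + a + Suc c + 1) * df a
     / (fact X * df (X + a + 1) * df (a + Suc c + 1)) :: real))"
  have "moment a (Suc c) (a + Suc X) = P X"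
  proof (induction X)
    case 0
    have "moment a (Suc c) (a + Suc 0) = (lam (a + 1 + c) - lam a) * moment a c (a + Suc 0)"
      using moment_step[of a c a] by (simp add: moment_def)
    also have "\<dots> = P 0"
      unfolding IH lam_diff P_def by (simp add: divide_simps)
    finally show ?case .
  next
    case (Suc X)
    have "moment a (Suc c) (a + Suc (Suc X)) = P X
        + (lam (a + Suc X + 1 + c) - lam (a + Suc X)) * moment a c (a + Suc (Suc X))"
      using moment_step[of a c "a + Suc X"] Suc by simp
    also have "\<dots> = P (Suc X)"
    proof -
      \<comment> \<open>The common factor of the three closed forms; after dividing by it a
        polynomial identity remains.\<close>
      define G :: real where "G = fact c * fact (X + 2 * a + c + 2) * df (X + a + c + 2) * df a
        / (fact (Suc X) * df (X + a + 2) * df (a + c + 2))"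
      have p1: "P X = G * ((c + 1) * (X + 1) * (2 * X + 2 * a + 3))"
        unfolding P_def G_def by (simp add: divide_simps) (simp add: algebra_simps)
      have p2: "moment a c (a + Suc (Suc X)) = G * (2 * a + 2 * c + 3)"
        unfolding IH G_def by (simp add: divide_simps)
      have p3: "P (Suc X) = G * ((c + 1) * (X + 2 * a + c + 3) * (2 * X + 2 * a + 2 * c + 5))"
        unfolding P_def G_def by (simp add: divide_simps) (simp add: algebra_simps)
      show ?thesis unfolding p1 p2 p3 lam_diff by (simp add: algebra_simps)
    qed
    finally show ?case .
  qed
  then show ?case by (simp add: P_def)
qed
text \<open>Here 1 / r! is read as 0 for negative r, in agreement with the Pochhammer symbol, which
  vanishes for \<open>m > X\<close>. This lets the moments of an empty gap obey the same formula as
  the others.\<close>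

lemma fact_falling:
  "(if m \<le> X then 1 / fact (X - m) else 0) = ((-1) ^ m * pochhammer (- real X) m / fact X :: real)"
proof (induction m)
  case (Suc m)
  have "(-1) ^ Suc m * pochhammer (- real X) (Suc m) / fact X
      = (if m \<le> X then 1 / fact (X - m) else 0) * (real X - real m)"
    unfolding Suc by (simp add: pochhammer_Suc algebra_simps add_divide_distrib diff_divide_distrib)
  also have "\<dots> = (if Suc m \<le> X then 1 / fact (X - Suc m) else 0)"
  proof (cases "Suc m \<le> X")
    case True
    then obtain t where "X = Suc m + t" by (metis le_Suc_ex)
    then show ?thesis by (simp add: divide_simps)
  next
    case False
    then show ?thesis by (cases "m = X") auto
  qed
  finally show ?case by simp
qed simp

lemma vand_sorted:
  assumes "finite D" "card D = n"
  shows "vand D = (\<Prod>j<n. \<Prod>i<j. lam (sorted_list_of_set D ! j) - lam (sorted_list_of_set D ! i))"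
proof -
  let ?e = "\<lambda>i. sorted_list_of_set D ! i"
  have bij: "bij_betw ?e {..<n} D"
    using bij_betw_nth[of "sorted_list_of_set D" "{..<n}" D] assms by simp
  have mono: "?e i < ?e j" if "i < j" "j < n" for i j
    using sorted_wrt_nth_less[OF strict_sorted_list_of_set[of D] that(1)] that(2) assms by simp
  have "vand D = (\<Prod>j<n. \<Prod>s\<in>{s\<in>D. s < ?e j}. lam (?e j) - lam s)"
    unfolding vand_def by (rule prod.reindex_bij_betw[OF bij, symmetric])
  also have "\<dots> = (\<Prod>j<n. \<Prod>i<j. lam (?e j) - lam (?e i))"
  proof (rule prod.cong[OF refl])
    fix j assume j: "j \<in> {..<n}"
    have "bij_betw ?e {..<j} {s\<in>D. s < ?e j}"
    proof (rule bij_betw_imageI)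
      show "inj_on ?e {..<j}" by (rule inj_on_subset[of _ "{..<n}"]) (use bij j in \<open>auto simp: bij_betw_def\<close>)
      have "\<exists>i<j. s = ?e i" if "s \<in> D" "s < ?e j" for s
      proof -
        have "s \<in> ?e ` {..<n}" using bij that by (simp add: bij_betw_def)
        then obtain i where i: "i < n" "s = ?e i" by auto
        then have "i < j" using mono[of j i] that by (metis less_asym less_irrefl linorder_neqE_nat)
        then show ?thesis using i by auto
      qed
      then show "?e ` {..<j} = {s\<in>D. s < ?e j}"
        using mono j bij by (auto simp: bij_betw_def)
    qed
    then show "(\<Prod>s\<in>{s\<in>D. s < ?e j}. lam (?e j) - lam s) = (\<Prod>i<j. lam (?e j) - lam (?e i))"
      by (rule prod.reindex_bij_betw[symmetric])
  qed
  finally show ?thesis .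
qed

lemma vand_pos:
  "finite D \<Longrightarrow> vand D > 0"
  unfolding vand_def by (intro prod_pos) (auto simp: lam_strict_mono)

text \<open>
  Andreief's identity with the polynomials \<open>\<Prod>r<i. X - lam (a + r)\<close> and \<open>\<Prod>r<j. X - lam (N - 1 - r)\<close>:
  multiplied by them, the weight becomes, up to sign, the weight with shifted parameters.
\<close>

lemma gap_sum_det:
  assumes "n \<le> N"
  shows "gap_sum n a c N = fdet n (\<lambda>i j. (-1) ^ j * moment (a + i) (c + j) (N - j))"
proof -
  let ?w = "gap_weight a c N"
  define p where "p = (\<lambda>i s. ?w s * (\<Prod>r<i. lam s - lam (a + r)))"
  define q where "q = (\<lambda>j s. \<Prod>r<j. lam s - lam (N - 1 - r))"
  let ?e = "\<lambda>D i. sorted_list_of_set D ! i"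
  have entry: "(\<Sum>s\<in>{a..<N}. p i s * q j s) = (-1) ^ j * moment (a + i) (c + j) (N - j)"
    if "i < n" "j < n" for i j
  proof -
    have w: "p i s * q j s = (-1) ^ j * gap_weight (a + i) (c + j) (N - j) s" for s
    proof -
      have 1: "(\<Prod>f<a + i. lam s - lam f) = (\<Prod>f<a. lam s - lam f) * (\<Prod>r<i. lam s - lam (a + r))"
        by (induction i) auto
      have "(\<Prod>r<j. lam s - lam (N - 1 - r)) = (-1) ^ j * (\<Prod>r<j. lam (N - 1 - r) - lam s)"
        by (induction j) (auto simp: algebra_simps)
      also have "(\<Prod>r<j. lam (N - 1 - r) - lam s) = (\<Prod>f=N-j..<N. lam f - lam s)"
        by (rule prod.reindex_bij_witness[of _ "\<lambda>f. N - 1 - f" "\<lambda>r. N - 1 - r"])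
          (use that assms in auto)
      finally have 2: "(\<Prod>r<j. lam s - lam (N - 1 - r)) * (\<Prod>f=N..<N+c. lam f - lam s)
          = (-1) ^ j * (\<Prod>f=N-j..<N-j+(c+j). lam f - lam s)"
        using prod.atLeastLessThan_concat[of "N - j" N "N + c" "\<lambda>f. lam f - lam s"] that assms
        by (simp add: add.commute)
      show ?thesis using 1 2 by (simp add: p_def q_def gap_weight_def mult_ac)
    qed
    \<comment> \<open>The shifted weight vanishes at those positions of the old gap that no longer
      belong to the shorter one.\<close>
    have "(\<Sum>s\<in>{a..<N}. gap_weight (a + i) (c + j) (N - j) s) = moment (a + i) (c + j) (N - j)"
      unfolding moment_def
    proof (rule sum.mono_neutral_right)
      show "\<forall>s\<in>{a..<N} - {a + i..<N - j}. gap_weight (a + i) (c + j) (N - j) s = 0"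
      proof
        fix s assume s: "s \<in> {a..<N} - {a + i..<N - j}"
        then consider "s < a + i" | "N - j \<le> s" "s < N" by auto
        then show "gap_weight (a + i) (c + j) (N - j) s = 0"
        proof cases
          case 1
          then have "(\<Prod>f<a + i. lam s - lam f) = 0" by (intro prod_zero) auto
          then show ?thesis by (simp add: gap_weight_def)
        next
          case 2
          then have "(\<Prod>f=N-j..<N-j+(c+j). lam f - lam s) = 0" by (intro prod_zero) auto
          then show ?thesis by (simp add: gap_weight_def)
        qed
      qed
    qed auto
    then show ?thesis unfolding w by (simp add: sum_distrib_left[symmetric])
  qed
  have "fdet n (\<lambda>i j. (-1) ^ j * moment (a + i) (c + j) (N - j)) = fdet n (\<lambda>i j. \<Sum>s\<in>{a..<N}. p i s * q j s)"
    by (rule fdet_cong) (simp add: entry)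
  also have "\<dots> = (\<Sum>D | D \<subseteq> {a..<N} \<and> card D = n. fdet n (\<lambda>i j. p j (?e D i)) * fdet n (\<lambda>i j. q j (?e D i)))"
    by (rule fdet_andreief) simp
  also have "\<dots> = gap_sum n a c N"
    unfolding gap_sum_def
  proof (rule sum.cong[OF refl])
    fix D assume "D \<in> {D. D \<subseteq> {a..<N} \<and> card D = n}"
    then have D: "finite D" "card D = n" using finite_subset[of D "{a..<N}"] by auto
    have bij: "bij_betw (?e D) {..<n} D"
      using bij_betw_nth[of "sorted_list_of_set D" "{..<n}" D] D by simp
    have "fdet n (\<lambda>i j. p j (?e D i)) = (\<Prod>i<n. ?w (?e D i)) * vand D"
      using fdet_scale[of n "\<lambda>i. ?w (?e D i)" "\<lambda>_. 1" "\<lambda>i j. \<Prod>r<j. lam (?e D i) - lam (a + r)"]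
      by (simp add: p_def fdet_prod_linear vand_sorted[OF D])
    moreover have "fdet n (\<lambda>i j. q j (?e D i)) = vand D"
      unfolding q_def using fdet_prod_linear[of n "\<lambda>i. lam (?e D i)" "\<lambda>_ r. lam (N - 1 - r)"]
      by (simp add: vand_sorted[OF D])
    moreover have "(\<Prod>i<n. ?w (?e D i)) = (\<Prod>s\<in>D. ?w s)"
      by (rule prod.reindex_bij_betw[OF bij])
    ultimately show "fdet n (\<lambda>i j. p j (?e D i)) * fdet n (\<lambda>i j. q j (?e D i))
        = (vand D)\<^sup>2 * (\<Prod>s\<in>D. ?w s)"
      by (simp add: power2_eq_square mult_ac)
  qed
  finally show ?thesis ..
qed

text \<open>By \<open>moment_closed\<close> the entry at i, j is a row factor times a column factor
  times a function of \<open>i + j\<close>. Up to further row and column factors that function is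
  the quotient in \<open>fdet_pochhammer_quotient\<close> with \<open>- X\<close> for
  \<open>\<alpha>\<close>, where \<open>X + 1 = n + x\<close> is the length of the gap.\<close>

lemma gap_sum_closed:
  "gap_sum n a c (a + n + x) = (\<Prod>i<n. fact (c + i) * fact i * df (a + i) * fact (x + 2 * a + c + n + i)
     * df (x + a + c + n + i) / (fact (x + i) * df (x + a + 1 + i) * df (a + c + n + i)))"
proof (cases n)
  case 0
  have "{D. D \<subseteq> {a..<a + x} \<and> card D = 0} = {{}}"
    by (auto dest: finite_subset[of _ "{a..<a + x}"])
  then show ?thesis using 0 by (simp add: gap_sum_def vand_def)
next
  case (Suc k)
  define X where "X = x + k"
  define B where "B = a + c + 1"
  \<comment> \<open>The half comes from \<open>df_add\<close>, which writes a product of odd numbers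
    as a Pochhammer symbol.\<close>
  define \<beta> where "\<beta> = real B + 1 / 2"
  have \<beta>: "\<beta> > 0" by (simp add: \<beta>_def)
  have bpos: "pochhammer (\<beta> + real i) j > 0" for i j
    using \<beta> by (intro pochhammer_pos) simp
  \<comment> \<open>The part of the entry that depends on \<open>i + j\<close> only.\<close>
  define h where "h = (\<lambda>m. (if m \<le> X then 1 / fact (X - m) else 0) / df (B + m))"
  have h: "h m = (-1/2) ^ m * pochhammer (- real X) m / pochhammer \<beta> m / (fact X * df B)" for m
    unfolding h_def fact_falling df_add[of B m] \<beta>_def power_divide by (simp add: mult_ac)
  define R where "R = (\<lambda>i. df (a + i) * fact (X + 2 * a + c + 1 + i))"
  define C where "C = (\<lambda>j. fact (c + j) / df (X + a + 1 - j))"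
  have ent: "(-1) ^ j * moment (a + i) (c + j) (a + n + x - j)
      = (R i * df (B + X) * h i) * ((1 / 2) ^ j * C j) *
        (pochhammer (- real X + real i) j / pochhammer (\<beta> + real i) j)" if "i < n" "j < n" for i j
  proof -
    have "moment (a + i) (c + j) (a + n + x - j) = R i * df (B + X) * C j * h (i + j)"
    proof (cases "i + j \<le> X")
      case True
      then obtain t where t: "X = i + j + t" by (metis le_Suc_ex)
      then have e: "a + n + x - j = (a + i) + Suc t" "X + a + 1 - j = t + (a + i) + 1" "X - (i + j) = t"
        "X + 2 * a + c + 1 + i = t + 2 * (a + i) + (c + j) + 1" "B + X = t + (a + i) + (c + j) + 1"
        "B + (i + j) = (a + i) + (c + j) + 1"
        using Suc by (auto simp: X_def B_def)
      show ?thesis unfolding R_def C_def h_def e moment_closed using t by (simp add: mult_ac)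
    next
      \<comment> \<open>The gap of this moment is empty, and \<open>h\<close> is 0 by its
        convention.\<close>
      case False
      then have "a + n + x - j \<le> a + i" using Suc by (simp add: X_def)
      then have "moment (a + i) (c + j) (a + n + x - j) = 0" by (simp add: moment_def)
      then show ?thesis using False by (simp add: h_def)
    qed
    moreover have "h (i + j) = h i * (-1/2) ^ j * (pochhammer (- real X + real i) j / pochhammer (\<beta> + real i) j)"
      unfolding h by (simp add: pochhammer_product' power_add mult_ac)
    moreover have "(-1) ^ j * (-1/2) ^ j = ((1 / 2) ^ j :: real)"
      by (simp add: power_mult_distrib[symmetric])
    ultimately show ?thesis by (simp add: mult_ac)
  qed
  have "gap_sum n a c (a + n + x) = fdet n (\<lambda>i j. (-1) ^ j * moment (a + i) (c + j) (a + n + x - j))"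
    by (rule gap_sum_det) simp
  also have "\<dots> = fdet n (\<lambda>i j. (R i * df (B + X) * h i) * ((1 / 2) ^ j * C j) *
        (pochhammer (- real X + real i) j / pochhammer (\<beta> + real i) j))"
    by (rule fdet_cong) (rule ent)
  also have "\<dots> = (\<Prod>i<n. R i * df (B + X) * h i) * (\<Prod>j<n. (1 / 2) ^ j * C j) *
      (\<Prod>i<n. fact i * pochhammer (\<beta> + real X) i / pochhammer (\<beta> + real i) k)"
    unfolding fdet_scale fdet_pochhammer_quotient[OF \<beta>] by (simp add: Suc)
  also have "\<dots> = (\<Prod>i<n. R i * fact (c + i) * fact i * df (B + X + i) / df (B + i + k)
      * (1 / (fact (X - i) * df (X + a + 1 - i))) * (2 ^ k / 4 ^ i))"
    unfolding prod.distrib[symmetric]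
  proof (rule prod.cong[OF refl])
    fix i assume "i \<in> {..<n}"
    then have i: "i \<le> X" using Suc by (simp add: X_def)
    have 1: "df (B + X) * pochhammer (\<beta> + real X) i = df (B + X + i) / 2 ^ i"
      unfolding df_add[of "B + X" i] \<beta>_def by (simp add: add_ac)
    have 2: "1 / (df (B + i) * pochhammer (\<beta> + real i) k) = 2 ^ k / df (B + i + k)"
      unfolding df_add[of "B + i" k] \<beta>_def by (simp add: add_ac)
    have "R i * df (B + X) * h i * ((1 / 2) ^ i * C i) * (fact i * pochhammer (\<beta> + real X) i / pochhammer (\<beta> + real i) k)
      = R i * fact (c + i) * fact i * (df (B + X) * pochhammer (\<beta> + real X) i)
        * (1 / (df (B + i) * pochhammer (\<beta> + real i) k)) * (1 / 2) ^ i * (1 / (fact (X - i) * df (X + a + 1 - i)))"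
      using i by (simp add: h_def C_def mult_ac)
    also have "\<dots> = R i * fact (c + i) * fact i * df (B + X + i) / df (B + i + k)
      * (1 / (fact (X - i) * df (X + a + 1 - i))) * (2 ^ k * ((1 / 2) ^ i * (1 / 2) ^ i))"
      unfolding 1 2 by (simp add: power_one_over)
    also have "(1 / 2) ^ i * (1 / 2) ^ i = (1 / 4 ^ i :: real)"
      by (simp add: power_mult_distrib[symmetric] power_one_over)
    finally show "R i * df (B + X) * h i * ((1 / 2) ^ i * C i) * (fact i * pochhammer (\<beta> + real X) i / pochhammer (\<beta> + real i) k)
      = R i * fact (c + i) * fact i * df (B + X + i) / df (B + i + k)
      * (1 / (fact (X - i) * df (X + a + 1 - i))) * (2 ^ k / 4 ^ i)" by simp
  qed
  also have "\<dots> = (\<Prod>i<n. R i * fact (c + i) * fact i * df (B + X + i) / df (B + i + k)) *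
     (\<Prod>i<n. 1 / (fact (X - i) * df (X + a + 1 - i))) * (\<Prod>i<n. 2 ^ k / 4 ^ i)"
    by (simp only: prod.distrib)
  \<comment> \<open>Numerator and denominator are both \<open>2 ^ (n * (n - 1))\<close>.\<close>
  also have "(\<Prod>i<n. 2 ^ k / 4 ^ i) = (1 :: real)"
  proof -
    have four: "(\<Prod>i<m. 4 ^ i :: real) = 2 ^ (m * (m - 1))" for m
    proof (induction m)
      case (Suc m)
      have "(4 :: real) ^ m = 2 ^ (2 * m)" by (simp add: power_mult)
      then show ?case using Suc by (cases m) (simp_all add: power_add[symmetric] algebra_simps)
    qed simp
    show ?thesis unfolding prod_dividef four by (simp add: Suc power_mult[symmetric] mult.commute power_add)
  qed
  \<comment> \<open>Taking the factors in reverse order replaces \<open>X - i\<close> by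
    \<open>x + i\<close>.\<close>
  also have "(\<Prod>i<n. 1 / (fact (X - i) * df (X + a + 1 - i))) = (\<Prod>i<n. 1 / (fact (x + i) * df (x + a + 1 + i)))"
  proof -
    have "(\<Prod>i<n. 1 / (fact (x + i) * df (x + a + 1 + i))) = (\<Prod>i<n. 1 / (fact (x + (n - Suc i)) * df (x + a + 1 + (n - Suc i))))"
      by (rule prod.nat_diff_reindex[symmetric])
    also have "\<dots> = (\<Prod>i<n. 1 / (fact (X - i) * df (X + a + 1 - i)))"
    proof (intro prod.cong refl)
      fix i assume "i \<in> {..<n}"
      then have "X - i = x + (n - Suc i)" "X + a + 1 - i = x + a + 1 + (n - Suc i)"
        by (auto simp: X_def Suc)
      then show "1 / (fact (x + (n - Suc i)) * df (x + a + 1 + (n - Suc i))) = 1 / (fact (X - i) * df (X + a + 1 - i))"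
        by (simp only:)
    qed
    finally show ?thesis ..
  qed
  also have "(\<Prod>i<n. R i * fact (c + i) * fact i * df (B + X + i) / df (B + i + k)) *
     (\<Prod>i<n. 1 / (fact (x + i) * df (x + a + 1 + i))) * 1 =
     (\<Prod>i<n. fact (c + i) * fact i * df (a + i) * fact (x + 2 * a + c + n + i)
     * df (x + a + c + n + i) / (fact (x + i) * df (x + a + 1 + i) * df (a + c + n + i)))"
    unfolding prod.distrib[symmetric] mult_1_right
    by (intro prod.cong refl) (simp add: R_def B_def X_def Suc add_ac mult_ac)
  finally show ?thesis .
qed

section \<open>The factors of the theorem as products of factorials\<close>

lemma odd_dfact_eq: "odd_dfact (2 * int m - 1) = df m"
proof -
  have "{j \<in> {1..2 * int m - 1}. odd j} = (\<lambda>r. 2 * int r + 1) ` {..<m}"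
  proof (intro equalityI subsetI)
    fix j assume "j \<in> {j \<in> {1..2 * int m - 1}. odd j}"
    then obtain k where "j = 2 * k + 1" "0 \<le> k" "k < int m" by (auto elim!: oddE)
    then have "j = 2 * int (nat k) + 1" "nat k < m" by auto
    then show "j \<in> (\<lambda>r. 2 * int r + 1) ` {..<m}" by blast
  qed auto
  then show ?thesis
    unfolding odd_dfact_def df_def by (simp add: prod.reindex inj_on_def)
qed

lemma H_add: "H (n + m) = H n * (\<Prod>i<m. fact (n + i))"
  by (induction m) (auto simp: H_def mult_ac)

lemma H_pos: "H n > 0"
  unfolding H_def by (intro prod_pos) auto

lemma H2_pos: "H2 n > 0"
  unfolding H2_def by (intro prod_pos) auto

lemma step2_pochhammer_df: "step2_pochhammer (2 * real m + 1) n = df (m + n) / df m"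
proof (induction n)
  case (Suc n)
  have "step2_pochhammer (2 * real m + 1) (Suc n) = step2_pochhammer (2 * real m + 1) n * (2 * real (m + n) + 1)"
    by (simp add: step2_pochhammer_def add_ac)
  then show ?case by (simp add: Suc)
qed (simp add: step2_pochhammer_def)

lemma pochhammer_fact_quotient: "pochhammer (real m + 1) n = fact (m + n) / fact m"
proof (induction n)
  case (Suc n)
  have "pochhammer (real m + 1) (Suc n) = pochhammer (real m + 1) n * real (Suc (m + n))"
    by (simp add: pochhammer_Suc add_ac)
  then show ?case by (simp add: Suc mult.commute)
qed simp

text \<open>Here \<open>c\<close> stands for b + z. The i-th Pochhammer symbol runs from x + 1 + i
  to x + 2a + c + 2y - 1 - i, so it is a quotient of factorials. Its numerators decrease with i and
  are put in increasing order to match \<open>gap_sum_closed\<close>.\<close>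

lemma T_eq:
  "T (real x + 1) (2 * int a + int c + 2 * int y - 1) y = (\<Prod>i<y. fact (x + 2 * a + c + y + i) / fact (x + i))"
proof -
  have "T (real x + 1) (2 * int a + int c + 2 * int y - 1) y
      = (\<Prod>i<y. fact (x + 2 * a + c + y + (y - Suc i)) / fact (x + i))"
    unfolding T_def
  proof (rule prod.cong[OF refl])
    fix i assume "i \<in> {..<y}"
    \<comment> \<open>In terms of \<open>k\<close> the truncated subtractions and the conversion by
      \<open>nat\<close> disappear.\<close>
    then obtain k where k: "y = Suc (i + k)" by (auto simp: less_iff_Suc_add)
    then have n: "nat (2 * int a + int c + 2 * int y - 1 - 2 * int i) = 2 * a + c + 1 + 2 * k"
      and e: "x + 2 * a + c + y + (y - Suc i) = x + i + (2 * a + c + 1 + 2 * k)" by auto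
    have "real x + 1 + real i = real (x + i) + 1" by simp
    then show "pochhammer (real x + 1 + real i) (nat (2 * int a + int c + 2 * int y - 1 - 2 * int i))
        = fact (x + 2 * a + c + y + (y - Suc i)) / fact (x + i)"
      unfolding n e by (simp only: pochhammer_fact_quotient)
  qed
  then show ?thesis
    by (simp only: prod_dividef prod.nat_diff_reindex[of "\<lambda>i. fact (x + 2 * a + c + y + i)" y])
qed

lemma V_eq:
  "V (2 * real x + 2 * real a + 3) (int c + 2 * int y - 2) y = (\<Prod>i<y. df (x + a + c + y + i) / df (x + a + 1 + i))"
proof -
  have "V (2 * real x + 2 * real a + 3) (int c + 2 * int y - 2) y
      = (\<Prod>i<y. df (x + a + c + y + (y - Suc i)) / df (x + a + 1 + i))"
    unfolding V_def
  proof (rule prod.cong[OF refl])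
    fix i assume "i \<in> {..<y}"
    then obtain k where k: "y = Suc (i + k)" by (auto simp: less_iff_Suc_add)
    then have n: "nat (int c + 2 * int y - 2 - 2 * int i) = c + 2 * k"
      and e: "x + a + c + y + (y - Suc i) = x + a + 1 + i + (c + 2 * k)" by auto
    have "2 * real x + 2 * real a + 3 + 2 * real i = 2 * real (x + a + 1 + i) + 1" by simp
    then show "step2_pochhammer (2 * real x + 2 * real a + 3 + 2 * real i) (nat (int c + 2 * int y - 2 - 2 * int i))
        = df (x + a + c + y + (y - Suc i)) / df (x + a + 1 + i)"
      unfolding n e by (simp only: step2_pochhammer_df)
  qed
  then show ?thesis
    by (simp only: prod_dividef prod.nat_diff_reindex[of "\<lambda>i. df (x + a + c + y + i)" y])
qed

definition gap_factor :: "nat \<Rightarrow> nat \<Rightarrow> nat \<Rightarrow> nat \<Rightarrow> nat \<Rightarrow> real" where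
  "gap_factor x y z a b =
    (T (real x + 1) (2 * int a + int b + 2 * int y + int z - 1) y
      * V (2 * real x + 2 * real a + 3) (int b + 2 * int y + int z - 2) y)
    / (T 1 (2 * int a + int b + 2 * int y + int z - 1) y
      * V (2 * real a + 3) (int b + 2 * int y + int z - 2) y)"

text \<open>The factors of \<open>gap_sum_closed\<close> that contain \<open>x\<close> are the
  numerator of \<open>gap_factor\<close>. Dividing them by their values at \<open>x = 0\<close>
  leaves (c + i)! and (2a + c + y + i)!, whose products are quotients of \<open>H\<close>, and
  \<open>df (a + i) / df (a + 1 + i)\<close>, which telescopes.\<close>

lemma gap_sum_gap_factor:
  "gap_sum y a (b + z) (a + x + y) = odd_dfact (2 * int a - 1) / odd_dfact (2 * int a + 2 * int y - 1)
     * (H (2 * a + b + 2 * y + z) * H (b + y + z) / (H (2 * a + b + y + z) * H (b + z)))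
     * gap_factor x y z a b"
proof -
  define c where "c = b + z"
  have gf: "gap_factor x y z a b =
    ((\<Prod>i<y. fact (x + 2 * a + c + y + i) / fact (x + i)) * (\<Prod>i<y. df (x + a + c + y + i) / df (x + a + 1 + i)))
    / ((\<Prod>i<y. fact (2 * a + c + y + i) / fact i) * (\<Prod>i<y. df (a + c + y + i) / df (a + 1 + i)))"
    using T_eq[of x a c y] V_eq[of x a c y] T_eq[of 0 a c y] V_eq[of 0 a c y]
    by (simp add: gap_factor_def c_def algebra_simps)
  have od: "odd_dfact (2 * int a - 1) / odd_dfact (2 * int a + 2 * int y - 1) = (\<Prod>i<y. df (a + i) / df (a + 1 + i))"
  proof -
    have "(\<Prod>i<y. df (a + i) / df (a + 1 + i)) = df a / df (a + y)"
      by (induction y) auto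
    moreover have "odd_dfact (2 * int a + 2 * int y - 1) = df (a + y)"
      using odd_dfact_eq[of "a + y"] by (simp add: algebra_simps)
    ultimately show ?thesis by (simp add: odd_dfact_eq)
  qed
  have h: "H (2 * a + b + 2 * y + z) * H (b + y + z) / (H (2 * a + b + y + z) * H (b + z))
      = (\<Prod>i<y. fact (2 * a + c + y + i)) * (\<Prod>i<y. fact (c + i))"
    using H_add[of "2 * a + c + y" y] H_add[of c y] H_pos[of "2 * a + c + y"] H_pos[of c]
    by (simp add: c_def add_ac mult_2)
  have "gap_sum y a (b + z) (a + x + y) = (\<Prod>i<y. fact (c + i) * fact i * df (a + i) * fact (x + 2 * a + c + y + i)
     * df (x + a + c + y + i) / (fact (x + i) * df (x + a + 1 + i) * df (a + c + y + i)))"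
    using gap_sum_closed[of y a c x] by (simp add: c_def add_ac)
  also have "\<dots> = (\<Prod>i<y. df (a + i) / df (a + 1 + i)) * ((\<Prod>i<y. fact (2 * a + c + y + i)) * (\<Prod>i<y. fact (c + i)))
     * gap_factor x y z a b"
    unfolding gf prod.distrib[symmetric] prod_dividef[symmetric]
    by (intro prod.cong refl) (simp add: mult_ac)
  finally show ?thesis unfolding od h .
qed

lemma gap_factor_0: "gap_factor 0 y z a b = 1"
proof -
  define c where "c = b + z"
  have "T 1 (2 * int a + int c + 2 * int y - 1) y > 0" "V (2 * real a + 3) (int c + 2 * int y - 2) y > 0"
    using T_eq[of 0 a c y] V_eq[of 0 a c y] by (simp_all add: prod_pos)
  then show ?thesis by (simp add: gap_factor_def c_def algebra_simps)
qed

lemma gap_sum_0: "gap_sum 0 a c N = 1"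
proof -
  have "{D. D \<subseteq> {a..<N} \<and> card D = 0} = {{}}"
    by (auto dest: finite_subset[of _ "{a..<N}"])
  then show ?thesis by (simp add: gap_sum_def vand_def)
qed

section \<open>Counting tilings\<close>

text \<open>The last alternative of each clause is the neighbour across the horizontal edge, that
  is, the vertical lozenge.\<close>

fun adj :: "face \<Rightarrow> face \<Rightarrow> bool" where
  "adj (Up i k) (Down i' k') \<longleftrightarrow> i' = i \<and> k' = k \<or> i' = i - 1 \<and> k' = k \<or> i' = i \<and> k' = k - 1"
| "adj (Down i k) (Up i' k') \<longleftrightarrow> i' = i \<and> k' = k \<or> i' = i + 1 \<and> k' = k \<or> i' = i \<and> k' = k + 1"
| "adj (Up _ _) (Up _ _) \<longleftrightarrow> False"
| "adj (Down _ _) (Down _ _) \<longleftrightarrow> False"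

fun is_up :: "face \<Rightarrow> bool" where
  "is_up (Up _ _) \<longleftrightarrow> True"
| "is_up (Down _ _) \<longleftrightarrow> False"

lemma adj_is_up: "adj f g \<Longrightarrow> is_up g \<longleftrightarrow> \<not> is_up f"
  by (cases f; cases g) auto

lemma adj_sym: "adj f g \<longleftrightarrow> adj g f"
  by (cases f; cases g) auto

lemma card_Int_triple:
  assumes "distinct [p, q, r]"
  shows "card ({p, q, r} \<inter> B) = of_bool (p \<in> B) + of_bool (q \<in> B) + of_bool (r \<in> B)"
  using assms by (auto simp: Int_insert_left)

lemma card_vertices_Int: "card (vertices f \<inter> vertices g) = 2 \<longleftrightarrow> adj f g"
proof (cases f)
  case (Up i k)
  show ?thesis
    by (cases g; simp only: Up vertices.simps; subst card_Int_triple; simp add: of_bool_def)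
      (smt (verit))+
next
  case (Down i k)
  show ?thesis
    by (cases g; simp only: Down vertices.simps; subst card_Int_triple; simp add: of_bool_def)
      (smt (verit))+
qed

lemma lozenge_iff: "lozenge l \<longleftrightarrow> (\<exists>f g. l = {f, g} \<and> adj f g)"
  by (simp add: lozenge_def card_vertices_Int)

lemma finite_tilings: "finite R \<Longrightarrow> finite (tilings R)"
  by (rule finite_subset[of _ "Pow (Pow R)"]) (auto simp: tilings_def partition_on_def)

lemma num_tilings_empty [simp]: "num_tilings {} = 1"
proof -
  have "tilings {} = {{}}" by (auto simp: tilings_def partition_on_def)
  then show ?thesis by (simp add: num_tilings_def)
qed

text \<open>The tilings are sorted by the partner \<open>g\<close> of \<open>f\<close> in its
  lozenge. All later counting rests on this recurrence instead of on partitions.\<close>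

lemma num_tilings_expand:
  assumes "finite R" "f \<in> R"
  shows "num_tilings R = (\<Sum>g | g \<in> R \<and> adj f g. num_tilings (R - {f, g}))"
proof -
  let ?N = "{g. g \<in> R \<and> adj f g}"
  let ?A = "\<lambda>g. {P \<in> tilings R. {f, g} \<in> P}"
  have "tilings R = (\<Union>g\<in>?N. ?A g)"
  proof (intro equalityI subsetI)
    fix P assume P: "P \<in> tilings R"
    then obtain l where l: "l \<in> P" "f \<in> l" using assms by (auto simp: tilings_def partition_on_def)
    then obtain f' g' where fg: "l = {f', g'}" "adj f' g'"
      using P by (auto simp: tilings_def lozenge_iff)
    have "\<exists>g. l = {f, g} \<and> adj f g"
      by (cases "f = f'") (use fg l(2) adj_sym in \<open>auto simp: insert_commute\<close>)
    then obtain g where "l = {f, g}" "adj f g" by auto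
    then show "P \<in> (\<Union>g\<in>?N. ?A g)" using l P by (auto simp: tilings_def partition_on_def)
  qed auto
  then have "num_tilings R = card (\<Union>g\<in>?N. ?A g)" by (simp add: num_tilings_def)
  also have "\<dots> = (\<Sum>g\<in>?N. card (?A g))"
  proof (rule card_UN_disjoint)
    show "\<forall>g\<in>?N. \<forall>h\<in>?N. g \<noteq> h \<longrightarrow> ?A g \<inter> ?A h = {}"
    proof (intro ballI impI, rule ccontr)
      fix g h assume gh: "g \<in> ?N" "h \<in> ?N" "g \<noteq> h" and "?A g \<inter> ?A h \<noteq> {}"
      then obtain P where P: "partition_on R P" "{f, g} \<in> P" "{f, h} \<in> P" by (auto simp: tilings_def)
      then have "{f, g} = {f, h}" using disjointD[OF partition_onD2[OF P(1)] P(2,3)] by auto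
      then show False using gh by (auto simp: doubleton_eq_iff)
    qed
  qed (use assms finite_tilings in auto)
  also have "\<dots> = (\<Sum>g\<in>?N. num_tilings (R - {f, g}))"
  proof (rule sum.cong[OF refl])
    fix g assume g: "g \<in> ?N"
    have "bij_betw (insert {f, g}) (tilings (R - {f, g})) (?A g)"
    proof (rule bij_betw_byWitness[where f'="\<lambda>P. P - {{f, g}}"])
      have new: "{f, g} \<notin> P" if "P \<in> tilings (R - {f, g})" for P
        using that by (auto simp: tilings_def partition_on_def)
      then show "\<forall>P\<in>tilings (R - {f, g}). insert {f, g} P - {{f, g}} = P" by auto
      show "insert {f, g} ` tilings (R - {f, g}) \<subseteq> ?A g"
      proof
        fix P' assume "P' \<in> insert {f, g} ` tilings (R - {f, g})"
        then obtain P where P: "P \<in> tilings (R - {f, g})" "P' = insert {f, g} P" by auto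
        then have "partition_on R P'"
          using g assms by (auto simp: tilings_def partition_on_insert partition_on_def disjnt_def)
            (auto simp: disjoint_def)
        then show "P' \<in> ?A g" using P g by (auto simp: tilings_def lozenge_iff)
      qed
      show "(\<lambda>P. P - {{f, g}}) ` ?A g \<subseteq> tilings (R - {f, g})"
      proof
        fix P' assume "P' \<in> (\<lambda>P. P - {{f, g}}) ` ?A g"
        then obtain P where P: "P \<in> tilings R" "{f, g} \<in> P" "P' = P - {{f, g}}" by auto
        then have part: "partition_on R P" by (simp add: tilings_def)
        have "l \<inter> {f, g} = {}" if "l \<in> P'" for l
          using disjointD[OF partition_onD2[OF part], of l "{f, g}"] P that by auto
        then have "\<Union>P' = R - {f, g}"
          using partition_onD1[OF part] P by blast
        then have "partition_on (R - {f, g}) P'"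
          using part P by (auto simp: partition_on_def disjoint_def)
        then show "P' \<in> tilings (R - {f, g})" using P by (auto simp: tilings_def)
      qed
    qed auto
    then show "card (?A g) = num_tilings (R - {f, g})"
      by (simp add: num_tilings_def bij_betw_same_card)
  qed
  finally show ?thesis .
qed

lemma num_tilings_none:
  "\<lbrakk>finite R; f \<in> R; \<And>g. g \<in> R \<Longrightarrow> \<not> adj f g\<rbrakk> \<Longrightarrow> num_tilings R = 0"
  by (subst num_tilings_expand[of R f]) auto

lemma num_tilings_forced:
  assumes "finite R" "f \<in> R" "g \<in> R" "adj f g" "\<And>h. h \<in> R \<Longrightarrow> adj f h \<Longrightarrow> h = g"
  shows "num_tilings R = num_tilings (R - {f, g})"
proof -
  have "{h. h \<in> R \<and> adj f h} = {g}" using assms(3-5) by blast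
  then show ?thesis using num_tilings_expand[OF assms(1,2)] by simp
qed

lemma num_tilings_image:
  assumes "finite R" "inj \<phi>" "\<And>f g. adj (\<phi> f) (\<phi> g) \<longleftrightarrow> adj f g"
  shows "num_tilings (\<phi> ` R) = num_tilings R"
  using assms(1)
proof (induction "card R" arbitrary: R rule: less_induct)
  case less
  show ?case
  proof (cases "R = {}")
    case False
    then obtain f where f: "f \<in> R" by auto
    have "num_tilings (\<phi> ` R) = (\<Sum>g | g \<in> \<phi> ` R \<and> adj (\<phi> f) g. num_tilings (\<phi> ` R - {\<phi> f, g}))"
      using less f by (intro num_tilings_expand) auto
    also have "{g. g \<in> \<phi> ` R \<and> adj (\<phi> f) g} = \<phi> ` {g. g \<in> R \<and> adj f g}" by (auto simp: assms(3))
    also have "(\<Sum>g\<in>\<phi> ` {g. g \<in> R \<and> adj f g}. num_tilings (\<phi> ` R - {\<phi> f, g}))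
        = (\<Sum>g | g \<in> R \<and> adj f g. num_tilings (\<phi> ` R - {\<phi> f, \<phi> g}))"
      by (subst sum.reindex) (use assms(2) in \<open>auto simp: inj_on_def inj_def\<close>)
    also have "\<dots> = (\<Sum>g | g \<in> R \<and> adj f g. num_tilings (R - {f, g}))"
    proof (rule sum.cong[OF refl])
      fix g
      have "\<phi> ` R - {\<phi> f, \<phi> g} = \<phi> ` (R - {f, g})"
        using image_set_diff[OF assms(2), of R "{f, g}"] by simp
      moreover have "card (R - {f, g}) < card R" using f less.prems by (intro psubset_card_mono) auto
      ultimately show "num_tilings (\<phi> ` R - {\<phi> f, \<phi> g}) = num_tilings (R - {f, g})"
        using less by simp
    qed
    also have "\<dots> = num_tilings R" using less f by (intro num_tilings_expand[symmetric]) auto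
    finally show ?thesis .
  qed simp
qed

text \<open>Each lozenge consists of one face of either orientation.\<close>

lemma tileable_balanced:
  assumes "finite R" "num_tilings R \<noteq> 0"
  shows "card {f \<in> R. is_up f} = card {f \<in> R. \<not> is_up f}"
  using assms
proof (induction "card R" arbitrary: R rule: less_induct)
  case less
  show ?case
  proof (cases "R = {}")
    case False
    then obtain f where f: "f \<in> R" by auto
    have "(\<Sum>g | g \<in> R \<and> adj f g. num_tilings (R - {f, g})) \<noteq> 0"
      using num_tilings_expand[OF less.prems(1) f] less.prems(2) by simp
    then obtain g where "g \<in> {g. g \<in> R \<and> adj f g}" "num_tilings (R - {f, g}) \<noteq> 0"
      by (rule sum.not_neutral_contains_not_neutral)
    then have g: "g \<in> R" "adj f g" "num_tilings (R - {f, g}) \<noteq> 0" by auto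
    define u where "u = (if is_up f then f else g)"
    define d where "d = (if is_up f then g else f)"
    have ud: "u \<in> R" "d \<in> R" "is_up u" "\<not> is_up d" "{f, g} = {u, d}"
      using f g adj_is_up[OF g(2)] by (auto simp: u_def d_def)
    have "card (R - {f, g}) < card R" using f less.prems by (intro psubset_card_mono) auto
    then have "card {h \<in> R - {f, g}. is_up h} = card {h \<in> R - {f, g}. \<not> is_up h}"
      by (rule less.hyps) (use less.prems g in auto)
    then have "card {h \<in> R - {u, d}. is_up h} = card {h \<in> R - {u, d}. \<not> is_up h}"
      unfolding ud(5) .
    moreover have "{f \<in> R - {u, d}. is_up f} = {f \<in> R. is_up f} - {u}"
      "{f \<in> R - {u, d}. \<not> is_up f} = {f \<in> R. \<not> is_up f} - {d}" using ud by auto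
    moreover have "card {f \<in> R. is_up f} > 0" "card {f \<in> R. \<not> is_up f} > 0"
      using ud less.prems by (auto simp: card_gt_0_iff)
    ultimately show ?thesis using ud less.prems by (simp add: card_Diff_singleton)
  qed simp
qed

text \<open>A family of lozenges that is forced layer by layer: the \<^term>\<open>Down\<close> face of each of them loses
  its two neighbours in its own row, either to the complement of the region or to the previous layer.\<close>

lemma num_tilings_forced_verticals:
  assumes "finite R" "finite D"
    and "\<And>i k. (i, k) \<in> D \<Longrightarrow> Down i k \<in> R \<and> Up i (k + 1) \<in> R"
    and "\<And>i k. (i, k) \<in> D \<Longrightarrow> Up i k \<notin> R \<or> (i, k - 1) \<in> D"
    and "\<And>i k. (i, k) \<in> D \<Longrightarrow> Up (i + 1) k \<notin> R \<or> (i + 1, k - 1) \<in> D"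
  shows "num_tilings R = num_tilings (R - (\<Union>(i, k)\<in>D. {Down i k, Up i (k + 1)}))"
  using assms
proof (induction "card D" arbitrary: R D)
  case 0
  then show ?case by simp
next
  case (Suc n)
  then have "D \<noteq> {}" by auto
  \<comment> \<open>A lozenge of least height has no member of \<open>D\<close> below it; so both
    side neighbours of its Down face are missing, and it is forced.\<close>
  then obtain p where p: "p \<in> D" "\<And>q. q \<in> D \<Longrightarrow> snd p \<le> snd q"
    using arg_min_if_finite[of D snd] Suc.prems(2) by (metis leI)
  obtain i k where ik: "p = (i, k)" by (cases p)
  have not: "(i', k - 1) \<notin> D" for i' using p(2)[of "(i', k - 1)"] ik by auto
  have pair: "Down i k \<in> R" "Up i (k + 1) \<in> R" "Up i k \<notin> R" "Up (i + 1) k \<notin> R"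
    using Suc.prems(3-5)[of i k] p(1) not[of i] not[of "i + 1"] unfolding ik by auto
  have "num_tilings R = num_tilings (R - {Down i k, Up i (k + 1)})"
  proof (rule num_tilings_forced)
    fix h assume "h \<in> R" "adj (Down i k) h"
    then show "h = Up i (k + 1)" using pair by (cases h) auto
  qed (use pair Suc.prems in auto)
  also have "\<dots> = num_tilings ((R - {Down i k, Up i (k + 1)}) - (\<Union>(i, k)\<in>D - {p}. {Down i k, Up i (k + 1)}))"
  proof (rule Suc.hyps(1))
    show "n = card (D - {p})" using Suc.hyps(2) Suc.prems(2) p(1) by simp
    fix i' k' assume d: "(i', k') \<in> D - {p}"
    show "Down i' k' \<in> R - {Down i k, Up i (k + 1)} \<and> Up i' (k' + 1) \<in> R - {Down i k, Up i (k + 1)}"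
      using d Suc.prems(3)[of i' k'] ik by auto
    show "Up i' k' \<notin> R - {Down i k, Up i (k + 1)} \<or> (i', k' - 1) \<in> D - {p}"
      using d Suc.prems(4)[of i' k'] ik by auto
    show "Up (i' + 1) k' \<notin> R - {Down i k, Up i (k + 1)} \<or> (i' + 1, k' - 1) \<in> D - {p}"
      using d Suc.prems(5)[of i' k'] ik by auto
  qed (use Suc.prems in auto)
  also have "(R - {Down i k, Up i (k + 1)}) - (\<Union>(i, k)\<in>D - {p}. {Down i k, Up i (k + 1)})
      = R - (\<Union>(i, k)\<in>D. {Down i k, Up i (k + 1)})"
    using p(1) ik by auto
  finally show ?case .
qed

text \<open>\<open>W\<close> records the lozenges with one face in \<open>R\<close> and one in
  \<open>S\<close>, which must be pairs \<open>l v\<close>, \<open>r v\<close>. The induction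
  removes a face \<open>t\<close> of \<open>R\<close> with its partner: the partner lies in
  \<open>R\<close> when no \<open>v\<close> in \<open>W\<close> has \<open>l v = t\<close>, and in
  \<open>S\<close> otherwise.\<close>

lemma num_tilings_cut:
  fixes l r :: "'v \<Rightarrow> face"
  assumes "finite J" "finite R" "finite S" "R \<inter> S = {}" "inj_on l J" "inj_on r J"
    and "\<And>v. v \<in> J \<Longrightarrow> adj (l v) (r v)"
    and "\<And>f g. f \<in> R \<Longrightarrow> g \<in> S \<Longrightarrow> adj f g \<Longrightarrow> \<exists>v\<in>J. f = l v \<and> g = r v"
  shows "num_tilings (R \<union> S) = (\<Sum>W | W \<subseteq> J \<and> l ` W \<subseteq> R \<and> r ` W \<subseteq> S.
    num_tilings (R - l ` W) * num_tilings (S - r ` W))"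
  using assms(2-4,8)
proof (induction "card R" arbitrary: R S rule: less_induct)
  case less
  note fin = less.prems(1,2)
  let ?W = "\<lambda>R S. {W. W \<subseteq> J \<and> l ` W \<subseteq> R \<and> r ` W \<subseteq> S}"
  have finW: "finite (?W R S)" for R S
    by (rule finite_subset[of _ "Pow J"]) (use assms(1) in auto)
  have finA: "finite {W \<in> ?W R S. Q W}" for Q
    by (rule finite_subset[OF _ finW[of R S]]) auto
  show ?case
  proof (cases "R = {}")
    case True
    then have "?W R S = {{}}" by auto
    then show ?thesis using True by simp
  next
    case False
    then obtain t where t: "t \<in> R" by auto
    let ?F = "\<lambda>W. num_tilings (R - l ` W) * num_tilings (S - r ` W)"
    have IH: "num_tilings ((R - X) \<union> (S - Y)) = (\<Sum>W\<in>?W (R - X) (S - Y).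
        num_tilings (R - X - l ` W) * num_tilings (S - Y - r ` W))" if "t \<in> X" for X Y
    proof (rule less.hyps)
      show "card (R - X) < card R" using t that fin by (intro psubset_card_mono) auto
    qed (use less.prems in auto)
    have "num_tilings (R \<union> S) = (\<Sum>h | h \<in> R \<union> S \<and> adj t h. num_tilings ((R \<union> S) - {t, h}))"
      using fin t by (intro num_tilings_expand) auto
    also have "{h. h \<in> R \<union> S \<and> adj t h} = {h \<in> R. adj t h} \<union> {h \<in> S. adj t h}" by auto
    also have "(\<Sum>h\<in>\<dots>. num_tilings ((R \<union> S) - {t, h})) =
        (\<Sum>h\<in>{h \<in> R. adj t h}. num_tilings ((R \<union> S) - {t, h})) + (\<Sum>h\<in>{h \<in> S. adj t h}. num_tilings ((R \<union> S) - {t, h}))"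
      by (rule sum.union_disjoint) (use less.prems in auto)
    also have "(\<Sum>h\<in>{h \<in> R. adj t h}. num_tilings ((R \<union> S) - {t, h})) =
        (\<Sum>h\<in>{h \<in> R. adj t h}. \<Sum>W\<in>?W (R - {t, h}) S.
          num_tilings (R - {t, h} - l ` W) * num_tilings (S - r ` W))"
    proof (rule sum.cong[OF refl])
      fix h assume "h \<in> {h \<in> R. adj t h}"
      then have "(R \<union> S) - {t, h} = (R - {t, h}) \<union> (S - {})" using t less.prems(3) by auto
      then show "num_tilings ((R \<union> S) - {t, h}) = (\<Sum>W\<in>?W (R - {t, h}) S.
          num_tilings (R - {t, h} - l ` W) * num_tilings (S - r ` W))"
        using IH[of "{t, h}" "{}"] by simp
    qed
    also have "\<dots> = (\<Sum>W\<in>{W \<in> ?W R S. t \<notin> l ` W}. ?F W)"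
    proof -
      have "(\<Sum>h\<in>{h \<in> R. adj t h}. \<Sum>W\<in>?W (R - {t, h}) S. num_tilings (R - {t, h} - l ` W) * num_tilings (S - r ` W))
        = (\<Sum>h\<in>{h \<in> R. adj t h}. \<Sum>W\<in>{W \<in> {W \<in> ?W R S. t \<notin> l ` W}. h \<notin> l ` W}.
             num_tilings (R - {t, h} - l ` W) * num_tilings (S - r ` W))"
        by (intro sum.cong refl) auto
      \<comment> \<open>For a fixed \<open>W\<close> the sum over the partners \<open>h\<close> is
        the expansion at \<open>t\<close> of the count for what \<open>W\<close> leaves of
        \<open>R\<close>.\<close>
      also have "\<dots> = (\<Sum>W\<in>{W \<in> ?W R S. t \<notin> l ` W}. \<Sum>h\<in>{h \<in> {h \<in> R. adj t h}. h \<notin> l ` W}.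
             num_tilings (R - {t, h} - l ` W) * num_tilings (S - r ` W))"
        by (rule sum.swap_restrict[OF _ finA]) (use fin in auto)
      also have "\<dots> = (\<Sum>W\<in>{W \<in> ?W R S. t \<notin> l ` W}. ?F W)"
      proof (rule sum.cong[OF refl])
        fix W assume W: "W \<in> {W \<in> ?W R S. t \<notin> l ` W}"
        have "num_tilings (R - l ` W) = (\<Sum>h | h \<in> R - l ` W \<and> adj t h. num_tilings (R - l ` W - {t, h}))"
          using fin t W by (intro num_tilings_expand) auto
        also have "\<dots> = (\<Sum>h\<in>{h \<in> {h \<in> R. adj t h}. h \<notin> l ` W}. num_tilings (R - {t, h} - l ` W))"
          by (intro sum.cong arg_cong[where f=num_tilings]) auto
        finally show "(\<Sum>h\<in>{h \<in> {h \<in> R. adj t h}. h \<notin> l ` W}.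
             num_tilings (R - {t, h} - l ` W) * num_tilings (S - r ` W)) = ?F W"
          by (simp add: sum_distrib_right)
      qed
      finally show ?thesis .
    qed
    also have "(\<Sum>h\<in>{h \<in> S. adj t h}. num_tilings ((R \<union> S) - {t, h})) = (\<Sum>W\<in>{W \<in> ?W R S. t \<in> l ` W}. ?F W)"
    proof (cases "\<exists>v\<in>J. t = l v \<and> r v \<in> S")
      case True
      then obtain v where v: "v \<in> J" "t = l v" "r v \<in> S" by auto
      have uniq: "v' = v" if "v' \<in> J" "l v' = t" for v' using that v inj_on_eq_iff[OF assms(5)] by simp
      have "{h \<in> S. adj t h} = {r v}"
      proof (intro equalityI subsetI)
        fix h assume "h \<in> {h \<in> S. adj t h}"
        then obtain v' where "v' \<in> J" "t = l v'" "h = r v'" using less.prems(4)[OF t] by blast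
        then show "h \<in> {r v}" using uniq by simp
      qed (use v assms(7) in auto)
      then have "(\<Sum>h\<in>{h \<in> S. adj t h}. num_tilings ((R \<union> S) - {t, h})) = num_tilings ((R - {t}) \<union> (S - {r v}))"
        using t v less.prems(3) by (auto intro!: arg_cong[where f=num_tilings])
      also have "\<dots> = (\<Sum>W\<in>?W (R - {t}) (S - {r v}).
        num_tilings (R - {t} - l ` W) * num_tilings (S - {r v} - r ` W))" by (rule IH) simp
      also have "\<dots> = (\<Sum>W\<in>{W \<in> ?W R S. t \<in> l ` W}. ?F W)"
      proof (rule sum.reindex_bij_witness[of _ "\<lambda>W. W - {v}" "insert v"])
        fix W assume W: "W \<in> ?W (R - {t}) (S - {r v})"
        then have "v \<notin> W" using v by auto
        then show "insert v W - {v} = W" by auto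
        show "insert v W \<in> {W \<in> ?W R S. t \<in> l ` W}" using W v t by auto
        have "R - l ` insert v W = R - {t} - l ` W" "S - r ` insert v W = S - {r v} - r ` W" using v by auto
        then show "?F (insert v W) = num_tilings (R - {t} - l ` W) * num_tilings (S - {r v} - r ` W)" by simp
      next
        fix W assume W: "W \<in> {W \<in> ?W R S. t \<in> l ` W}"
        then have "v \<in> W" using uniq by auto
        then show "insert v (W - {v}) = W" by auto
        have "r w \<noteq> r v" "l w \<noteq> t" if "w \<in> W" "w \<noteq> v" for w
          using that W v inj_on_eq_iff[OF assms(5), of w v] inj_on_eq_iff[OF assms(6), of w v] by auto
        then show "W - {v} \<in> ?W (R - {t}) (S - {r v})" using W by auto
      qed
      finally show ?thesis .
    next
      case False
      then have "{h \<in> S. adj t h} = {}" using less.prems(4)[OF t] by auto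
      moreover have "{W \<in> ?W R S. t \<in> l ` W} = {}" using False by auto
      ultimately show ?thesis by (simp only: sum.empty)
    qed
    also have "(\<Sum>W\<in>{W \<in> ?W R S. t \<notin> l ` W}. ?F W) + (\<Sum>W\<in>{W \<in> ?W R S. t \<in> l ` W}. ?F W) = (\<Sum>W\<in>?W R S. ?F W)"
      by (subst sum.union_disjoint[OF finA finA, symmetric]) (auto intro!: sum.cong)
    finally show ?thesis .
  qed
qed

section \<open>Peeling off the rows of a halved hexagon\<close>

fun height :: "face \<Rightarrow> int" where
  "height (Up i k) = k"
| "height (Down i k) = k"

text \<open>A full row begins and ends with an Up face, so without dents it has one Up face too
  many.\<close>

definition strip :: "int \<Rightarrow> int \<Rightarrow> int \<Rightarrow> int set \<Rightarrow> face set" where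
  "strip lo hi k X = (\<lambda>i. Up i k) ` ({lo..hi} - X) \<union> (\<lambda>i. Down i k) ` {lo..<hi}"

lemma Up_in_strip [simp]: "Up i k' \<in> strip lo hi k X \<longleftrightarrow> k' = k \<and> lo \<le> i \<and> i \<le> hi \<and> i \<notin> X"
  and Down_in_strip [simp]: "Down i k' \<in> strip lo hi k X \<longleftrightarrow> k' = k \<and> lo \<le> i \<and> i < hi"
  by (auto simp: strip_def)

lemma finite_strip [simp]: "finite (strip lo hi k X)"
  by (simp add: strip_def)

lemma face_set_eqI:
  assumes "\<And>i k. Up i k \<in> A \<longleftrightarrow> Up i k \<in> B" "\<And>i k. Down i k \<in> A \<longleftrightarrow> Down i k \<in> B"
  shows "A = B"
proof (rule Set.set_eqI)
  fix f show "f \<in> A \<longleftrightarrow> f \<in> B" using assms by (cases f) auto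
qed

section \<open>One row, traversed from left to right\<close>

context
  fixes k hi :: int
begin

lemma strip_skip_one:
  assumes "finite G" "\<And>f. f \<in> G \<Longrightarrow> k < height f" "lo \<notin> X" "lo < hi"
  shows "num_tilings (strip lo hi k X \<union> G) = num_tilings (strip (lo + 1) hi k X \<union> G)"
proof -
  have G: "\<And>i k'. Up i k' \<in> G \<Longrightarrow> k < k'" "\<And>i k'. Down i k' \<in> G \<Longrightarrow> k < k'"
    using assms(2) by fastforce+
  have "num_tilings (strip lo hi k X \<union> G) = num_tilings (strip lo hi k X \<union> G - {Up lo k, Down lo k})"
  proof (rule num_tilings_forced)
    fix h assume "h \<in> strip lo hi k X \<union> G" "adj (Up lo k) h"
    then show "h = Down lo k" by (cases h) (auto dest: G)
  qed (use assms in auto)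
  also have "strip lo hi k X \<union> G - {Up lo k, Down lo k} = strip (lo + 1) hi k X \<union> G"
    by (rule face_set_eqI) (auto dest: G)
  finally show ?thesis .
qed

lemma strip_skip:
  assumes "finite G" "\<And>f. f \<in> G \<Longrightarrow> k < height f"
  shows "\<lbrakk>lo \<le> d; d \<le> hi; \<And>i. lo \<le> i \<Longrightarrow> i < d \<Longrightarrow> i \<notin> X\<rbrakk> \<Longrightarrow>
    num_tilings (strip lo hi k X \<union> G) = num_tilings (strip d hi k X \<union> G)"
proof (induction "nat (d - lo)" arbitrary: lo)
  case (Suc n)
  have "num_tilings (strip lo hi k X \<union> G) = num_tilings (strip (lo + 1) hi k X \<union> G)"
    using Suc by (intro strip_skip_one assms) auto
  also have "\<dots> = num_tilings (strip d hi k X \<union> G)"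
    using Suc by (intro Suc.hyps(1)) auto
  finally show ?case .
qed simp

text \<open>The forced lozenges consume the row from the left and strand its last Up face.\<close>

lemma strip_undented:
  assumes "finite G" "\<And>f. f \<in> G \<Longrightarrow> k < height f" "lo \<le> hi" "\<And>i. lo \<le> i \<Longrightarrow> i \<le> hi \<Longrightarrow> i \<notin> X"
  shows "num_tilings (strip lo hi k X \<union> G) = 0"
proof -
  have G: "\<And>i k'. Up i k' \<in> G \<Longrightarrow> k < k'" "\<And>i k'. Down i k' \<in> G \<Longrightarrow> k < k'"
    using assms(2) by fastforce+
  have "num_tilings (strip lo hi k X \<union> G) = num_tilings (strip hi hi k X \<union> G)"
    using assms(3,4) by (intro strip_skip assms(1,2)) auto
  also have "\<dots> = 0"
  proof (rule num_tilings_none[of _ "Up hi k"])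
    fix g assume "g \<in> strip hi hi k X \<union> G"
    then show "\<not> adj (Up hi k) g" by (cases g) (auto dest: G)
  qed (use assms in auto)
  finally show ?thesis .
qed

text \<open>The Down face next to the dent has two possible partners. If it takes the Up face to its
  right, the dent has moved one step; if it takes the Up face above, that becomes a dent of the next
  row.\<close>

lemma strip_from_dent:
  assumes "finite G" "\<And>f. f \<in> G \<Longrightarrow> k < height f" "lo \<in> X" "lo < hi"
  shows "num_tilings (strip lo hi k X \<union> G) =
    (if lo + 1 \<in> X then 0 else num_tilings (strip (lo + 1) hi k (insert (lo + 1) X) \<union> G)) +
    (if Up lo (k + 1) \<in> G then num_tilings (strip (lo + 1) hi k X \<union> (G - {Up lo (k + 1)})) else 0)"
proof -
  have G: "\<And>i k'. Up i k' \<in> G \<Longrightarrow> k < k'" "\<And>i k'. Down i k' \<in> G \<Longrightarrow> k < k'"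
    using assms(2) by fastforce+
  let ?R = "strip lo hi k X \<union> G"
  have "num_tilings ?R = (\<Sum>g | g \<in> ?R \<and> adj (Down lo k) g. num_tilings (?R - {Down lo k, g}))"
    using assms by (intro num_tilings_expand) auto
  also have "{g. g \<in> ?R \<and> adj (Down lo k) g} = (if lo + 1 \<in> X then {} else {Up (lo + 1) k})
      \<union> (if Up lo (k + 1) \<in> G then {Up lo (k + 1)} else {})"
    using assms by (intro face_set_eqI) (auto dest: G)
  also have "(\<Sum>g\<in>\<dots>. num_tilings (?R - {Down lo k, g})) =
    (if lo + 1 \<in> X then 0 else num_tilings (?R - {Down lo k, Up (lo + 1) k})) +
    (if Up lo (k + 1) \<in> G then num_tilings (?R - {Down lo k, Up lo (k + 1)}) else 0)"
    by auto
  also have "?R - {Down lo k, Up (lo + 1) k} = strip (lo + 1) hi k (insert (lo + 1) X) \<union> G"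
    using assms(3) by (intro face_set_eqI) (auto dest: G, metis add1_zle_eq order_le_less)
  also have "?R - {Down lo k, Up lo (k + 1)} = strip (lo + 1) hi k X \<union> (G - {Up lo (k + 1)})"
    using assms(3) by (intro face_set_eqI) (auto dest: G, metis add1_zle_eq order_le_less)
  finally show ?thesis .
qed

text \<open>Exactly one Down face between two consecutive dents is matched upwards, at
  \<open>q\<close>. Left of \<open>q\<close> the dent keeps moving; right of \<open>q\<close> the
  lozenges are forced.\<close>

lemma strip_between_dents:
  assumes "finite G" "\<And>f. f \<in> G \<Longrightarrow> k < height f"
  shows "\<lbrakk>d < d'; d' \<le> hi; d \<in> X; d' \<in> X; \<And>i. d < i \<Longrightarrow> i < d' \<Longrightarrow> i \<notin> X; \<And>q. d \<le> q \<Longrightarrow> q < d' \<Longrightarrow> Up q (k + 1) \<in> G\<rbrakk> \<Longrightarrow>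
    num_tilings (strip d hi k X \<union> G) = (\<Sum>q\<in>{d..<d'}. num_tilings (strip d' hi k X \<union> (G - {Up q (k + 1)})))"
proof (induction "nat (d' - d)" arbitrary: d X)
  case (Suc n)
  have skip: "num_tilings (strip (d + 1) hi k X \<union> (G - {Up d (k + 1)})) = num_tilings (strip d' hi k X \<union> (G - {Up d (k + 1)}))"
    using Suc.prems assms by (intro strip_skip) auto
  have d: "d \<in> X" using Suc.prems by auto
  have step: "num_tilings (strip d hi k X \<union> G) =
      (if d + 1 \<in> X then 0 else num_tilings (strip (d + 1) hi k (insert (d + 1) X) \<union> G)) +
      num_tilings (strip d' hi k X \<union> (G - {Up d (k + 1)}))"
    using strip_from_dent[OF assms d] Suc.prems(1,2) Suc.prems(6)[of d] skip by simp
  show ?case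
  proof (cases "d' = d + 1")
    case True
    then have "{d..<d'} = {d}" "d + 1 \<in> X" using Suc.prems by auto
    then show ?thesis using step by simp
  next
    case False
    then have notin: "d + 1 \<notin> X" using Suc.prems by auto
    have "num_tilings (strip (d + 1) hi k (insert (d + 1) X) \<union> G)
        = (\<Sum>q\<in>{d + 1..<d'}. num_tilings (strip d' hi k (insert (d + 1) X) \<union> (G - {Up q (k + 1)})))"
      using Suc.hyps(2) Suc.prems False by (intro Suc.hyps(1)) auto
    also have "strip d' hi k (insert (d + 1) X) = strip d' hi k X"
      using False Suc.prems by (intro face_set_eqI) auto
    finally have "num_tilings (strip (d + 1) hi k (insert (d + 1) X) \<union> G)
        = (\<Sum>q\<in>{d + 1..<d'}. num_tilings (strip d' hi k X \<union> (G - {Up q (k + 1)})))" .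
    moreover have "{d..<d'} = insert d {d + 1..<d'}" using Suc.prems by auto
    ultimately show ?thesis using step notin by simp
  qed
qed simp

text \<open>Behind the last dent no Down face can be matched upwards, since the rest of the row
  would be left without a dent.\<close>

lemma strip_last_dent:
  assumes "finite G" "\<And>f. f \<in> G \<Longrightarrow> k < height f"
  shows "\<lbrakk>d \<le> hi; d \<in> X; \<And>i. d < i \<Longrightarrow> i \<le> hi \<Longrightarrow> i \<notin> X\<rbrakk> \<Longrightarrow> num_tilings (strip d hi k X \<union> G) = num_tilings G"
proof (induction "nat (hi - d)" arbitrary: d X)
  case 0
  then have "strip d hi k X = {}" by (intro face_set_eqI) auto
  then show ?case by simp
next
  case (Suc n)
  have d: "d \<in> X" "d < hi" "d + 1 \<notin> X" using Suc.prems Suc.hyps(2) by auto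
  have "num_tilings (strip (d + 1) hi k X \<union> (G - {Up d (k + 1)})) = 0"
    using assms Suc.prems d by (intro strip_undented) auto
  moreover have "num_tilings (strip (d + 1) hi k (insert (d + 1) X) \<union> G) = num_tilings G"
    using Suc.hyps(2) Suc.prems d by (intro Suc.hyps(1)) auto
  ultimately show ?case using strip_from_dent[OF assms d(1,2)] d(3) by simp
qed

end

text \<open>One dent of the next row for each pair of consecutive dents. The intervals are half-open
  because the Down faces between the Up faces at \<open>d\<close> and \<open>d'\<close> have the
  positions \<open>d\<close> to \<open>d' - 1\<close>.\<close>

fun interlacing :: "int list \<Rightarrow> int list set" where
  "interlacing [] = {}"
| "interlacing [d] = {[]}"
| "interlacing (d # d' # ds) = (\<lambda>(q, qs). q # qs) ` ({d..<d'} \<times> interlacing (d' # ds))"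

lemma finite_interlacing [simp]: "finite (interlacing ds)"
  by (induction ds rule: interlacing.induct) auto

lemma sum_interlacing_Cons:
  "(\<Sum>qs\<in>interlacing (d # d' # ds). g qs) = (\<Sum>q\<in>{d..<d'}. \<Sum>qs\<in>interlacing (d' # ds). g (q # qs))"
  unfolding interlacing.simps by (subst sum.reindex) (auto simp: inj_on_def sum.cartesian_product case_prod_beta)

lemma head_le_last: "sorted_wrt (<) (x # xs) \<Longrightarrow> (x :: int) \<le> last (x # xs)"
  using last_in_set[of xs] by (cases "xs = []") (auto intro: less_imp_le)

lemma interlacing_props:
  "\<lbrakk>sorted_wrt (<) ds; qs \<in> interlacing ds\<rbrakk> \<Longrightarrow>
    sorted_wrt (<) qs \<and> length ds = Suc (length qs) \<and> (\<forall>q\<in>set qs. hd ds \<le> q \<and> q < last ds)"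
proof (induction ds arbitrary: qs rule: interlacing.induct)
  case (3 d d' ds)
  then obtain q rs where q: "qs = q # rs" "d \<le> q" "q < d'" "rs \<in> interlacing (d' # ds)" by auto
  have "sorted_wrt (<) rs \<and> length (d' # ds) = Suc (length rs) \<and> (\<forall>q\<in>set rs. hd (d' # ds) \<le> q \<and> q < last (d' # ds))"
    using 3 q by (intro "3.IH") auto
  moreover have "d' \<le> last (d' # ds)"
    using 3(2) by (intro head_le_last) auto
  ultimately show ?case using q 3(2) by (auto intro: order.trans less_imp_le)
qed auto

lemma num_tilings_strip:
  assumes "finite G" "\<And>f. f \<in> G \<Longrightarrow> k < height f" "ds \<noteq> []" "sorted_wrt (<) ds" "lo \<le> hd ds" "last ds \<le> hi"
    and "\<And>q. hd ds \<le> q \<Longrightarrow> q < last ds \<Longrightarrow> Up q (k + 1) \<in> G"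
  shows "num_tilings (strip lo hi k (set ds) \<union> G) = (\<Sum>qs\<in>interlacing ds. num_tilings (G - (\<lambda>q. Up q (k + 1)) ` set qs))"
  using assms
proof (induction ds arbitrary: lo G rule: interlacing.induct)
  case (2 d)
  have "num_tilings (strip lo hi k (set [d]) \<union> G) = num_tilings (strip d hi k (set [d]) \<union> G)"
    using 2 by (intro strip_skip) auto
  also have "\<dots> = num_tilings G" using 2 by (intro strip_last_dent) auto
  finally show ?case by simp
next
  case (3 d d' ds)
  let ?X = "set (d # d' # ds)"
  have le: "d' \<le> last (d' # ds)"
    using 3(5) by (intro head_le_last) auto
  have "num_tilings (strip lo hi k ?X \<union> G) = num_tilings (strip d hi k ?X \<union> G)"
    using "3.prems" le by (intro strip_skip) auto
  also have "\<dots> = (\<Sum>q\<in>{d..<d'}. num_tilings (strip d' hi k ?X \<union> (G - {Up q (k + 1)})))"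
    using "3.prems" le by (intro strip_between_dents) auto
  also have "strip d' hi k ?X = strip d' hi k (set (d' # ds))"
    using "3.prems" by (intro face_set_eqI) auto
  also have "(\<Sum>q\<in>{d..<d'}. num_tilings (strip d' hi k (set (d' # ds)) \<union> (G - {Up q (k + 1)}))) =
      (\<Sum>q\<in>{d..<d'}. \<Sum>qs\<in>interlacing (d' # ds). num_tilings (G - {Up q (k + 1)} - (\<lambda>q. Up q (k + 1)) ` set qs))"
    using "3.prems" le by (intro sum.cong refl "3.IH") auto
  also have "\<dots> = (\<Sum>qs\<in>interlacing (d # d' # ds). num_tilings (G - (\<lambda>q. Up q (k + 1)) ` set qs))"
    unfolding sum_interlacing_Cons by (intro sum.cong refl arg_cong[where f=num_tilings]) auto
  finally show ?case .
qed simp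

section \<open>The halved hexagon in integer coordinates\<close>

lemma zigzag_le_iff: "zigzag k \<le> of_int i + of_int k / 2 \<longleftrightarrow> 0 \<le> i + k div 2"
proof (cases "even k")
  case True
  then obtain j where "k = 2 * j" by auto
  moreover have "(0::real) \<le> of_int i + of_int j \<longleftrightarrow> (0::real) \<le> of_int (i + j)" by simp
  ultimately show ?thesis by (simp add: zigzag_def del: of_int_add)
next
  case False
  then obtain j where "k = 2 * j + 1" by (auto elim: oddE)
  moreover have "(0::real) \<le> of_int i * 2 + of_int j * 2 \<longleftrightarrow> (0::real) \<le> of_int (i + j)"
    unfolding of_int_add by (rule iffI) linarith+
  ultimately show ?thesis by (simp add: zigzag_def add_divide_distrib del: of_int_add) (simp add: mult.commute)
qed

lemma right_side_iff: "of_int i + of_int k / 2 \<le> real n - of_int k / 2 \<longleftrightarrow> i + k \<le> int n"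
proof -
  have "of_int i + of_int k / 2 \<le> real n - of_int k / 2 \<longleftrightarrow> real_of_int (i + k) \<le> real_of_int (int n)"
    unfolding of_int_add of_int_of_nat_eq by (rule iffI) linarith+
  then show ?thesis by (simp only: of_int_le_iff)
qed

lemma Up_in_upper [simp]: "Up i k \<in> upper_part L A \<longleftrightarrow> 0 \<le> k \<and> k < A \<and> 0 \<le> i + k div 2 \<and> i + k < int L"
  unfolding upper_part_def faces_within_def
  by (simp add: abscissa_def zigzag_le_iff right_side_iff del: of_int_add) arith

lemma Down_in_upper [simp]: "Down i k \<in> upper_part L A \<longleftrightarrow> 0 \<le> k \<and> k < A \<and> 0 \<le> i + (k + 1) div 2 \<and> i + k + 1 < int L"
  unfolding upper_part_def faces_within_def
  by (simp add: abscissa_def zigzag_le_iff right_side_iff del: of_int_add) arith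

lemma finite_upper_part [simp]: "finite (upper_part L A)"
proof (rule finite_subset)
  let ?B = "{-A..int L} \<times> {0..A}"
  show "upper_part L A \<subseteq> (\<lambda>(i, k). Up i k) ` ?B \<union> (\<lambda>(i, k). Down i k) ` ?B"
  proof
    fix f assume "f \<in> upper_part L A"
    then show "f \<in> (\<lambda>(i, k). Up i k) ` ?B \<union> (\<lambda>(i, k). Down i k) ` ?B"
      by (cases f) (auto simp: image_iff)
  qed
qed simp

text \<open>The translation by two rows that keeps the abscissa \<open>i + k / 2\<close>, and with
  it the zigzag.\<close>

fun shift :: "face \<Rightarrow> face" where
  "shift (Up i k) = Up (i - 1) (k + 2)"
| "shift (Down i k) = Down (i - 1) (k + 2)"

lemma Up_in_shift: "Up i k \<in> shift ` R \<longleftrightarrow> Up (i + 1) (k - 2) \<in> R"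
  and Down_in_shift: "Down i k \<in> shift ` R \<longleftrightarrow> Down (i + 1) (k - 2) \<in> R"
proof -
  have "shift f = Up i k \<longleftrightarrow> f = Up (i + 1) (k - 2)" for f by (cases f) auto
  then show "Up i k \<in> shift ` R \<longleftrightarrow> Up (i + 1) (k - 2) \<in> R" by (metis (no_types, lifting) image_iff)
  have "shift f = Down i k \<longleftrightarrow> f = Down (i + 1) (k - 2)" for f by (cases f) auto
  then show "Down i k \<in> shift ` R \<longleftrightarrow> Down (i + 1) (k - 2) \<in> R" by (metis (no_types, lifting) image_iff)
qed

lemma num_tilings_shift: "finite R \<Longrightarrow> num_tilings (shift ` R) = num_tilings R"
proof (rule num_tilings_image)
  show "inj shift"
  proof (rule injI)
    fix f g assume "shift f = shift g" then show "f = g" by (cases f; cases g) auto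
  qed
  show "adj (shift f) (shift g) = adj f g" for f g by (cases f; cases g) auto
qed

text \<open>
  An odd row of the halved hexagon is treated like an even one by adding to it a dent at position
  \<open>-1\<close>. Removing two rows and applying \<^const>\<open>shift\<close> gives a smaller halved hexagon.
\<close>

lemma num_tilings_two_rows:
  assumes e: "e \<ge> 1" and ds: "ds \<noteq> []" "sorted_wrt (<) ds" "\<And>d. d \<in> set ds \<Longrightarrow> 0 \<le> d \<and> d < int (Suc L)"
  shows "num_tilings (upper_part (Suc L) (2 * int (Suc e) - 1) - (\<lambda>d. Up d 0) ` set ds) =
    (\<Sum>qs\<in>interlacing ds. \<Sum>ps\<in>interlacing (-1 # qs).
      num_tilings (upper_part L (2 * int e - 1) - (\<lambda>p. Up (p + 1) 0) ` set ps))"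
proof -
  define U where "U = upper_part (Suc L) (2 * int (Suc e) - 1)"
  define G1 where "G1 = {f \<in> U. 0 < height f}"
  define G2 where "G2 = {f \<in> U. 1 < height f}"
  have fin: "finite G1" "finite G2" by (simp_all add: G1_def G2_def U_def)
  have last: "0 \<le> hd ds" "last ds < int (Suc L)" using ds(1,3) by auto
  have "U - (\<lambda>d. Up d 0) ` set ds = strip 0 (int L) 0 (set ds) \<union> G1"
    using e by (intro face_set_eqI) (auto simp: U_def G1_def)
  moreover have "num_tilings (strip 0 (int L) 0 (set ds) \<union> G1) =
      (\<Sum>qs\<in>interlacing ds. num_tilings (G1 - (\<lambda>q. Up q (0 + 1)) ` set qs))"
  proof (rule num_tilings_strip)
    show "last ds \<le> int L" using last by simp
    fix q assume "hd ds \<le> q" "q < last ds"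
    then have "0 \<le> q" "q < int L" using last by auto
    then show "Up q (0 + 1) \<in> G1" using e by (auto simp: G1_def U_def)
  qed (use fin ds last in \<open>auto simp: G1_def\<close>)
  ultimately have "num_tilings (U - (\<lambda>d. Up d 0) ` set ds) =
      (\<Sum>qs\<in>interlacing ds. num_tilings (G1 - (\<lambda>q. Up q (0 + 1)) ` set qs))" by simp
  also have "\<dots> = (\<Sum>qs\<in>interlacing ds. \<Sum>ps\<in>interlacing (-1 # qs).
      num_tilings (G2 - (\<lambda>q. Up q (1 + 1)) ` set ps))"
  proof (rule sum.cong[OF refl])
    fix qs assume "qs \<in> interlacing ds"
    then have qs: "sorted_wrt (<) qs" "\<And>q. q \<in> set qs \<Longrightarrow> 0 \<le> q \<and> q < int L"
      using interlacing_props[OF ds(2)] last by fastforce+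
    have lst: "last (-1 # qs) \<le> int L - 1" using qs(2)[OF last_in_set] by (cases "qs = []") auto
    \<comment> \<open>Row 1 starts with \<open>Down (-1) 1\<close>, which has no Up face to its
      left; so it is a strip from -1 that is dented there.\<close>
    have "G1 - (\<lambda>q. Up q (0 + 1)) ` set qs = strip (-1) (int L - 1) 1 (set (-1 # qs)) \<union> G2"
      using e by (intro face_set_eqI) (auto simp: G1_def G2_def U_def)
    moreover have "num_tilings (strip (-1) (int L - 1) 1 (set (-1 # qs)) \<union> G2) =
       (\<Sum>ps\<in>interlacing (-1 # qs). num_tilings (G2 - (\<lambda>q. Up q (1 + 1)) ` set ps))"
    proof (rule num_tilings_strip)
      show "sorted_wrt (<) (-1 # qs)" using qs by fastforce
      fix q assume "hd (-1 # qs) \<le> q" "q < last (-1 # qs)"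
      then show "Up q (1 + 1) \<in> G2" using lst e by (auto simp: G2_def U_def)
    qed (use fin lst in \<open>auto simp: G2_def\<close>)
    ultimately show "num_tilings (G1 - (\<lambda>q. Up q (0 + 1)) ` set qs) =
       (\<Sum>ps\<in>interlacing (-1 # qs). num_tilings (G2 - (\<lambda>q. Up q (1 + 1)) ` set ps))" by simp
  qed
  also have "\<dots> = (\<Sum>qs\<in>interlacing ds. \<Sum>ps\<in>interlacing (-1 # qs).
      num_tilings (upper_part L (2 * int e - 1) - (\<lambda>p. Up (p + 1) 0) ` set ps))"
  proof (intro sum.cong refl)
    fix ps :: "int list"
    have "G2 - (\<lambda>q. Up q (1 + 1)) ` set ps = shift ` (upper_part L (2 * int e - 1) - (\<lambda>p. Up (p + 1) 0) ` set ps)"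
    proof (rule face_set_eqI)
      fix i k
      show "Up i k \<in> G2 - (\<lambda>q. Up q (1 + 1)) ` set ps \<longleftrightarrow>
          Up i k \<in> shift ` (upper_part L (2 * int e - 1) - (\<lambda>p. Up (p + 1) 0) ` set ps)"
        unfolding Up_in_shift by (auto simp: G2_def U_def)
      show "Down i k \<in> G2 - (\<lambda>q. Up q (1 + 1)) ` set ps \<longleftrightarrow>
          Down i k \<in> shift ` (upper_part L (2 * int e - 1) - (\<lambda>p. Up (p + 1) 0) ` set ps)"
        unfolding Down_in_shift by (auto simp: G2_def U_def)
    qed
    then show "num_tilings (G2 - (\<lambda>q. Up q (1 + 1)) ` set ps) =
        num_tilings (upper_part L (2 * int e - 1) - (\<lambda>p. Up (p + 1) 0) ` set ps)"
      by (simp only: num_tilings_shift finite_Diff finite_upper_part)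
  qed
  finally show ?thesis by (simp add: U_def)
qed

text \<open>
  \<open>phi j\<close> is monic of degree \<open>j\<close> in \<open>t * (t + 1)\<close>; up to constants, \<open>gam j\<close> is the discrete
  antiderivative of \<open>phi j\<close>, and \<open>phi (j + 1)\<close> is the one of \<open>gam j\<close>.
\<close>

definition phi :: "nat \<Rightarrow> int \<Rightarrow> real" where
  "phi j t = (\<Prod>r<j. (of_int t - real r) * (of_int t + real r + 1))"

definition gam :: "nat \<Rightarrow> int \<Rightarrow> real" where
  "gam j t = phi j t * (of_int t + real j + 1)"

text \<open>\<open>phi j t\<close> is the product of the 2j consecutive integers from t - j + 1 to t
  + j, and \<open>gam j t\<close> that from t - j + 1 to t + j + 1. The additional factor can be
  split off at either end, which yields the difference rules below, as for falling
  factorials.\<close>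

lemma gam_eq: "gam j t = phi j (t + 1) * (of_int t - real j + 1)"
proof (induction j)
  case (Suc j)
  have "gam (Suc j) t = gam j t * (of_int t - real j) * (of_int t + real j + 2)"
    by (simp add: gam_def phi_def algebra_simps)
  also have "\<dots> = phi (Suc j) (t + 1) * (of_int t - real (Suc j) + 1)"
    unfolding Suc by (simp add: phi_def algebra_simps)
  finally show ?case .
qed (simp add: gam_def phi_def)

lemma gam_diff: "gam j (t + 1) - gam j t = (2 * real j + 1) * phi j (t + 1)"
  unfolding gam_eq[of j t] by (simp add: gam_def algebra_simps)

lemma phi_diff: "phi (Suc j) (t + 1) - phi (Suc j) t = (2 * real j + 1 + 1) * gam j t"
proof -
  have "phi (Suc j) (t + 1) = gam j t * (of_int t + 2 + real j)"
    unfolding gam_eq by (simp add: phi_def algebra_simps)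
  moreover have "phi (Suc j) t = gam j t * (of_int t - real j)"
    by (simp add: gam_def phi_def mult_ac)
  ultimately show ?thesis by (simp add: algebra_simps)
qed

text \<open>The factor t + 1 vanishes. This is the boundary value at the dent that is added to odd
  rows.\<close>

lemma gam_minus_one: "gam j (-1) = 0"
  by (cases j) (auto simp: gam_def phi_def prod.lessThan_Suc_shift simp del: prod.lessThan_Suc)

lemma sum_int_telescope:
  fixes F :: "int \<Rightarrow> real"
  shows "a \<le> b \<Longrightarrow> (\<Sum>t\<in>{a..<b}. F (t + 1) - F t) = F b - F a"
proof (induction b rule: int_ge_induct)
  case (step b)
  then have "{a..<b + 1} = insert b {a..<b}" by auto
  then show ?case using step by simp
qed simp

lemma sum_interlacing_prod:
  fixes h :: "nat \<Rightarrow> int \<Rightarrow> real"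
  shows "length ds = Suc n \<Longrightarrow> (\<Sum>qs\<in>interlacing ds. \<Prod>i=0..<n. h i (qs ! i)) = (\<Prod>i=0..<n. \<Sum>q\<in>{ds ! i..<ds ! Suc i}. h i q)"
proof (induction ds arbitrary: n h rule: interlacing.induct)
  case (3 d d' ds)
  then obtain m where n: "n = Suc m" by (cases n) auto
  have "(\<Sum>qs\<in>interlacing (d # d' # ds). \<Prod>i=0..<n. h i (qs ! i)) =
      (\<Sum>q\<in>{d..<d'}. \<Sum>qs\<in>interlacing (d' # ds). h 0 q * (\<Prod>i=0..<m. h (Suc i) (qs ! i)))"
    unfolding sum_interlacing_Cons n prod.atLeast0_lessThan_Suc_shift by simp
  also have "\<dots> = (\<Sum>q\<in>{d..<d'}. h 0 q) * (\<Sum>qs\<in>interlacing (d' # ds). \<Prod>i=0..<m. h (Suc i) (qs ! i))"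
    by (simp add: sum_product)
  also have "(\<Sum>qs\<in>interlacing (d' # ds). \<Prod>i=0..<m. h (Suc i) (qs ! i))
      = (\<Prod>i=0..<m. \<Sum>q\<in>{(d' # ds) ! i..<(d' # ds) ! Suc i}. h (Suc i) q)"
    using 3 n by (intro "3.IH") auto
  finally show ?case unfolding n prod.atLeast0_lessThan_Suc_shift by simp
qed auto

text \<open>Row \<open>i\<close> involves only the i-th interlacing dent, and these dents range
  independently of each other. So in every term of the Leibniz formula the sum becomes a product of
  telescoping sums.\<close>

lemma sum_interlacing_fdet:
  assumes ds: "sorted_wrt (<) ds" "length ds = Suc n" and F: "\<And>j t. F j (t + 1) - F j t = f j t"
  shows "(\<Sum>qs\<in>interlacing ds. fdet n (\<lambda>i j. f j (qs ! i))) = fdet n (\<lambda>i j. F j (ds ! Suc i) - F j (ds ! i) :: real)"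
proof -
  have tele: "(\<Sum>q\<in>{ds ! i..<ds ! Suc i}. f j q) = F j (ds ! Suc i) - F j (ds ! i)" if "i < n" for i j
    unfolding F[symmetric] using sorted_wrt_nth_less[OF ds(1), of i "Suc i"] that ds(2)
    by (intro sum_int_telescope) auto
  have "(\<Sum>qs\<in>interlacing ds. fdet n (\<lambda>i j. f j (qs ! i))) =
      (\<Sum>p | p permutes {0..<n}. signof p * (\<Sum>qs\<in>interlacing ds. \<Prod>i=0..<n. f (p i) (qs ! i)))"
    unfolding fdet_leibniz by (subst sum.swap) (simp add: sum_distrib_left)
  also have "\<dots> = (\<Sum>p | p permutes {0..<n}. signof p * (\<Prod>i=0..<n. F (p i) (ds ! Suc i) - F (p i) (ds ! i)))"
  proof (intro sum.cong refl)
    fix p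
    show "signof p * (\<Sum>qs\<in>interlacing ds. \<Prod>i=0..<n. f (p i) (qs ! i)) =
        signof p * (\<Prod>i=0..<n. F (p i) (ds ! Suc i) - F (p i) (ds ! i))"
      using sum_interlacing_prod[OF ds(2), of "\<lambda>i. f (p i)"] by (simp add: tele)
  qed
  finally show ?thesis unfolding fdet_leibniz .
qed

lemma fdet_first_row:
  assumes "f 0 0 = 1" "\<And>j. j < n \<Longrightarrow> f 0 (Suc j) = 0"
  shows "fdet (Suc n) f = fdet n (\<lambda>i j. f (Suc i) (Suc j))"
  using fdet_first_column[of "\<lambda>i j. f j i" n] assms
  unfolding fdet_transpose[of "Suc n" f] fdet_transpose[of n "\<lambda>i j. f (Suc i) (Suc j)"] by simp

text \<open>Two rows are removed per step. The sum over \<open>ps\<close> replaces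
  \<open>phi\<close> by its antiderivative \<open>F\<close>; the border of ones that this produces
  disappears again, because \<open>F\<close> vanishes at the added dent -1. The sum over
  \<open>qs\<close> replaces \<open>F\<close> by \<open>G\<close>, and now the border stays: it is
  the column of \<open>phi 0\<close> and makes the determinant larger by one.\<close>

lemma upper_count:
  "\<lbrakk>sorted_wrt (<) ds; length ds = Suc e; \<And>d. d \<in> set ds \<Longrightarrow> 0 \<le> d \<and> d < int L\<rbrakk> \<Longrightarrow>
    real (num_tilings (upper_part L (2 * int (Suc e) - 1) - (\<lambda>d. Up d 0) ` set ds)) * (\<Prod>j<Suc e. fact (2 * j))
    = fdet (Suc e) (\<lambda>i j. phi j (ds ! i))"
proof (induction e arbitrary: ds L)
  case 0
  then obtain d where d: "ds = [d]" by (cases ds) auto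
  then have L: "0 \<le> d" "d < int L" using 0 by auto
  have "upper_part L (2 * int (Suc 0) - 1) - (\<lambda>d. Up d 0) ` set ds = strip 0 (int L - 1) 0 (set ds) \<union> {}"
    by (intro face_set_eqI) (auto simp: d)
  moreover have "num_tilings (strip 0 (int L - 1) 0 (set ds) \<union> {}) = (\<Sum>qs\<in>interlacing ds. num_tilings ({} - (\<lambda>q. Up q (0 + 1)) ` set qs))"
    using L by (intro num_tilings_strip) (auto simp: d)
  moreover have "fdet (Suc 0) (\<lambda>i j. phi j (ds ! i)) = 1"
    by (subst fdet_lower_triangular) (auto simp: phi_def)
  ultimately show ?case by (simp add: d)
next
  case (Suc e)
  have "hd ds \<in> set ds" using Suc.prems(2) by (cases ds) auto
  then obtain L' where L': "L = Suc L'" using Suc.prems(3)[of "hd ds"] by (cases L) auto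
  define C :: real where "C = (\<Prod>j<Suc e. fact (2 * j))"
  define C' :: real where "C' = (\<Prod>j<Suc e. (2 * real j + 1) * (2 * real j + 1 + 1))"
  define F where "F = (\<lambda>j t. gam j t / (2 * real j + 1))"
  define G where "G = (\<lambda>j t. phi (Suc j) t / ((2 * real j + 1) * (2 * real j + 1 + 1)))"
  have F: "F j (t + 1) - F j t = phi j (t + 1)" for j t
    unfolding F_def diff_divide_distrib[symmetric] gam_diff by simp
  have G: "G j (t + 1) - G j t = F j t" for j t
    unfolding G_def F_def diff_divide_distrib[symmetric] phi_diff by simp
  \<comment> \<open>The constants (2j + 1)(2j + 2) of the two antiderivatives turn (2j)! into (2j +
    2)!.\<close>
  have CC: "(\<Prod>j<Suc (Suc e). fact (2 * j)) = C * C'"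
    unfolding prod.lessThan_Suc_shift[of _ "Suc e"] C_def C'_def prod.distrib[symmetric]
    by (simp add: mult_ac algebra_simps del: prod.lessThan_Suc)
  have C': "C' > 0" unfolding C'_def by (intro prod_pos) auto
  have inner: "(\<Sum>ps\<in>interlacing (-1 # qs).
      real (num_tilings (upper_part L' (2 * int (Suc e) - 1) - (\<lambda>p. Up (p + 1) 0) ` set ps)) * C)
      = fdet (Suc e) (\<lambda>i j. F j (qs ! i))" if qs: "qs \<in> interlacing ds" for qs
  proof -
    have "ds \<noteq> []" using Suc.prems(2) by auto
    then have hl: "0 \<le> hd ds" "last ds < int L"
      using Suc.prems(3)[of "hd ds"] Suc.prems(3)[of "last ds"] by simp_all
    have q: "sorted_wrt (<) qs" "length qs = Suc e" "\<And>q. q \<in> set qs \<Longrightarrow> 0 \<le> q \<and> q < int L'"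
      using interlacing_props[OF Suc.prems(1) qs] Suc.prems(2) hl L' by fastforce+
    have s: "sorted_wrt (<) (-1 # qs)" using q by fastforce
    have "(\<Sum>ps\<in>interlacing (-1 # qs).
      real (num_tilings (upper_part L' (2 * int (Suc e) - 1) - (\<lambda>p. Up (p + 1) 0) ` set ps)) * C) =
      (\<Sum>ps\<in>interlacing (-1 # qs). fdet (Suc e) (\<lambda>i j. phi j (ps ! i + 1)))"
    proof (rule sum.cong[OF refl])
      fix ps assume ps: "ps \<in> interlacing (-1 # qs)"
      have "last (-1 # qs) < int L'" using q(2) q(3)[OF last_in_set] by auto
      then have p: "sorted_wrt (<) ps" "length ps = Suc e" "\<And>p. p \<in> set ps \<Longrightarrow> -1 \<le> p \<and> p + 1 < int L'"
        using interlacing_props[OF s ps] q(2) by fastforce+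
      \<comment> \<open>\<open>shift\<close> lowers positions by one, so the dents seen in the
        smaller hexagon are larger by one.\<close>
      define ps' where "ps' = map (\<lambda>p. p + 1) ps"
      have "(\<lambda>p. Up (p + 1) 0) ` set ps = (\<lambda>d. Up d 0) ` set ps'" by (auto simp: ps'_def)
      moreover have "real (num_tilings (upper_part L' (2 * int (Suc e) - 1) - (\<lambda>d. Up d 0) ` set ps')) * C
          = fdet (Suc e) (\<lambda>i j. phi j (ps' ! i))"
        unfolding C_def
      proof (rule Suc.IH)
        show "sorted_wrt (<) ps'" unfolding ps'_def sorted_wrt_map
          by (rule sorted_wrt_mono_rel[OF _ p(1)]) simp
        show "length ps' = Suc e" using p(2) by (simp add: ps'_def)
        show "0 \<le> d \<and> d < int L'" if "d \<in> set ps'" for d using that p(3) by (force simp: ps'_def)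
      qed
      moreover have "fdet (Suc e) (\<lambda>i j. phi j (ps' ! i)) = fdet (Suc e) (\<lambda>i j. phi j (ps ! i + 1))"
        by (rule fdet_cong) (simp add: ps'_def p(2))
      ultimately show "real (num_tilings (upper_part L' (2 * int (Suc e) - 1) - (\<lambda>p. Up (p + 1) 0) ` set ps)) * C =
         fdet (Suc e) (\<lambda>i j. phi j (ps ! i + 1))" by simp
    qed
    also have "\<dots> = fdet (Suc e) (\<lambda>i j. F j ((-1 # qs) ! Suc i) - F j ((-1 # qs) ! i))"
      using sum_interlacing_fdet[OF s, of "Suc e" F "\<lambda>j t. phi j (t + 1)"] F q(2) by simp
    \<comment> \<open>The first row of the bordered matrix belongs to the dent -1 and is (1, 0, ...,
      0).\<close>
    also have "\<dots> = fdet (Suc (Suc e)) (\<lambda>i j. case j of 0 \<Rightarrow> 1 | Suc j' \<Rightarrow> F j' ((-1 # qs) ! i))"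
      using fdet_row_differences[of "Suc e" "\<lambda>i j. case j of 0 \<Rightarrow> 1 | Suc j' \<Rightarrow> F j' ((-1 # qs) ! i)"] by simp
    also have "\<dots> = fdet (Suc e) (\<lambda>i j. F j (qs ! i))"
      by (subst fdet_first_row) (auto simp: F_def gam_minus_one)
    finally show ?thesis .
  qed
  have "real (num_tilings (upper_part L (2 * int (Suc (Suc e)) - 1) - (\<lambda>d. Up d 0) ` set ds)) * (C * C') =
     (\<Sum>qs\<in>interlacing ds. \<Sum>ps\<in>interlacing (-1 # qs).
      real (num_tilings (upper_part L' (2 * int (Suc e) - 1) - (\<lambda>p. Up (p + 1) 0) ` set ps)) * C) * C'"
    unfolding L' using Suc.prems by (subst num_tilings_two_rows) (auto simp: L' sum_distrib_right mult.assoc)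
  also have "\<dots> = (\<Sum>qs\<in>interlacing ds. fdet (Suc e) (\<lambda>i j. F j (qs ! i))) * C'"
    by (simp only: inner cong: sum.cong)
  also have "(\<Sum>qs\<in>interlacing ds. fdet (Suc e) (\<lambda>i j. F j (qs ! i))) = fdet (Suc e) (\<lambda>i j. G j (ds ! Suc i) - G j (ds ! i))"
    using sum_interlacing_fdet[OF Suc.prems(1,2), of G F] G by simp
  also have "\<dots> = fdet (Suc (Suc e)) (\<lambda>i j. case j of 0 \<Rightarrow> 1 | Suc j' \<Rightarrow> G j' (ds ! i))"
    using fdet_row_differences[of "Suc e" "\<lambda>i j. case j of 0 \<Rightarrow> 1 | Suc j' \<Rightarrow> G j' (ds ! i)"] by simp
  also have "\<dots> = fdet (Suc (Suc e)) (\<lambda>i j. 1 * (case j of 0 \<Rightarrow> 1 | Suc j' \<Rightarrow> 1 / ((2 * real j' + 1) * (2 * real j' + 1 + 1))) * phi j (ds ! i))"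
    by (rule fdet_cong) (auto simp: G_def phi_def split: nat.split)
  also have "\<dots> = fdet (Suc (Suc e)) (\<lambda>i j. phi j (ds ! i)) / C'"
    unfolding fdet_scale prod.lessThan_Suc_shift[of _ "Suc e"] C'_def
    by (simp add: prod_dividef del: prod.lessThan_Suc)
  finally show ?case unfolding CC using C' by simp
qed

lemma H2_even: "H2 (2 * e) = (\<Prod>j<e. fact (2 * j))"
proof -
  have "H2 (2 * e) = (\<Prod>i=1..e. fact (2 * e - 2 * i))" by (simp add: H2_def)
  also have "\<dots> = (\<Prod>j<e. fact (2 * j))"
    by (rule prod.reindex_bij_witness[of _ "\<lambda>j. e - j" "\<lambda>i. e - i"]) (auto simp: diff_mult_distrib2)
  finally show ?thesis .
qed

lemma dented_count_balanced:
  assumes D: "D \<subseteq> {..<L}" "card D = e" and e: "e \<ge> 1"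
  shows "real (num_tilings (upper_part L (2 * int e - 1) - (\<lambda>d. Up (int d) 0) ` D)) = vand D / H2 (2 * e)"
proof -
  have fin: "finite D" using D finite_subset by blast
  obtain e' where e': "e = Suc e'" using e by (cases e) auto
  define ds where "ds = map int (sorted_list_of_set D)"
  have ds: "sorted_wrt (<) ds" "length ds = Suc e'" "set ds = int ` D"
    using D fin e' by (auto simp: ds_def sorted_wrt_map)
  have img: "(\<lambda>d. Up d 0) ` set ds = (\<lambda>d. Up (int d) 0) ` D" by (auto simp: ds(3))
  have "real (num_tilings (upper_part L (2 * int e - 1) - (\<lambda>d. Up (int d) 0) ` D)) * (\<Prod>j<Suc e'. fact (2 * j))
      = fdet e (\<lambda>i j. phi j (ds ! i))"
    unfolding img[symmetric] e' by (rule upper_count) (use ds D in auto)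
  also have "\<dots> = fdet e (\<lambda>i j. \<Prod>r<j. lam (sorted_list_of_set D ! i) - lam r)"
    using D fin by (intro fdet_cong) (simp add: ds_def phi_def lam_diff)
  also have "\<dots> = vand D"
    using fdet_prod_linear[of e "\<lambda>i. lam (sorted_list_of_set D ! i)" "\<lambda>_ r. lam r"] by (simp add: vand_sorted[OF fin D(2)])
  finally show ?thesis using H2_pos[of "2 * e"] unfolding H2_even e'[symmetric] by (simp add: field_simps)
qed

text \<open>A tiling needs equally many faces of both orientations. The surplus of Up faces in the
  full hexagon is not computed but read off from the dents \<open>{..<e}\<close>, which admit a
  tiling by the balanced case.\<close>

lemma dented_count:
  assumes D: "D \<subseteq> {..<L}" and e: "1 \<le> e" "e \<le> L"
  shows "real (num_tilings (upper_part L (2 * int e - 1) - (\<lambda>d. Up (int d) 0) ` D)) =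
    (if card D = e then vand D / H2 (2 * e) else 0)"
proof (cases "card D = e")
  case True
  then show ?thesis using dented_count_balanced[OF D True e(1)] by simp
next
  case False
  let ?U = "upper_part L (2 * int e - 1)"
  let ?R = "\<lambda>D. ?U - (\<lambda>d. Up (int d) 0) ` D"
  have cards: "card D \<le> card {f \<in> ?U. is_up f} \<and> card {f \<in> ?U. is_up f} - card D = card {f \<in> ?U. \<not> is_up f}"
    if D: "D \<subseteq> {..<L}" and num: "num_tilings (?R D) \<noteq> 0" for D
  proof -
    have sub: "(\<lambda>d. Up (int d) 0) ` D \<subseteq> {f \<in> ?U. is_up f}" using D e by auto
    have c: "card ((\<lambda>d. Up (int d) 0) ` D) = card D" by (rule card_image) (auto simp: inj_on_def)
    have "{f \<in> ?R D. is_up f} = {f \<in> ?U. is_up f} - (\<lambda>d. Up (int d) 0) ` D" by auto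
    then have "card {f \<in> ?R D. is_up f} = card {f \<in> ?U. is_up f} - card D"
      using card_Diff_subset[OF finite_subset[OF sub] sub] c by simp
    moreover have "{f \<in> ?R D. \<not> is_up f} = {f \<in> ?U. \<not> is_up f}" by auto
    ultimately show ?thesis
      using tileable_balanced[of "?R D"] num card_mono[OF _ sub] c by simp
  qed
  have "real (num_tilings (?R {..<e})) > 0"
    using dented_count_balanced[of "{..<e}" L e] e vand_pos[of "{..<e}"] H2_pos[of "2 * e"] by simp
  then have "num_tilings (?R {..<e}) \<noteq> 0" by simp
  then have e': "e \<le> card {f \<in> ?U. is_up f} \<and> card {f \<in> ?U. is_up f} - e = card {f \<in> ?U. \<not> is_up f}"
    using cards[of "{..<e}"] e by auto
  have "num_tilings (?R D) = 0"
  proof (rule ccontr)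
    assume "num_tilings (?R D) \<noteq> 0"
    then show False using cards[OF D] e' False by linarith
  qed
  then show ?thesis using False by simp
qed

section \<open>Removed triangles and reflection\<close>

text \<open>An Up face above the bottom row must be the top of a vertical lozenge in
  \<open>P\<close>. The side neighbours of a Down face must be dents, tops of lozenges one row
  lower, or outside \<open>R\<close>. The conditions are monotone in \<open>P\<close>, so unions of
  filled sets are filled.\<close>

fun supported :: "face set \<Rightarrow> face set \<Rightarrow> face \<Rightarrow> bool" where
  "supported R P (Up i k) \<longleftrightarrow> k = 0 \<or> Down i (k - 1) \<in> P"
| "supported R P (Down i k) \<longleftrightarrow> 0 \<le> k \<and> Up i (k + 1) \<in> P \<and>
      (k = 0 \<longrightarrow> Up i 0 \<in> P \<and> Up (i + 1) 0 \<in> P) \<and>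
      (k \<noteq> 0 \<longrightarrow> (Down i (k - 1) \<in> P \<or> Up i k \<notin> R) \<and> (Down (i + 1) (k - 1) \<in> P \<or> Up (i + 1) k \<notin> R))"

text \<open>\<open>fills R D P\<close>: once the dents \<open>D\<close> in the bottom row are removed from \<open>R\<close>, the remaining part
  of \<open>P\<close> is covered by forced vertical lozenges.\<close>

definition fills :: "face set \<Rightarrow> nat set \<Rightarrow> face set \<Rightarrow> bool" where
  "fills R D P \<longleftrightarrow> P \<subseteq> R \<and> (\<forall>i. Up i 0 \<in> P \<longleftrightarrow> i \<in> int ` D) \<and> (\<forall>f\<in>P. supported R P f)"

lemma supported_mono: "supported R P f \<Longrightarrow> P \<subseteq> P' \<Longrightarrow> supported R P' f"
  by (cases f) auto

lemma fillsI:
  assumes "P \<subseteq> R" "\<And>i. Up i 0 \<in> P \<longleftrightarrow> i \<in> int ` D"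
    and "\<And>i k. Up i k \<in> P \<Longrightarrow> supported R P (Up i k)" "\<And>i k. Down i k \<in> P \<Longrightarrow> supported R P (Down i k)"
  shows "fills R D P"
proof -
  have "supported R P f" if "f \<in> P" for f using assms(3,4) that by (cases f) auto
  then show ?thesis using assms(1,2) by (auto simp: fills_def)
qed

lemma fills_num_tilings:
  assumes "finite R" "fills R D P"
  shows "num_tilings (R - P) = num_tilings (R - (\<lambda>d. Up (int d) 0) ` D)"
proof -
  let ?R = "R - (\<lambda>d. Up (int d) 0) ` D"
  let ?E = "{(i, k). Down i k \<in> P}"
  have sub: "P \<subseteq> R" and z: "\<And>i. Up i 0 \<in> P \<longleftrightarrow> i \<in> int ` D"
    and supp: "\<And>f. f \<in> P \<Longrightarrow> supported R P f"
    using assms(2) by (auto simp: fills_def)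
  note u = supp[of "Up _ _", unfolded supported.simps]
  note d = supp[of "Down _ _", unfolded supported.simps]
  have dent: "Up i k \<in> (\<lambda>d. Up (int d) 0) ` D \<longleftrightarrow> k = 0 \<and> Up i 0 \<in> P" for i k
    unfolding z by auto
  have nd: "Down i k \<notin> (\<lambda>d. Up (int d) 0) ` D" for i k by auto
  have "inj (\<lambda>(i, k). Down i k)" by (auto simp: inj_def)
  then have "finite ((\<lambda>(i, k). Down i k) -` P)"
    using finite_subset[OF sub assms(1)] by (intro finite_vimageI)
  then have finE: "finite ?E" by (simp add: vimage_def case_prod_beta')
  have "num_tilings ?R = num_tilings (?R - (\<Union>(i, k)\<in>?E. {Down i k, Up i (k + 1)}))"
  proof (rule num_tilings_forced_verticals)
    fix i k assume "(i, k) \<in> ?E"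
    then have P: "Down i k \<in> P" by simp
    show "Down i k \<in> ?R \<and> Up i (k + 1) \<in> ?R" using d[OF P] sub P dent nd by auto
    show "Up i k \<notin> ?R \<or> (i, k - 1) \<in> ?E" "Up (i + 1) k \<notin> ?R \<or> (i + 1, k - 1) \<in> ?E"
      using d[OF P] dent[of i k] dent[of "i + 1" k] by (cases "k = 0"; auto)+
  qed (use finE assms(1) in auto)
  also have "?R - (\<Union>(i, k)\<in>?E. {Down i k, Up i (k + 1)}) = R - P"
  proof (rule face_set_eqI)
    fix i k
    have "Up i k \<in> (\<Union>(i, k)\<in>?E. {Down i k, Up i (k + 1)}) \<longleftrightarrow> Down i (k - 1) \<in> P" by force
    moreover have "Up i k \<in> P \<longleftrightarrow> k = 0 \<and> Up i 0 \<in> P \<or> Down i (k - 1) \<in> P"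
      using u[of i k] d[of i "k - 1"] by auto
    ultimately show "Up i k \<in> ?R - (\<Union>(i, k)\<in>?E. {Down i k, Up i (k + 1)}) \<longleftrightarrow> Up i k \<in> R - P"
      using dent[of i k] by blast
    show "Down i k \<in> ?R - (\<Union>(i, k)\<in>?E. {Down i k, Up i (k + 1)}) \<longleftrightarrow> Down i k \<in> R - P"
      by auto
  qed
  finally show ?thesis ..
qed

lemma fills_Un:
  assumes "fills R D P" "fills R D' P'"
  shows "fills R (D \<union> D') (P \<union> P')"
proof -
  note f = assms[unfolded fills_def, THEN conjunct1] and z = assms[unfolded fills_def, THEN conjunct2, THEN conjunct1]
    and s = assms[unfolded fills_def, THEN conjunct2, THEN conjunct2]
  have "P \<union> P' \<subseteq> R" using f by (rule Un_least)
  moreover have "Up i 0 \<in> P \<union> P' \<longleftrightarrow> i \<in> int ` (D \<union> D')" for i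
    unfolding image_Un Un_iff using z[THEN spec, of i] by (simp only:)
  moreover have "supported R (P \<union> P') f" if "f \<in> P \<union> P'" for f
    using that supported_mono[of R P f "P \<union> P'"] supported_mono[of R P' f "P \<union> P'"]
      s(1)[THEN bspec, of f] s(2)[THEN bspec, of f] by blast
  ultimately show ?thesis unfolding fills_def by blast
qed

lemma fills_empty: "fills R {} {}"
  by (simp add: fills_def)

lemma fills_UN:
  assumes "finite I" "\<And>i. i \<in> I \<Longrightarrow> fills R (D i) (P i)"
  shows "fills R (\<Union>i\<in>I. D i) (\<Union>i\<in>I. P i)"
  using assms by (induction I rule: finite_induct) (auto simp: fills_empty intro!: fills_Un)

lemma fills_dents:
  "(\<lambda>d. Up (int d) 0) ` D \<subseteq> R \<Longrightarrow> fills R D ((\<lambda>d. Up (int d) 0) ` D)"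
  by (rule fillsI) auto

lemma int_image_atLeastLessThan: "i \<in> int ` {p..<q} \<longleftrightarrow> int p \<le> i \<and> i < int q"
  by (metis (no_types, lifting) image_int_atLeastLessThan atLeastLessThan_iff)

lemma Up_in_up_triangle [simp]: "Up i k \<in> up_triangle p q \<longleftrightarrow> 0 \<le> k \<and> int p \<le> i \<and> i + k < int q"
  unfolding up_triangle_def faces_within_def
  by (simp add: abscissa_def right_side_iff del: of_int_add) arith

lemma Down_in_up_triangle [simp]: "Down i k \<in> up_triangle p q \<longleftrightarrow> 0 \<le> k \<and> int p \<le> i \<and> i + k + 1 < int q"
  unfolding up_triangle_def faces_within_def
  by (simp add: abscissa_def right_side_iff del: of_int_add) arith

text \<open>Each Down face of the triangle lies between two of its Up faces, which are dents or
  already covered. The assumption on \<open>A\<close> keeps the triangle below the north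
  side.\<close>

lemma fills_up_triangle:
  assumes "q \<le> L" "p < q \<longrightarrow> int q - int p \<le> A"
  shows "fills (upper_part L A) {p..<q} (upper_part L A \<inter> up_triangle p q)"
proof (rule fillsI, goal_cases)
  case (2 i)
  show ?case unfolding int_image_atLeastLessThan using assms by auto
next
  case (3 i k)
  then show ?case by auto
next
  case (4 i k)
  then have "k + 1 < A" using assms by auto
  then show ?case using 4 by auto
qed auto

text \<open>On vertices this maps (i, k) to (i + k, -k), which has the same abscissa. Row
  \<open>k\<close> lies between the heights \<open>k\<close> and \<open>k + 1\<close> and so goes to
  row \<open>- k - 1\<close>.\<close>

fun reflect :: "face \<Rightarrow> face" where
  "reflect (Up i k) = Down (i + k) (- k - 1)"
| "reflect (Down i k) = Up (i + k + 1) (- k - 1)"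

lemma reflect_reflect [simp]: "reflect (reflect f) = f"
  by (cases f) auto

lemma in_reflect_iff: "f \<in> reflect ` R \<longleftrightarrow> reflect f \<in> R"
  by (metis (no_types, lifting) image_iff reflect_reflect)

lemma num_tilings_reflect: "finite R \<Longrightarrow> num_tilings (reflect ` R) = num_tilings R"
proof (rule num_tilings_image)
  show "inj reflect" by (rule inj_on_inverseI[of _ reflect]) simp
  show "adj (reflect f) (reflect g) = adj f g" for f g by (cases f; cases g) auto
qed

lemma reflect_faces_within: "reflect ` faces_within Q = faces_within (\<lambda>u k. Q u (- k))"
proof (rule Set.set_eqI)
  fix f
  have "reflect f \<in> faces_within Q \<longleftrightarrow> f \<in> faces_within (\<lambda>u k. Q u (- k))"
  proof (cases f)
    case (Up i k)
    have "abscissa (i + k, - k - 1 + 1) = abscissa (i, k)"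
      "abscissa (i + k + 1, - k - 1 + 1) = abscissa (i + 1, k)"
      "abscissa (i + k + 1, - k - 1) = abscissa (i, k + 1)"
      by (simp_all add: abscissa_def field_simps)
    then show ?thesis by (auto simp: Up faces_within_def)
  next
    case (Down i k)
    have "abscissa (i + k + 1, - k - 1) = abscissa (i, k + 1)"
      "abscissa (i + k + 1 + 1, - k - 1) = abscissa (i + 1, k + 1)"
      "abscissa (i + k + 1, - k - 1 + 1) = abscissa (i + 1, k)"
      by (simp_all add: abscissa_def field_simps)
    then show ?thesis by (auto simp: Down faces_within_def)
  qed
  then show "f \<in> reflect ` faces_within Q \<longleftrightarrow> f \<in> faces_within (\<lambda>u k. Q u (- k))"
    by (simp only: in_reflect_iff)
qed

lemma reflect_down_triangle: "reflect ` down_triangle p q = up_triangle p q"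
  unfolding down_triangle_def up_triangle_def reflect_faces_within by simp

lemma zigzag_minus [simp]: "zigzag (- k) = zigzag k"
  by (simp add: zigzag_def)

lemma upper_left_side_iff: "of_int i + of_int k / 2 \<le> real n + of_int k / 2 \<longleftrightarrow> i \<le> int n"
proof -
  have "of_int i + of_int k / 2 \<le> real n + of_int k / 2 \<longleftrightarrow> real_of_int i \<le> real_of_int (int n)"
    by simp
  then show ?thesis by (simp only: of_int_le_iff)
qed

lemma le_if_iff: "(u::real) \<le> (if c then p else q) \<longleftrightarrow> (c \<longrightarrow> u \<le> p) \<and> (\<not> c \<longrightarrow> u \<le> q)"
  by simp

lemma right_side_add_iff: "of_int i + of_int k / 2 \<le> real n + real m - of_int k / 2 \<longleftrightarrow> i + k \<le> int n + int m"
  using right_side_iff[of i k "n + m"] by simp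

lemma faces_within_simps:
  "Up i k \<in> faces_within Q \<longleftrightarrow> Q (of_int i + of_int k / 2) k \<and> Q (of_int (i + 1) + of_int k / 2) k
      \<and> Q (of_int i + of_int (k + 1) / 2) (k + 1)"
  "Down i k \<in> faces_within Q \<longleftrightarrow> Q (of_int i + of_int (k + 1) / 2) (k + 1)
      \<and> Q (of_int (i + 1) + of_int (k + 1) / 2) (k + 1) \<and> Q (of_int (i + 1) + of_int k / 2) k"
  by (simp_all add: faces_within_def abscissa_def del: of_int_add)

lemma Up_in_reflect_lower [simp]:
  "Up i k \<in> reflect ` lower_part L z B \<longleftrightarrow> Up i k \<in> upper_part (L + z) B \<and> i < int L"
proof -
  define p q where "p = k div 2" and "q = (k + 1) div 2"
  have pq: "p \<le> q" "q \<le> p + 1" unfolding p_def q_def by presburger+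
  show ?thesis
    unfolding lower_part_def reflect_faces_within Up_in_upper faces_within_simps
    unfolding minus_minus zigzag_minus le_if_iff zigzag_le_iff right_side_add_iff upper_left_side_iff of_nat_add
      p_def[symmetric] q_def[symmetric]
    using pq by (smt (verit))
qed

lemma Down_in_reflect_lower [simp]:
  "Down i k \<in> reflect ` lower_part L z B \<longleftrightarrow> Down i k \<in> upper_part (L + z) B \<and> i < int L"
proof -
  define p q where "p = k div 2" and "q = (k + 1) div 2"
  have pq: "p \<le> q" "q \<le> p + 1" unfolding p_def q_def by presburger+
  show ?thesis
    unfolding lower_part_def reflect_faces_within Down_in_upper faces_within_simps
    unfolding minus_minus zigzag_minus le_if_iff zigzag_le_iff right_side_add_iff upper_left_side_iff of_nat_add
      p_def[symmetric] q_def[symmetric]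
    using pq by (smt (verit))
qed

text \<open>Seen from the line, the lower half widens up to height \<open>z\<close> and narrows
  after that. Prolonging its narrowing side to the line adds a triangle of side \<open>z\<close> and
  gives a halved hexagon with base \<open>L + z\<close>. This is where the last entry of
  \<open>t_minus\<close> comes from.\<close>

lemma reflect_lower_part: "reflect ` lower_part L z B = upper_part (L + z) B - up_triangle L (L + z)"
  by (intro face_set_eqI) auto

lemma Up_in_reflect_left_down [simp]: "Up i k \<in> reflect ` left_down s \<longleftrightarrow> 0 \<le> k \<and> i + k < int s"
  unfolding left_down_def reflect_faces_within faces_within_simps
  by (simp only: minus_minus right_side_iff) presburger

lemma Down_in_reflect_left_down [simp]: "Down i k \<in> reflect ` left_down s \<longleftrightarrow> 0 \<le> k \<and> i + k + 1 < int s"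
  unfolding left_down_def reflect_faces_within faces_within_simps
  by (simp only: minus_minus right_side_iff) presburger

text \<open>The leftmost Down face of an odd row has no left neighbour in the region; this is what
  the alternative "not in \<open>R\<close>" of \<open>supported\<close> is for. A half triangle over
  \<open>s\<close> base positions has \<open>2 * s - 1\<close> rows, hence the bound on
  \<open>A\<close>.\<close>

lemma fills_left_down:
  assumes "s \<le> L" "0 < s \<longrightarrow> 2 * int s - 1 \<le> A"
  shows "fills (upper_part L A) {..<s} (upper_part L A \<inter> reflect ` left_down s)"
proof (rule fillsI, goal_cases)
  case (2 i)
  show ?case unfolding lessThan_atLeast0 int_image_atLeastLessThan using assms by auto
next
  case (3 i k)
  then show ?case by auto
next
  case (4 i k)
  then have "0 \<le> k" "0 \<le> i + (k + 1) div 2" "i + k + 1 < int s" by auto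
  then have "k + 1 < A" using assms by presburger
  then show ?case using 4 assms(1) by auto
qed auto

lemma finite_lower_part [simp]: "finite (lower_part L z B)"
proof -
  have "finite (reflect ` lower_part L z B)" by (simp add: reflect_lower_part)
  then have "finite (reflect ` reflect ` lower_part L z B)" by (rule finite_imageI)
  then show ?thesis by (simp add: image_image)
qed

lemma height_reflect: "height (reflect f) = - height f - 1"
  by (cases f) auto

lemma height_upper: "f \<in> upper_part L A \<Longrightarrow> 0 \<le> height f"
  by (cases f) auto

lemma height_up_triangle: "f \<in> up_triangle p q \<Longrightarrow> 0 \<le> height f"
  by (cases f) auto

lemma height_lower: "f \<in> lower_part L z B \<Longrightarrow> height f < 0"
  using height_upper[of "reflect f" "L + z" B] reflect_lower_part[of L z B] in_reflect_iff[of "reflect f" "lower_part L z B"]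
  by (auto simp: height_reflect)

lemma height_down_triangle: "f \<in> down_triangle p q \<Longrightarrow> height f < 0"
  using height_up_triangle[of "reflect f" p q] reflect_down_triangle[of p q] in_reflect_iff[of "reflect f" "down_triangle p q"]
  by (auto simp: height_reflect)

lemma height_left_down: "f \<in> left_down s \<Longrightarrow> height f < 0"
proof -
  assume "f \<in> left_down s"
  then have "reflect f \<in> reflect ` left_down s" by simp
  then have "0 \<le> height (reflect f)" by (cases "reflect f") simp_all
  then show ?thesis by (simp add: height_reflect)
qed

section \<open>Blocks of dents\<close>

text \<open>Blocks are empty for index 0 and for indices beyond the length, so unions may range over
  all indices of one parity.\<close>

definition blk :: "nat list \<Rightarrow> nat \<Rightarrow> nat set" where
  "blk t i = {psum t (i - 1)..<psum t i}"

definition rblk :: "nat \<Rightarrow> nat list \<Rightarrow> nat \<Rightarrow> nat set" where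
  "rblk n t j = {n - psum t j..<n - psum t (j - 1)}"

lemma entry_0 [simp]: "entry t 0 = 0"
  by (simp add: entry_def)

lemma entry_beyond: "length t < i \<Longrightarrow> entry t i = 0"
  by (simp add: entry_def)

lemma psum_0 [simp]: "psum t 0 = 0"
  by (simp add: psum_def)

lemma psum_Suc: "psum t (Suc k) = psum t k + entry t (Suc k)"
  by (simp add: psum_def)

lemma psum_pred: "1 \<le> k \<Longrightarrow> psum t k = psum t (k - 1) + entry t k"
  using psum_Suc[of t "k - 1"] by simp

lemma psum_mono: "i \<le> j \<Longrightarrow> psum t i \<le> psum t j"
  unfolding psum_def by (rule sum_mono2) auto

lemma psum_length: "length t \<le> k \<Longrightarrow> psum t k = sum_list t"
proof -
  assume "length t \<le> k"
  have "psum t (length t) = (\<Sum>i<length t. t ! i)"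
    unfolding psum_def entry_def by (rule sum.reindex_bij_witness[of _ Suc "\<lambda>i. i - 1"]) auto
  moreover have "psum t k = psum t (length t)" using \<open>length t \<le> k\<close>
    unfolding psum_def by (intro sum.mono_neutral_right) (auto simp: entry_beyond)
  ultimately show ?thesis by (simp add: sum_list_sum_nth lessThan_atLeast0)
qed

lemma psum_le_sum_list: "psum t k \<le> sum_list t"
  using psum_mono[of k "max k (length t)" t] psum_length[of t "max k (length t)"] by simp

lemma odd_even_sum: "odd_sum t + even_sum t = sum_list t"
proof -
  have "odd_sum t + even_sum t = (\<Sum>i\<in>{i \<in> {1..length t}. odd i} \<union> {i \<in> {1..length t}. even i}. entry t i)"
    unfolding odd_sum_def even_sum_def by (rule sum.union_disjoint[symmetric]) auto
  also have "{i \<in> {1..length t}. odd i} \<union> {i \<in> {1..length t}. even i} = {1..length t}" by auto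
  finally show ?thesis using psum_length[of t "length t"] by (simp add: psum_def)
qed

lemma card_blk: "card (blk t i) = entry t i"
  using psum_pred[of i t] by (cases i) (auto simp: blk_def)

lemma card_rblk: "sum_list t \<le> n \<Longrightarrow> card (rblk n t j) = entry t j"
  using psum_pred[of j t] psum_le_sum_list[of t j] by (cases j) (auto simp: rblk_def)

lemma finite_blk [simp]: "finite (blk t i)" "finite (rblk n t i)"
  by (simp_all add: blk_def rblk_def)

lemma blk_index: "d \<in> blk t i \<Longrightarrow> 1 \<le> i \<and> i \<le> length t"
  using card_blk[of t i] entry_beyond[of t i] by (cases "i = 0"; cases "length t < i") (auto simp: blk_def)

lemma rblk_index: "d \<in> rblk n t i \<Longrightarrow> 1 \<le> i \<and> i \<le> length t"
  using psum_pred[of i t] entry_beyond[of t i] by (cases "i = 0"; cases "length t < i") (auto simp: rblk_def)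

lemma blk_disjoint: "i \<noteq> j \<Longrightarrow> blk t i \<inter> blk t j = {}"
proof -
  have "blk t i \<inter> blk t j = {}" if "i < j" for i j
  proof -
    have "psum t i \<le> psum t (j - 1)" using that by (intro psum_mono) simp
    then show ?thesis by (auto simp: blk_def)
  qed
  then show "i \<noteq> j \<Longrightarrow> blk t i \<inter> blk t j = {}" by (metis inf_commute linorder_neqE_nat)
qed

lemma rblk_disjoint: "i \<noteq> j \<Longrightarrow> rblk n t i \<inter> rblk n t j = {}"
proof -
  have "rblk n t i \<inter> rblk n t j = {}" if "i < j" for i j
  proof -
    have "psum t i \<le> psum t (j - 1)" using that by (intro psum_mono) simp
    then show ?thesis by (auto simp: rblk_def)
  qed
  then show "i \<noteq> j \<Longrightarrow> rblk n t i \<inter> rblk n t j = {}" by (metis inf_commute linorder_neqE_nat)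
qed

lemma UN_blk: "(\<Union>i. blk t i) = {..<sum_list t}"
proof -
  have "{..<psum t n} \<subseteq> (\<Union>i. blk t i)" for n
  proof (induction n)
    case (Suc n)
    have "{..<psum t (Suc n)} \<subseteq> {..<psum t n} \<union> blk t (Suc n)" by (auto simp: blk_def)
    then show ?case using Suc by blast
  qed simp
  from this[of "length t"] show ?thesis
    using psum_length[of t "length t"] psum_le_sum_list[of t] by (auto simp: blk_def intro: less_le_trans)
qed

lemma UN_rblk: "sum_list t \<le> n \<Longrightarrow> (\<Union>j. rblk n t j) = {n - sum_list t..<n}"
proof -
  assume n: "sum_list t \<le> n"
  have "{n - psum t k..<n} \<subseteq> (\<Union>i. rblk n t i)" for k
  proof (induction k)
    case (Suc k)
    have "{n - psum t (Suc k)..<n} \<subseteq> {n - psum t k..<n} \<union> rblk n t (Suc k)" by (auto simp: rblk_def)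
    then show ?case using Suc by blast
  qed simp
  from this[of "length t"] have "{n - sum_list t..<n} \<subseteq> (\<Union>i. rblk n t i)" by (simp add: psum_length)
  moreover have "rblk n t i \<subseteq> {n - sum_list t..<n}" for i
    using psum_le_sum_list[of t i] n by (auto simp: rblk_def)
  ultimately show ?thesis by blast
qed

lemma UN_blk_restrict: "(\<Union>i\<in>{i. Q i}. blk t i) = (\<Union>i\<in>{i \<in> {1..length t}. Q i}. blk t i)"
  using blk_index by fastforce

lemma UN_rblk_restrict: "(\<Union>i\<in>{i. Q i}. rblk n t i) = (\<Union>i\<in>{i \<in> {1..length t}. Q i}. rblk n t i)"
  using rblk_index by fastforce

lemma card_UN_blk: "card (\<Union>i\<in>{i. Q i}. blk t i) = (\<Sum>i\<in>{i \<in> {1..length t}. Q i}. entry t i)"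
  by (subst UN_blk_restrict, subst card_UN_disjoint) (auto simp: blk_disjoint card_blk)

lemma card_UN_rblk: "sum_list t \<le> n \<Longrightarrow> card (\<Union>i\<in>{i. Q i}. rblk n t i) = (\<Sum>i\<in>{i \<in> {1..length t}. Q i}. entry t i)"
  by (subst UN_rblk_restrict, subst card_UN_disjoint) (auto simp: rblk_disjoint card_rblk)

lemma finite_UN_blk [simp]: "finite (\<Union>i\<in>{i. Q i}. blk t i)" "finite (\<Union>i\<in>{i. Q i}. rblk n t i)"
  by (subst UN_blk_restrict UN_rblk_restrict, simp)+

lemma up_triangles_K:
  "(\<Union>i\<in>{1..length t div 2}. up_triangle (psum t (2 * i - 1)) (psum t (2 * i))) =
   (\<Union>i\<in>{i \<in> {1..length t}. even i}. up_triangle (psum t (i - 1)) (psum t i))"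
proof -
  have "{i \<in> {1..length t}. even i} = (\<lambda>i. 2 * i) ` {1..length t div 2}" by (auto elim!: evenE)
  then show ?thesis by simp
qed

text \<open>A quartered hexagon is a halved one whose dents are the even blocks. There are
  \<open>even_sum t\<close> of them, which is the balanced number for its height.\<close>

lemma K_eq: "real (K t) = vand (\<Union>i\<in>{i. even i}. blk t i) / H2 (2 * even_sum t)"
proof -
  let ?D = "\<Union>i\<in>{i. even i}. blk t i"
  have card: "card ?D = even_sum t" by (simp add: card_UN_blk even_sum_def)
  have fin: "finite ?D" by (rule finite_UN_blk)
  show ?thesis
  proof (cases "even_sum t = 0")
    \<comment> \<open>The convention for \<open>K\<close> agrees with the empty Vandermonde product
      over \<open>H2 0\<close>.\<close>
    case True
    then have "?D = {}" using card fin by simp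
    then show ?thesis using True by (simp add: K_def vand_def H2_def)
  next
    case False
    let ?R = "upper_part (odd_sum t + even_sum t) (2 * int (even_sum t) - 1)"
    have "fills ?R (\<Union>i\<in>{i \<in> {1..length t}. even i}. blk t i)
       (\<Union>i\<in>{i \<in> {1..length t}. even i}. ?R \<inter> up_triangle (psum t (i - 1)) (psum t i))"
    proof (rule fills_UN)
      fix i assume i: "i \<in> {i \<in> {1..length t}. even i}"
      have "entry t i \<le> even_sum t" unfolding even_sum_def by (rule member_le_sum[OF i]) auto
      then show "fills ?R (blk t i) (?R \<inter> up_triangle (psum t (i - 1)) (psum t i))"
        unfolding blk_def using psum_pred[of i t] psum_le_sum_list[of t i] False i
        by (intro fills_up_triangle) (auto simp: odd_even_sum)
    qed simp
    then have "num_tilings (?R - (\<Union>i\<in>{i \<in> {1..length t}. even i}. ?R \<inter> up_triangle (psum t (i - 1)) (psum t i)))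
        = num_tilings (?R - (\<lambda>d. Up (int d) 0) ` ?D)"
      unfolding UN_blk_restrict[where Q=even] by (intro fills_num_tilings) simp_all
    moreover have "?R - (\<Union>i\<in>{i \<in> {1..length t}. even i}. ?R \<inter> up_triangle (psum t (i - 1)) (psum t i)) = quartered_hexagon t"
      unfolding quartered_hexagon_def up_triangles_K by blast
    ultimately have "K t = num_tilings (?R - (\<lambda>d. Up (int d) 0) ` ?D)"
      using False by (simp add: K_def)
    also have "real \<dots> = vand ?D / H2 (2 * even_sum t)"
      using UN_blk[of t] card False by (intro dented_count_balanced) (auto simp: odd_even_sum)
    finally show ?thesis .
  qed
qed

text \<open>
  The common shape of \<open>t_plus\<close> and of \<open>t_minus\<close> without its first and last entries.
\<close>

definition joined :: "nat \<Rightarrow> nat list \<Rightarrow> nat list \<Rightarrow> nat \<Rightarrow> nat \<Rightarrow> nat list" where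
  "joined w as bs p q = map (entry as) [1..<p + 1] @ [entry as (p + 1) + w + entry bs q] @ rev (map (entry bs) [1..<q])"

context
  fixes w p q n :: nat and as bs :: "nat list"
  assumes p: "length as \<le> p + 1" and q: "length bs \<le> q" "1 \<le> q"
    and n: "n = w + sum_list as + sum_list bs"
begin

lemma length_joined: "length (joined w as bs p q) = p + q"
  using q by (simp add: joined_def)

lemma entry_joined:
  "entry (joined w as bs p q) k = (if k \<le> p then entry as k else if k = p + 1 then entry as (p + 1) + w + entry bs q
     else if k \<le> p + q then entry bs (p + q + 1 - k) else 0)"
proof -
  consider "k = 0" | "1 \<le> k" "k \<le> p" | "k = p + 1" | "p + 1 < k" "k \<le> p + q" | "p + q < k" by linarith
  then show ?thesis
  proof cases
    case 2
    then obtain r where "k = Suc r" "r < p" by (cases k) auto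
    then show ?thesis unfolding entry_def[of "joined w as bs p q"] length_joined
      by (simp add: joined_def nth_append del: upt_Suc)
  next
    case 3
    then show ?thesis unfolding entry_def[of "joined w as bs p q"] length_joined
      using q by (simp add: joined_def nth_append del: upt_Suc)
  next
    case 4
    then obtain r where r: "k = p + 2 + r" by (metis Suc_leI add_2_eq_Suc' add_Suc_right le_Suc_ex Suc_eq_plus1 add_Suc)
    then have "r < q - 1" using 4 by simp
    then have "rev (map (entry bs) [1..<q]) ! r = entry bs (q - 1 - r)"
    proof -
      assume "r < q - 1"
      moreover from this have "Suc (q - Suc (Suc r)) = q - Suc r" by arith
      ultimately show ?thesis by (simp add: rev_nth)
    qed
    then show ?thesis unfolding entry_def[of "joined w as bs p q"] length_joined
      using 4 r by (simp add: joined_def nth_append del: upt_Suc)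
  next
    case 5
    then show ?thesis using entry_beyond[of "joined w as bs p q" k] q by (simp add: length_joined)
  qed simp
qed

lemma psum_joined_left: "k \<le> p \<Longrightarrow> psum (joined w as bs p q) k = psum as k"
  unfolding psum_def by (rule sum.cong) (auto simp: entry_joined)

lemma psum_joined_right:
  "p + 1 \<le> k \<Longrightarrow> k \<le> p + q \<Longrightarrow> psum (joined w as bs p q) k = n - psum bs (p + q - k)"
proof (induction k rule: dec_induct)
  case base
  have "psum (joined w as bs p q) (p + 1) = psum as (p + 1) + w + entry bs q"
    using psum_Suc[of "joined w as bs p q" p] psum_Suc[of as p] by (simp add: psum_joined_left entry_joined)
  also have "psum as (p + 1) = sum_list as" using p by (rule psum_length)
  finally show ?case
    using psum_pred[of q bs] psum_length[of bs q] q n by simp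
next
  case (step k)
  then have "psum (joined w as bs p q) (Suc k) = n - psum bs (p + q - k) + entry bs (p + q - k)"
    by (simp add: psum_Suc entry_joined)
  moreover have "psum bs (p + q - k) = psum bs (p + q - Suc k) + entry bs (p + q - k)"
    using psum_Suc[of bs "p + q - Suc k"] step by (simp add: Suc_diff_Suc)
  moreover have "psum bs (p + q - k) \<le> n" using psum_le_sum_list[of bs "p + q - k"] n by simp
  ultimately show ?case by simp
qed

lemma psum_joined_total: "psum (joined w as bs p q) (p + q) = n"
  using psum_joined_right[of "p + q"] q by simp

lemma blk_joined:
  "blk (joined w as bs p q) i = (if i \<le> p then blk as i else if i = p + 1 then {psum as p..<n - psum bs (q - 1)}
     else rblk n bs (p + q + 1 - i))" if "i \<le> p + q"
proof -
  consider "i \<le> p" | "i = p + 1" | "p + 2 \<le> i" by linarith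
  then show ?thesis
  proof cases
    case 1
    then show ?thesis by (simp add: blk_def psum_joined_left)
  next
    case 2
    then show ?thesis using psum_joined_right[of "p + 1"] q by (simp add: blk_def psum_joined_left)
  next
    case 3
    then have "p + q - (i - 1) = p + q + 1 - i" "p + q + 1 - i - 1 = p + q - i" using that by auto
    then show ?thesis using 3 that psum_joined_right[of "i - 1"] psum_joined_right[of i]
      by (simp add: blk_def rblk_def)
  qed
qed

text \<open>The middle entry contains the gap and must not be selected. A last block of
  \<open>as\<close> or \<open>bs\<close> may be merged into it; \<open>Qa\<close> and
  \<open>Qb\<close> say that such a block is not selected either. Reading \<open>bs\<close>
  backwards turns index \<open>j\<close> into \<open>p + q + 1 - j\<close>, hence the separate
  predicate \<open>Q'\<close>.\<close>

lemma UN_blk_joined: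
  assumes "\<not> Q (p + 1)" and Qa: "\<And>i. Q i \<Longrightarrow> i \<le> length as \<Longrightarrow> i \<le> p"
    and Qb: "\<And>j. Q' j \<Longrightarrow> j \<le> length bs \<Longrightarrow> j < q"
    and QQ: "\<And>j. 1 \<le> j \<Longrightarrow> j < q \<Longrightarrow> Q (p + q + 1 - j) \<longleftrightarrow> Q' j"
  shows "(\<Union>i\<in>{i. Q i}. blk (joined w as bs p q) i) = (\<Union>i\<in>{i. Q i}. blk as i) \<union> (\<Union>j\<in>{j. Q' j}. rblk n bs j)"
proof (intro equalityI subsetI)
  fix d assume "d \<in> (\<Union>i\<in>{i. Q i}. blk (joined w as bs p q) i)"
  then obtain i where i: "Q i" "d \<in> blk (joined w as bs p q) i" by auto
  then have ile: "i \<le> p + q" using blk_index[OF i(2)] by (simp add: length_joined)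
  show "d \<in> (\<Union>i\<in>{i. Q i}. blk as i) \<union> (\<Union>j\<in>{j. Q' j}. rblk n bs j)"
  proof (cases "i \<le> p")
    case True
    then show ?thesis using i blk_joined[OF ile] by auto
  next
    case False
    then have "i \<ge> p + 2" using i assms(1) by (cases "i = p + 1") auto
    then have "Q' (p + q + 1 - i)" "d \<in> rblk n bs (p + q + 1 - i)"
      using QQ[of "p + q + 1 - i"] i ile blk_joined[OF ile] by auto
    then show ?thesis by blast
  qed
next
  fix d assume "d \<in> (\<Union>i\<in>{i. Q i}. blk as i) \<union> (\<Union>j\<in>{j. Q' j}. rblk n bs j)"
  then consider i where "Q i" "d \<in> blk as i" | j where "Q' j" "d \<in> rblk n bs j" by blast
  then show "d \<in> (\<Union>i\<in>{i. Q i}. blk (joined w as bs p q) i)"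
  proof cases
    case 1
    then have "i \<le> p" using Qa blk_index by blast
    then show ?thesis using 1 blk_joined[of i] by auto
  next
    case 2
    then have j: "1 \<le> j" "j < q" using Qb rblk_index by blast+
    define i where "i = p + q + 1 - j"
    have "\<not> i \<le> p" "i \<noteq> p + 1" "i \<le> p + q" "p + q + 1 - i = j" using j by (auto simp: i_def)
    then have "d \<in> blk (joined w as bs p q) i" using 2 blk_joined[of i] by simp
    then have "d \<in> blk (joined w as bs p q) (p + q + 1 - j)" unfolding i_def .
    then show ?thesis using QQ[OF j] 2 by blast
  qed
qed

end

section \<open>The dents of the two halves and their relation to K\<close>

definition up_dents :: "nat \<Rightarrow> nat list \<Rightarrow> nat list \<Rightarrow> nat set" where
  "up_dents n as bs = (\<Union>i\<in>{i. even i}. blk as i) \<union> (\<Union>j\<in>{j. odd j}. rblk n bs j)"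

definition down_dents :: "nat \<Rightarrow> nat list \<Rightarrow> nat list \<Rightarrow> nat set" where
  "down_dents n as bs = (\<Union>i\<in>{i. odd i}. blk as i) \<union> (\<Union>j\<in>{j. even j}. rblk n bs j)"

lemma dents_props:
  assumes n: "n = w + sum_list as + sum_list bs"
  shows "card (up_dents n as bs) = even_sum as + odd_sum bs"
    and "card (down_dents n as bs) = odd_sum as + even_sum bs"
    and "up_dents n as bs \<inter> down_dents n as bs = {}"
    and "up_dents n as bs \<union> down_dents n as bs = {..<sum_list as} \<union> {n - sum_list bs..<n}"
proof -
  have b: "sum_list bs \<le> n" using n by simp
  have sub: "blk as i \<subseteq> {..<sum_list as}" "rblk n bs j \<subseteq> {n - sum_list bs..<n}" for i j
    using UN_blk[of as] UN_rblk[OF b] by blast+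
  have disj: "blk as i \<inter> rblk n bs j = {}" for i j
    using sub(1)[of i] sub(2)[of j] n by fastforce
  have crd: "card ((\<Union>i\<in>{i. Q i}. blk as i) \<union> (\<Union>j\<in>{j. Q' j}. rblk n bs j)) =
      (\<Sum>i\<in>{i \<in> {1..length as}. Q i}. entry as i) + (\<Sum>i\<in>{i \<in> {1..length bs}. Q' i}. entry bs i)" for Q Q'
  proof -
    have "(\<Union>i\<in>{i. Q i}. blk as i) \<inter> (\<Union>j\<in>{j. Q' j}. rblk n bs j) = {}" using disj by blast
    from card_Un_disjoint[OF finite_UN_blk this] show ?thesis
      by (simp only: card_UN_blk card_UN_rblk[OF b])
  qed
  show "card (up_dents n as bs) = even_sum as + odd_sum bs"
    "card (down_dents n as bs) = odd_sum as + even_sum bs"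
    by (simp_all add: up_dents_def down_dents_def crd even_sum_def odd_sum_def)
  show "up_dents n as bs \<inter> down_dents n as bs = {}"
  proof (rule equals0I)
    fix d assume d: "d \<in> up_dents n as bs \<inter> down_dents n as bs"
    obtain i where i: "even i \<and> d \<in> blk as i \<or> odd i \<and> d \<in> rblk n bs i"
      using d by (auto simp: up_dents_def)
    obtain j where j: "odd j \<and> d \<in> blk as j \<or> even j \<and> d \<in> rblk n bs j"
      using d by (auto simp: down_dents_def)
    show False
      using i j disj[of i j] disj[of j i] blk_disjoint[of i j as] rblk_disjoint[of i j n bs]
      by (cases "i = j") auto
  qed
  have "up_dents n as bs \<union> down_dents n as bs = (\<Union>i. blk as i) \<union> (\<Union>j. rblk n bs j)"
    unfolding up_dents_def down_dents_def by blast
  then show "up_dents n as bs \<union> down_dents n as bs = {..<sum_list as} \<union> {n - sum_list bs..<n}"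
    by (simp add: UN_blk UN_rblk[OF b])
qed

text \<open>As \<open>p\<close> and \<open>q\<close> are even, the middle index \<open>p + 1\<close>
  is odd, and reversing \<open>bs\<close> exchanges parities: the even blocks are the bases of the
  triangles above the line.\<close>

lemma K_t_plus:
  assumes n: "n = (x + y) + sum_list as + sum_list bs"
  shows "real (K (t_plus x y as bs)) = vand (up_dents n as bs) / H2 (2 * (even_sum as + odd_sum bs))"
proof -
  define p where "p = 2 * (max 1 (length as) div 2)"
  define q where "q = 2 * ((max 1 (length bs) + 1) div 2)"
  have pq: "length as \<le> p + 1" "length bs \<le> q" "1 \<le> q" "even p" "even q"
    by (auto simp: p_def q_def)
  have t: "t_plus x y as bs = joined (x + y) as bs p q"
    by (simp add: t_plus_def joined_def Let_def p_def q_def add_ac)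
  have D: "(\<Union>i\<in>{i. even i}. blk (t_plus x y as bs) i) = up_dents n as bs"
    unfolding t up_dents_def
  proof (rule UN_blk_joined[OF pq(1-3) n])
    fix i :: nat
    show "even i \<Longrightarrow> i \<le> length as \<Longrightarrow> i \<le> p" using pq by (cases "i = p + 1") auto
    show "odd i \<Longrightarrow> i \<le> length bs \<Longrightarrow> i < q" using pq by (cases "i = q") auto
    show "1 \<le> i \<Longrightarrow> i < q \<Longrightarrow> even (p + q + 1 - i) = odd i" using pq by (auto simp: even_diff_nat)
  qed (use pq in auto)
  have "even_sum (t_plus x y as bs) = card (up_dents n as bs)"
    unfolding D[symmetric] by (simp add: card_UN_blk even_sum_def)
  then show ?thesis using K_eq[of "t_plus x y as bs"] by (simp add: D dents_props(1)[OF n])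
qed

text \<open>The leading 0 moves every index by one, so the even blocks are the odd ones of
  \<open>J\<close>. The last entry adds the positions of the triangle by which the base was
  lengthened.\<close>

lemma K_t_minus:
  assumes n: "n = (x + y) + sum_list as + sum_list bs"
  shows "real (K (t_minus x y z as bs)) = vand (down_dents n as bs \<union> {n..<n + z}) / H2 (2 * (odd_sum as + even_sum bs + z))"
proof -
  define p where "p = 2 * ((max 1 (length as) + 1) div 2) - 1"
  define q where "q = 2 * (max 1 (length bs) div 2) + 1"
  have pq: "length as \<le> p + 1" "length bs \<le> q" "1 \<le> q" "odd p" "odd q"
    by (auto simp: p_def q_def)
  define J where "J = joined (x + y) as bs p q"
  have p1: "2 * ((max 1 (length as) + 1) div 2) = p + 1" by (simp add: p_def)
  have t: "t_minus x y z as bs = 0 # J @ [z]"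
    unfolding t_minus_def Let_def p1 by (simp add: J_def joined_def q_def add_ac)
  let ?t = "t_minus x y z as bs"
  have lJ: "length J = p + q" unfolding J_def by (rule length_joined[OF pq(1-3) n])
  have lt: "length ?t = p + q + 2" by (simp add: t lJ)
  have ent: "entry ?t (Suc i) = entry J i" if "i \<le> p + q" for i
    using that by (cases i) (auto simp: entry_def t lJ nth_append)
  have ps: "psum ?t (Suc i) = psum J i" if "i \<le> p + q" for i
    using that
  proof (induction i)
    case 0
    then show ?case using ent[of 0] by (simp add: psum_Suc)
  next
    case (Suc i)
    then show ?case using ent[of "Suc i"] by (simp add: psum_Suc)
  qed
  have blkt: "blk ?t (Suc i) = blk J i" if "i \<le> p + q" for i
    using ps[of i] ps[of "i - 1"] that by (cases i) (auto simp: blk_def)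
  have tot: "psum J (p + q) = n" unfolding J_def by (rule psum_joined_total[OF pq(1-3) n])
  have last: "blk ?t (p + q + 2) = {n..<n + z}"
  proof -
    have "entry ?t (p + q + 2) = z" by (simp add: entry_def lt) (simp add: t lJ nth_append)
    then show ?thesis using psum_Suc[of ?t "Suc (p + q)"] ps[of "p + q"] tot by (simp add: blk_def)
  qed
  have DJ: "(\<Union>i\<in>{i. odd i}. blk J i) = down_dents n as bs"
    unfolding J_def down_dents_def
  proof (rule UN_blk_joined[OF pq(1-3) n])
    fix i :: nat
    show "odd i \<Longrightarrow> i \<le> length as \<Longrightarrow> i \<le> p" using pq by (cases "i = p + 1") auto
    show "even i \<Longrightarrow> i \<le> length bs \<Longrightarrow> i < q" using pq by (cases "i = q") auto
    show "1 \<le> i \<Longrightarrow> i < q \<Longrightarrow> odd (p + q + 1 - i) = even i" using pq by (auto simp: even_diff_nat)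
  qed (use pq in auto)
  have D: "(\<Union>i\<in>{i. even i}. blk ?t i) = down_dents n as bs \<union> {n..<n + z}"
  proof (intro equalityI subsetI)
    fix d assume "d \<in> (\<Union>i\<in>{i. even i}. blk ?t i)"
    then obtain i where i: "even i" "d \<in> blk ?t i" by auto
    then have "1 \<le> i" "i \<le> p + q + 2" using blk_index[OF i(2)] lt by auto
    then obtain k where k: "i = Suc k" by (cases i) auto
    show "d \<in> down_dents n as bs \<union> {n..<n + z}"
    proof (cases "i = p + q + 2")
      case True
      then show ?thesis using i last by simp
    next
      case False
      then have "d \<in> blk J k" "odd k" using i k blkt[of k] \<open>i \<le> p + q + 2\<close> by auto
      then show ?thesis using DJ by blast
    qed
  next
    fix d assume "d \<in> down_dents n as bs \<union> {n..<n + z}"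
    then consider i where "odd i" "d \<in> blk J i" | "d \<in> {n..<n + z}" using DJ by blast
    then show "d \<in> (\<Union>i\<in>{i. even i}. blk ?t i)"
    proof cases
      case 1
      then have "d \<in> blk ?t (Suc i)" using blk_index[of d J i] lJ blkt[of i] by simp
      then show ?thesis using 1 by (intro UN_I[of "Suc i"]) auto
    next
      case 2
      then show ?thesis using last pq by (intro UN_I[of "p + q + 2"]) auto
    qed
  qed
  have "down_dents n as bs \<subseteq> {..<n}"
  proof -
    have "down_dents n as bs \<subseteq> {..<sum_list as} \<union> {n - sum_list bs..<n}"
      unfolding dents_props(4)[OF n, symmetric] by (rule Un_upper2)
    then show ?thesis using n by auto
  qed
  then have "card (down_dents n as bs \<union> {n..<n + z}) = odd_sum as + even_sum bs + z"
    unfolding dents_props(2)[OF n, symmetric]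
    by (subst card_Un_disjoint) (auto intro: finite_subset)
  moreover have "even_sum ?t = card (down_dents n as bs \<union> {n..<n + z})"
    unfolding D[symmetric] by (simp add: card_UN_blk even_sum_def)
  ultimately show ?thesis using K_eq[of ?t] by (simp add: D)
qed

section \<open>Cutting the region along the line\<close>

text \<open>The absolute values account for the pairs from \<open>A\<close> and \<open>B\<close> in
  either order.\<close>

lemma vand_union:
  assumes "finite A" "finite B" "A \<inter> B = {}"
  shows "vand (A \<union> B) = vand A * vand B * (\<Prod>t\<in>B. \<Prod>s\<in>A. \<bar>lam t - lam s\<bar>)"
proof -
  \<comment> \<open>The default 1 makes the Vandermonde product a full double product, which splits
    over a disjoint union.\<close>
  define g where "g = (\<lambda>t s. if s < t then lam t - lam s else 1)"
  have v: "vand D = (\<Prod>t\<in>D. \<Prod>s\<in>D. g t s)" if "finite D" for D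
    unfolding vand_def g_def using that
    by (intro prod.cong refl prod.mono_neutral_cong_left) auto
  have sym: "g t s * g s t = \<bar>lam t - lam s\<bar>" if "t \<noteq> s" for t s
    using that lam_strict_mono[of s t] lam_strict_mono[of t s] by (auto simp: g_def)
  have split: "(\<Prod>s\<in>A \<union> B. f s) = (\<Prod>s\<in>A. f s) * (\<Prod>s\<in>B. f s)" for f :: "nat \<Rightarrow> real"
    by (rule prod.union_disjoint[OF assms])
  have "vand (A \<union> B) = (\<Prod>t\<in>A \<union> B. \<Prod>s\<in>A \<union> B. g t s)" using assms by (intro v) simp
  also have "\<dots> = vand A * vand B * ((\<Prod>t\<in>A. \<Prod>s\<in>B. g t s) * (\<Prod>t\<in>B. \<Prod>s\<in>A. g t s))"
    unfolding split prod.distrib v[OF assms(1)] v[OF assms(2)] by (simp add: mult_ac)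
  also have "(\<Prod>t\<in>A. \<Prod>s\<in>B. g t s) = (\<Prod>t\<in>B. \<Prod>s\<in>A. g s t)" by (rule prod.swap)
  also have "(\<Prod>t\<in>B. \<Prod>s\<in>A. g s t) * (\<Prod>t\<in>B. \<Prod>s\<in>A. g t s) = (\<Prod>t\<in>B. \<Prod>s\<in>A. \<bar>lam t - lam s\<bar>)"
    unfolding prod.distrib[symmetric]
  proof (intro prod.cong refl)
    fix t s assume "t \<in> B" "s \<in> A"
    then have "t \<noteq> s" using assms(3) by auto
    then show "g s t * g t s = \<bar>lam t - lam s\<bar>" using sym[of t s] by (simp add: mult.commute)
  qed
  finally show ?thesis .
qed

lemma dents_subset:
  assumes n: "n = w + sum_list as + sum_list bs"
  shows "up_dents n as bs \<subseteq> {..<n}" "down_dents n as bs \<subseteq> {..<n}"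
proof -
  have "{..<sum_list as} \<union> {n - sum_list bs..<n} \<subseteq> {..<n}" using n by auto
  then show "up_dents n as bs \<subseteq> {..<n}" "down_dents n as bs \<subseteq> {..<n}"
    unfolding dents_props(4)[OF n, symmetric] by blast+
qed

lemma fills_dent_iff:
  assumes "fills R D P"
  shows "Up (int d) 0 \<in> P \<longleftrightarrow> d \<in> D"
proof -
  have "Up (int d) 0 \<in> P \<longleftrightarrow> int d \<in> int ` D" using assms unfolding fills_def by blast
  then show ?thesis by (simp add: inj_image_mem_iff)
qed

definition up_triangles :: "nat \<Rightarrow> nat list \<Rightarrow> nat list \<Rightarrow> face set" where
  "up_triangles n as bs = (\<Union>i\<in>{i \<in> {1..length as}. even i}. up_triangle (psum as (i - 1)) (psum as i))
     \<union> (\<Union>j\<in>{j \<in> {1..length bs}. odd j}. up_triangle (n - psum bs j) (n - psum bs (j - 1)))"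

definition down_triangles :: "nat \<Rightarrow> nat list \<Rightarrow> nat list \<Rightarrow> face set" where
  "down_triangles n as bs = left_down (entry as 1)
     \<union> (\<Union>i\<in>{i \<in> {2..length as}. odd i}. down_triangle (psum as (i - 1)) (psum as i))
     \<union> (\<Union>j\<in>{j \<in> {1..length bs}. even j}. down_triangle (n - psum bs j) (n - psum bs (j - 1)))"

text \<open>The height of a face tells the side of the line on which it lies, so a removed triangle
  affects only its own half.\<close>

lemma R2_eq:
  assumes "n = (x + y) + sum_list as + sum_list bs"
  shows "R2 x y z as bs = (lower_part n z (2 * int (y + z + odd_sum as + even_sum bs) - 1) - down_triangles n as bs)
    \<union> (upper_part n (2 * int (y + even_sum as + odd_sum bs) - 1) - up_triangles n as bs)"
proof -
  have X: "left_down (entry as 1)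
           \<union> (\<Union>i\<in>{2..length as}. (if even i then up_triangle else down_triangle) (psum as (i - 1)) (psum as i))
           \<union> (\<Union>j\<in>{1..length bs}. (if odd j then up_triangle else down_triangle) (n - psum bs j) (n - psum bs (j - 1)))
      = up_triangles n as bs \<union> down_triangles n as bs"
  proof -
    have "{i \<in> {1..length as}. even i} = {i \<in> {2..length as}. even i}"
      by (auto simp: numeral_2_eq_2 Suc_le_eq)
    moreover have "(\<Union>i\<in>I. (if Q i then F else G) (p i) (q i)) = (\<Union>i\<in>{i \<in> I. Q i}. F (p i) (q i)) \<union> (\<Union>i\<in>{i \<in> I. \<not> Q i}. G (p i) (q i))"
      for I :: "nat set" and Q and F G :: "nat \<Rightarrow> nat \<Rightarrow> face set" and p q
      by (auto simp: if_distribR split: if_splits)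
    ultimately show ?thesis unfolding up_triangles_def down_triangles_def by auto
  qed
  have u: "f \<notin> down_triangles n as bs" if "f \<in> upper_part n A" for f A
    using height_upper[OF that] height_down_triangle height_left_down
    by (fastforce simp: down_triangles_def)
  have l: "f \<notin> up_triangles n as bs" if "f \<in> lower_part n z B" for f B
    using height_lower[OF that] height_up_triangle by (fastforce simp: up_triangles_def)
  have "R2 x y z as bs = (upper_part n (2 * int (y + even_sum as + odd_sum bs) - 1)
     \<union> lower_part n z (2 * int (y + z + odd_sum as + even_sum bs) - 1)) - (up_triangles n as bs \<union> down_triangles n as bs)"
    unfolding R2_def Let_def assms[symmetric] X[symmetric] ..
  then show ?thesis using u l by blast
qed

lemma entry_le_sum:
  "even i \<Longrightarrow> entry t i \<le> even_sum t" "odd i \<Longrightarrow> entry t i \<le> odd_sum t"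
proof -
  have "entry t i \<le> (\<Sum>i\<in>{i \<in> {1..length t}. Q i}. entry t i)" if "Q i" for Q
  proof (cases "1 \<le> i \<and> i \<le> length t")
    case True
    then show ?thesis using that by (intro member_le_sum) auto
  next
    case False
    then have "entry t i = 0" by (auto simp: entry_def)
    then show ?thesis by simp
  qed
  from this[of even] this[of odd]
  show "even i \<Longrightarrow> entry t i \<le> even_sum t" "odd i \<Longrightarrow> entry t i \<le> odd_sum t"
    unfolding even_sum_def odd_sum_def by simp_all
qed

lemma fills_blk:
  assumes "sum_list t \<le> L" "0 < entry t i \<Longrightarrow> int (entry t i) \<le> A"
  shows "fills (upper_part L A) (blk t i) (upper_part L A \<inter> up_triangle (psum t (i - 1)) (psum t i))"
  unfolding blk_def using assms psum_le_sum_list[of t i] psum_pred[of i t]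
  by (intro fills_up_triangle) (cases "i = 0"; auto)+

lemma fills_rblk:
  assumes "sum_list t \<le> n" "n \<le> L" "0 < entry t i \<Longrightarrow> int (entry t i) \<le> A"
  shows "fills (upper_part L A) (rblk n t i) (upper_part L A \<inter> up_triangle (n - psum t i) (n - psum t (i - 1)))"
proof -
  have "n - psum t i < n - psum t (i - 1) \<longrightarrow> int (n - psum t (i - 1)) - int (n - psum t i) \<le> A"
    using assms psum_le_sum_list[of t i] psum_pred[of i t] by (cases "i = 0") auto
  then show ?thesis unfolding rblk_def using assms by (intro fills_up_triangle) auto
qed

lemma fills_up_triangles:
  assumes n: "n = w + sum_list as + sum_list bs" and e: "even_sum as + odd_sum bs \<le> e"
  shows "fills (upper_part n (2 * int e - 1)) (up_dents n as bs) (upper_part n (2 * int e - 1) \<inter> up_triangles n as bs)"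
proof -
  let ?R = "upper_part n (2 * int e - 1)"
  have "fills ?R (up_dents n as bs)
     ((\<Union>i\<in>{i \<in> {1..length as}. even i}. ?R \<inter> up_triangle (psum as (i - 1)) (psum as i)) \<union>
      (\<Union>j\<in>{j \<in> {1..length bs}. odd j}. ?R \<inter> up_triangle (n - psum bs j) (n - psum bs (j - 1))))"
    unfolding up_dents_def UN_blk_restrict[where Q=even] UN_rblk_restrict[where Q=odd]
  proof (intro fills_Un fills_UN)
    fix i assume "i \<in> {i \<in> {1..length as}. even i}"
    then show "fills ?R (blk as i) (?R \<inter> up_triangle (psum as (i - 1)) (psum as i))"
      using entry_le_sum(1)[of i as] e n by (intro fills_blk) auto
  next
    fix i assume "i \<in> {i \<in> {1..length bs}. odd i}"
    then show "fills ?R (rblk n bs i) (?R \<inter> up_triangle (n - psum bs i) (n - psum bs (i - 1)))"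
      using entry_le_sum(2)[of i bs] e n by (intro fills_rblk) auto
  qed auto
  then show ?thesis unfolding up_triangles_def Int_Un_distrib Int_UN_distrib .
qed

text \<open>The first block carries a half triangle instead of a triangle, and the last
  \<open>z\<close> positions carry the corner by which the base was lengthened.\<close>

lemma fills_down_triangles:
  assumes n: "n = w + sum_list as + sum_list bs" and e: "odd_sum as + even_sum bs + z \<le> e"
  shows "fills (upper_part (n + z) (2 * int e - 1)) (down_dents n as bs \<union> {n..<n + z})
    (upper_part (n + z) (2 * int e - 1) \<inter> (reflect ` down_triangles n as bs \<union> up_triangle n (n + z)))"
proof -
  let ?R = "upper_part (n + z) (2 * int e - 1)"
  have A: "(\<Union>i\<in>{i. odd i}. blk as i) = {..<entry as 1} \<union> (\<Union>i\<in>{i \<in> {2..length as}. odd i}. blk as i)"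
  proof -
    have "blk as 1 = {..<entry as 1}" using psum_Suc[of as 0] by (auto simp: blk_def)
    moreover have "(\<Union>i\<in>{i. odd i}. blk as i) = blk as 1 \<union> (\<Union>i\<in>{i \<in> {2..length as}. odd i}. blk as i)"
    proof (intro equalityI subsetI)
      fix d assume "d \<in> (\<Union>i\<in>{i. odd i}. blk as i)"
      then obtain i where i: "odd i" "d \<in> blk as i" by auto
      then have "i = 1 \<or> i \<in> {i \<in> {2..length as}. odd i}" using blk_index[OF i(2)] by auto
      then show "d \<in> blk as 1 \<union> (\<Union>i\<in>{i \<in> {2..length as}. odd i}. blk as i)" using i(2) by blast
    next
      fix d assume "d \<in> blk as 1 \<union> (\<Union>i\<in>{i \<in> {2..length as}. odd i}. blk as i)"
      moreover have "blk as 1 \<subseteq> (\<Union>i\<in>{i. odd i}. blk as i)" by (rule UN_upper) simp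
      ultimately show "d \<in> (\<Union>i\<in>{i. odd i}. blk as i)" by blast
    qed
    ultimately show ?thesis by simp
  qed
  have "fills ?R (down_dents n as bs \<union> {n..<n + z})
     ((?R \<inter> reflect ` left_down (entry as 1)) \<union>
      (\<Union>i\<in>{i \<in> {2..length as}. odd i}. ?R \<inter> up_triangle (psum as (i - 1)) (psum as i)) \<union>
      (\<Union>j\<in>{j \<in> {1..length bs}. even j}. ?R \<inter> up_triangle (n - psum bs j) (n - psum bs (j - 1)))
      \<union> (?R \<inter> up_triangle n (n + z)))"
    unfolding down_dents_def A UN_rblk_restrict[where Q=even]
  proof (intro fills_Un fills_UN)
    show "fills ?R {..<entry as 1} (?R \<inter> reflect ` left_down (entry as 1))"
      using entry_le_sum(2)[of 1 as] odd_even_sum[of as] e n by (intro fills_left_down) auto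
    show "fills ?R {n..<n + z} (?R \<inter> up_triangle n (n + z))"
      using e by (intro fills_up_triangle) auto
  next
    fix i assume "i \<in> {i \<in> {2..length as}. odd i}"
    then show "fills ?R (blk as i) (?R \<inter> up_triangle (psum as (i - 1)) (psum as i))"
      using entry_le_sum(2)[of i as] e n by (intro fills_blk) auto
  next
    fix i assume "i \<in> {i \<in> {1..length bs}. even i}"
    then show "fills ?R (rblk n bs i) (?R \<inter> up_triangle (n - psum bs i) (n - psum bs (i - 1)))"
      using entry_le_sum(1)[of i bs] e n by (intro fills_rblk) auto
  qed auto
  then show ?thesis
    unfolding down_triangles_def image_Un image_UN reflect_down_triangle Int_Un_distrib Int_UN_distrib .
qed

text \<open>For \<open>e = 0\<close> the hexagon is empty, and since the dents lie in it, so is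
  \<open>D\<close>.\<close>

lemma dented_count_within:
  assumes D: "D \<subseteq> {..<L}" "(\<lambda>d. Up (int d) 0) ` D \<subseteq> upper_part L (2 * int e - 1)" and e: "e \<le> L"
  shows "real (num_tilings (upper_part L (2 * int e - 1) - (\<lambda>d. Up (int d) 0) ` D)) =
    (if card D = e then vand D / H2 (2 * e) else 0)"
proof (cases "e = 0")
  case True
  have "upper_part L (2 * int e - 1) = {}" unfolding True by (intro face_set_eqI) auto
  then show ?thesis using D True by (simp add: vand_def H2_def)
next
  case False
  then show ?thesis using dented_count[OF D(1)] e by simp
qed

lemma vand_product_gap_weight:
  assumes U: "finite U" "finite U'" "U \<inter> U' = {}" "U \<union> U' = {..<a} \<union> {N..<N + c}" and W: "W \<subseteq> {a..<N}"
  shows "vand (U \<union> W) * vand (U' \<union> W) = vand U * vand U' * ((vand W)\<^sup>2 * (\<Prod>s\<in>W. gap_weight a c N s))"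
proof -
  have finW: "finite W" using W finite_subset by blast
  have "({..<a} \<union> {N..<N + c}) \<inter> W = {}" using W by auto
  then have disj: "U \<inter> W = {}" "U' \<inter> W = {}" unfolding U(4)[symmetric] by blast+
  have "(\<Prod>s\<in>U. \<bar>lam t - lam s\<bar>) * (\<Prod>s\<in>U'. \<bar>lam t - lam s\<bar>) = gap_weight a c N t" if t: "t \<in> W" for t
  proof -
    have tN: "a \<le> t" "t < N" using t W by auto
    have "(\<Prod>s\<in>U. \<bar>lam t - lam s\<bar>) * (\<Prod>s\<in>U'. \<bar>lam t - lam s\<bar>) = (\<Prod>s\<in>{..<a} \<union> {N..<N + c}. \<bar>lam t - lam s\<bar>)"
      unfolding U(4)[symmetric] by (rule prod.union_disjoint[OF U(1-3), symmetric])
    also have "\<dots> = (\<Prod>s\<in>{..<a}. \<bar>lam t - lam s\<bar>) * (\<Prod>s\<in>{N..<N + c}. \<bar>lam t - lam s\<bar>)"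
      using tN by (intro prod.union_disjoint) auto
    \<comment> \<open>Positions below \<open>a\<close> are smaller than \<open>t\<close>, those from
      \<open>N\<close> on are larger; this fixes the signs in \<open>gap_weight\<close>.\<close>
    also have "(\<Prod>s\<in>{..<a}. \<bar>lam t - lam s\<bar>) = (\<Prod>s<a. lam t - lam s)"
      using tN lam_strict_mono[of _ t] by (intro prod.cong refl) (simp add: less_imp_le)
    also have "(\<Prod>s\<in>{N..<N + c}. \<bar>lam t - lam s\<bar>) = (\<Prod>s=N..<N + c. lam s - lam t)"
      using tN lam_strict_mono[of t] by (intro prod.cong refl) (simp add: less_imp_le)
    finally show ?thesis by (simp add: gap_weight_def)
  qed
  then have "(\<Prod>t\<in>W. \<Prod>s\<in>U. \<bar>lam t - lam s\<bar>) * (\<Prod>t\<in>W. \<Prod>s\<in>U'. \<bar>lam t - lam s\<bar>) = (\<Prod>s\<in>W. gap_weight a c N s)"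
    unfolding prod.distrib[symmetric] by (rule prod.cong[OF refl])
  then show ?thesis
    unfolding vand_union[OF U(1) finW disj(1)] vand_union[OF U(2) finW disj(2)]
    by (simp add: power2_eq_square mult_ac)
qed

text \<open>The balanced numbers of dents are \<open>card U + y\<close> above and
  \<open>card U' + y\<close> below, so each half on its own forces exactly \<open>y\<close>
  crossings. The two counts then multiply to \<open>vand_product_gap_weight\<close>.\<close>

lemma num_tilings_R2_sum:
  assumes n: "n = (x + y) + sum_list as + sum_list bs"
  shows "real (num_tilings (R2 x y z as bs)) =
    vand (up_dents n as bs) * vand (down_dents n as bs \<union> {n..<n + z})
    / (H2 (2 * (y + even_sum as + odd_sum bs)) * H2 (2 * (y + z + odd_sum as + even_sum bs)))
    * gap_sum y (sum_list as) (sum_list bs + z) (sum_list as + x + y)"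
proof -
  define e where "e = y + even_sum as + odd_sum bs"
  define e' where "e' = y + z + odd_sum as + even_sum bs"
  define Up0 where "Up0 = upper_part n (2 * int e - 1)"
  define Lo0 where "Lo0 = lower_part n z (2 * int e' - 1)"
  define S where "S = Up0 - up_triangles n as bs"
  define R where "R = Lo0 - down_triangles n as bs"
  \<comment> \<open>\<open>l v\<close> and \<open>r v\<close> are the faces below and above the base
    edge at position \<open>v\<close>.\<close>
  define l where "l = (\<lambda>v::nat. Down (int v) (-1))"
  define r where "r = (\<lambda>v::nat. Up (int v) 0)"
  define U where "U = up_dents n as bs"
  define U' where "U' = down_dents n as bs \<union> {n..<n + z}"
  define a where "a = sum_list as"
  define c where "c = sum_list bs + z"
  define N where "N = a + x + y"
  define Up1 where "Up1 = upper_part (n + z) (2 * int e' - 1)"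
  have nN: "n = N + sum_list bs" by (simp add: n N_def a_def)
  note dp = dents_props[OF n]
  have ddn: "down_dents n as bs \<subseteq> {..<n}" "U \<subseteq> {..<n}"
    unfolding U_def using dents_subset[OF n] by blast+
  have finU: "finite U" "finite U'" using ddn finite_subset by (auto simp: U'_def)
  have UU: "U \<inter> U' = {}" using dp(3) ddn by (auto simp: U_def U'_def)
  have "U \<union> U' = ({..<a} \<union> {N..<n}) \<union> {n..<n + z}"
    using dp(4) nN by (simp add: U_def U'_def a_def Un_assoc[symmetric])
  also have "\<dots> = {..<a} \<union> {N..<N + c}" by (auto simp: nN c_def)
  finally have UUn: "U \<union> U' = {..<a} \<union> {N..<N + c}" .
  have cardU: "card U = even_sum as + odd_sum bs" by (simp add: U_def dp)
  have cardU': "card U' = odd_sum as + even_sum bs + z"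
  proof -
    have "down_dents n as bs \<inter> {n..<n + z} = {}" using ddn by fastforce
    then show ?thesis unfolding U'_def using ddn finite_subset[OF ddn(1)] by (simp add: card_Un_disjoint dp)
  qed
  have eL: "e \<le> n" "e' \<le> n + z"
    using odd_even_sum[of as] odd_even_sum[of bs] by (auto simp: e_def e'_def n)
  have fu: "fills Up0 U (Up0 \<inter> up_triangles n as bs)"
    unfolding Up0_def U_def by (rule fills_up_triangles[OF n]) (simp add: e_def)
  have fd: "fills Up1 U' (Up1 \<inter> (reflect ` down_triangles n as bs \<union> up_triangle n (n + z)))"
    unfolding Up1_def U'_def by (rule fills_down_triangles[OF n]) (simp add: e'_def)
  have zu: "Up (int d) 0 \<in> Up0 \<inter> up_triangles n as bs \<longleftrightarrow> d \<in> U" for d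
    by (rule fills_dent_iff[OF fu])
  have zd: "Up (int d) 0 \<in> Up1 \<inter> (reflect ` down_triangles n as bs \<union> up_triangle n (n + z)) \<longleftrightarrow> d \<in> U'" for d
    by (rule fills_dent_iff[OF fd])
  have Lo: "reflect ` Lo0 = Up1 - up_triangle n (n + z)"
    unfolding Lo0_def Up1_def by (rule reflect_lower_part)
  have rl: "reflect (l v) = r v" for v by (simp add: l_def r_def)
  have inj: "inj reflect" by (rule inj_on_inverseI[of _ reflect]) simp
  have reflR: "reflect ` R = Up1 - (reflect ` down_triangles n as bs \<union> up_triangle n (n + z))"
    unfolding R_def image_set_diff[OF inj] Lo by blast
  have lR: "l v \<in> R \<longleftrightarrow> r v \<in> Up1 \<and> v \<notin> U'" for v
  proof -
    have "l v \<in> R \<longleftrightarrow> r v \<in> reflect ` R" by (metis in_reflect_iff reflect_reflect rl)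
    then show ?thesis unfolding reflR using zd[of v] by (auto simp: r_def)
  qed
  have rS: "r v \<in> S \<longleftrightarrow> r v \<in> Up0 \<and> v \<notin> U" for v
    unfolding S_def using zu[of v] by (auto simp: r_def)
  have fin: "finite R" "finite S" by (simp_all add: R_def S_def Lo0_def Up0_def)
  let ?\<W> = "{W. W \<subseteq> {..<n} \<and> l ` W \<subseteq> R \<and> r ` W \<subseteq> S}"
  have "num_tilings (R2 x y z as bs) = num_tilings (R \<union> S)"
    unfolding R2_eq[OF n] R_def S_def Lo0_def Up0_def e_def e'_def ..
  also have "\<dots> = (\<Sum>W\<in>?\<W>. num_tilings (R - l ` W) * num_tilings (S - r ` W))"
  proof (rule num_tilings_cut[OF _ fin])
    show "R \<inter> S = {}"
      using height_lower height_upper by (fastforce simp: R_def S_def Lo0_def Up0_def)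
    show "inj_on l {..<n}" "inj_on r {..<n}" by (auto simp: l_def r_def inj_on_def)
    show "adj (l v) (r v)" for v by (simp add: l_def r_def)
    fix f g assume "f \<in> R" "g \<in> S" and adj: "adj f g"
    then have h: "height f < 0" "0 \<le> height g" and g: "g \<in> Up0"
      using height_lower height_upper by (auto simp: R_def S_def Lo0_def Up0_def)
    from adj h obtain i where "f = Down i (-1)" "g = Up i 0" by (cases f; cases g) auto
    moreover from this g have "0 \<le> i" "i < int n" by (auto simp: Up0_def)
    ultimately show "\<exists>v\<in>{..<n}. f = l v \<and> g = r v"
      by (intro bexI[of _ "nat i"]) (auto simp: l_def r_def)
  qed simp
  finally have cut: "real (num_tilings (R2 x y z as bs)) =
     (\<Sum>W\<in>?\<W>. real (num_tilings (R - l ` W)) * real (num_tilings (S - r ` W)))" by simp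
  \<comment> \<open>A crossing needs a face on either side of the line, so it avoids the dents of
    both halves; only the gap is left.\<close>
  have sub: "W \<subseteq> {a..<N}" if "W \<in> ?\<W>" for W
  proof
    fix v assume v: "v \<in> W"
    then have "v < n" "v \<notin> U" "v \<notin> U'" using that lR[of v] rS[of v] by auto
    then have "v \<notin> {..<a} \<union> {N..<N + c}" unfolding UUn[symmetric] by simp
    then show "v \<in> {a..<N}" using \<open>v < n\<close> by (auto simp: nN c_def)
  qed
  define C where "C = vand U * vand U' / (H2 (2 * e) * H2 (2 * e'))"
  have trm: "real (num_tilings (R - l ` W)) * real (num_tilings (S - r ` W)) =
      (if card W = y then C * ((vand W)\<^sup>2 * (\<Prod>s\<in>W. gap_weight a c N s)) else 0)" if W: "W \<in> ?\<W>" for W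
  proof -
    note Wab = sub[OF W]
    have finW: "finite W" using Wab finite_subset by blast
    have "({..<a} \<union> {N..<N + c}) \<inter> W = {}" using Wab by auto
    then have disj: "U \<inter> W = {}" "U' \<inter> W = {}" unfolding UUn[symmetric] by blast+
    have rW: "r ` W \<subseteq> Up0" "r ` W \<subseteq> Up1" using W lR rS by auto
    have "fills Up0 (U \<union> W) (Up0 \<inter> up_triangles n as bs \<union> r ` W)"
      using fills_Un[OF fu fills_dents] rW unfolding r_def by simp
    then have "num_tilings (Up0 - (Up0 \<inter> up_triangles n as bs \<union> r ` W)) = num_tilings (Up0 - r ` (U \<union> W))"
      unfolding r_def by (rule fills_num_tilings[rotated]) (simp add: Up0_def)
    moreover have "Up0 - (Up0 \<inter> up_triangles n as bs \<union> r ` W) = S - r ` W" unfolding S_def by blast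
    moreover have "real (num_tilings (Up0 - r ` (U \<union> W))) = (if card (U \<union> W) = e then vand (U \<union> W) / H2 (2 * e) else 0)"
      unfolding Up0_def r_def
    proof (rule dented_count_within[OF _ _ eL(1)])
      show "U \<union> W \<subseteq> {..<n}" using ddn W by auto
      have "r ` U \<subseteq> Up0" using zu by (auto simp: r_def)
      then show "(\<lambda>d. Up (int d) 0) ` (U \<union> W) \<subseteq> upper_part n (2 * int e - 1)"
        using rW by (auto simp: r_def Up0_def)
    qed
    moreover have "card (U \<union> W) = e \<longleftrightarrow> card W = y"
      using card_Un_disjoint[OF finU(1) finW disj(1)] by (simp add: cardU e_def)
    ultimately have up: "real (num_tilings (S - r ` W)) = (if card W = y then vand (U \<union> W) / H2 (2 * e) else 0)"
      by simp
    have "fills Up1 (U' \<union> W) (Up1 \<inter> (reflect ` down_triangles n as bs \<union> up_triangle n (n + z)) \<union> r ` W)"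
      using fills_Un[OF fd fills_dents] rW unfolding r_def by simp
    then have "num_tilings (Up1 - (Up1 \<inter> (reflect ` down_triangles n as bs \<union> up_triangle n (n + z)) \<union> r ` W)) = num_tilings (Up1 - r ` (U' \<union> W))"
      unfolding r_def by (rule fills_num_tilings[rotated]) (simp add: Up1_def)
    moreover have "Up1 - (Up1 \<inter> (reflect ` down_triangles n as bs \<union> up_triangle n (n + z)) \<union> r ` W) = reflect ` (R - l ` W)"
      unfolding image_set_diff[OF inj] reflR image_image rl by blast
    moreover have "num_tilings (reflect ` (R - l ` W)) = num_tilings (R - l ` W)"
      using fin by (intro num_tilings_reflect) simp
    moreover have "real (num_tilings (Up1 - r ` (U' \<union> W))) = (if card (U' \<union> W) = e' then vand (U' \<union> W) / H2 (2 * e') else 0)"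
      unfolding Up1_def r_def
    proof (rule dented_count_within[OF _ _ eL(2)])
      show "U' \<union> W \<subseteq> {..<n + z}" using ddn W by (fastforce simp: U'_def)
      have "r ` U' \<subseteq> Up1" using zd by (auto simp: r_def)
      then show "(\<lambda>d. Up (int d) 0) ` (U' \<union> W) \<subseteq> upper_part (n + z) (2 * int e' - 1)"
        using rW by (auto simp: r_def Up1_def)
    qed
    moreover have "card (U' \<union> W) = e' \<longleftrightarrow> card W = y"
      using card_Un_disjoint[OF finU(2) finW disj(2)] by (auto simp: cardU' e'_def)
    ultimately have down: "real (num_tilings (R - l ` W)) = (if card W = y then vand (U' \<union> W) / H2 (2 * e') else 0)"
      by simp
    show ?thesis
      using vand_product_gap_weight[OF finU UU UUn Wab] unfolding up down C_def
      by (simp add: mult_ac)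
  qed
  \<comment> \<open>Conversely, every subset of the gap of size \<open>y\<close> is admissible: if
    it is nonempty then \<open>y\<close> is at least 1, and both halves have a bottom row.\<close>
  have set: "{W \<in> ?\<W>. card W = y} = {W. W \<subseteq> {a..<N} \<and> card W = y}"
  proof (intro equalityI subsetI)
    fix W assume W: "W \<in> {W. W \<subseteq> {a..<N} \<and> card W = y}"
    have "l v \<in> R \<and> r v \<in> S" if v: "v \<in> W" for v
    proof -
      have "finite W" using W finite_subset by auto
      then have "1 \<le> y" using W v by (cases y) auto
      moreover have "a \<le> v" "v < N" using W v by auto
      moreover from this have "v \<notin> U \<union> U'" unfolding UUn by auto
      ultimately show ?thesis unfolding lR rS by (auto simp: r_def Up0_def Up1_def e_def e'_def nN)
    qed
    then show "W \<in> {W \<in> ?\<W>. card W = y}" using W nN by auto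
  qed (use sub in auto)
  have "real (num_tilings (R2 x y z as bs)) =
      (\<Sum>W\<in>?\<W>. if card W = y then C * ((vand W)\<^sup>2 * (\<Prod>s\<in>W. gap_weight a c N s)) else 0)"
    unfolding cut by (rule sum.cong[OF refl trm])
  also have "\<dots> = (\<Sum>W | W \<in> ?\<W> \<and> card W = y. C * ((vand W)\<^sup>2 * (\<Prod>s\<in>W. gap_weight a c N s)))"
    by (rule sum.inter_filter[symmetric]) (rule finite_subset[of _ "Pow {..<n}"], auto)
  also have "\<dots> = C * gap_sum y a c N"
    using set unfolding gap_sum_def sum_distrib_left by simp
  finally show ?thesis unfolding C_def U_def U'_def a_def c_def N_def e_def e'_def .
qed

lemma num_tilings_R2:
  "real (num_tilings (R2 x y z as bs)) = real (K (t_plus x y as bs)) * real (K (t_minus x y z as bs))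
     * (H2 (2 * even_sum as + 2 * odd_sum bs) * H2 (2 * odd_sum as + 2 * even_sum bs + 2 * z)
       / (H2 (2 * even_sum as + 2 * odd_sum bs + 2 * y) * H2 (2 * odd_sum as + 2 * even_sum bs + 2 * y + 2 * z)))
     * gap_sum y (sum_list as) (sum_list bs + z) (sum_list as + x + y)"
proof -
  have H: "H2 (2 * even_sum as + 2 * odd_sum bs) \<noteq> 0" "H2 (2 * odd_sum as + 2 * even_sum bs + 2 * z) \<noteq> 0"
    using H2_pos by (metis less_irrefl)+
  have e: "2 * (y + even_sum as + odd_sum bs) = 2 * even_sum as + 2 * odd_sum bs + 2 * y"
    "2 * (y + z + odd_sum as + even_sum bs) = 2 * odd_sum as + 2 * even_sum bs + 2 * y + 2 * z"
    "2 * (even_sum as + odd_sum bs) = 2 * even_sum as + 2 * odd_sum bs"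
    "2 * (odd_sum as + even_sum bs + z) = 2 * odd_sum as + 2 * even_sum bs + 2 * z" by simp_all
  show ?thesis
    unfolding num_tilings_R2_sum[OF refl] K_t_plus[OF refl] K_t_minus[OF refl] e using H by simp
qed

text \<open>This justifies dividing by the count for \<open>y\<close>, 0 and
  \<open>z\<close>.\<close>

lemma K_pos: "0 < real (K (t_plus x y as bs))" "0 < real (K (t_minus x y z as bs))"
proof -
  define n where n: "n = (x + y) + sum_list as + sum_list bs"
  have "up_dents n as bs \<subseteq> {..<n}" "down_dents n as bs \<subseteq> {..<n}"
    using dents_subset[OF n] by blast+
  then have "finite (up_dents n as bs)" "finite (down_dents n as bs \<union> {n..<n + z})"
    using finite_subset by auto
  then show "0 < real (K (t_plus x y as bs))" "0 < real (K (t_minus x y z as bs))"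
    unfolding K_t_plus[OF n] K_t_minus[OF n] using vand_pos H2_pos by (auto intro: divide_pos_pos)
qed

theorem theorem2p9:
  fixes x y z :: nat and as bs :: "nat list"
  shows "let a = sum_list as; b = sum_list bs;
      oa = odd_sum as; ea = even_sum as; ob = odd_sum bs; eb = even_sum bs;
      M = (\<lambda>x y z. real (num_tilings (R2 x y z as bs)));
      F = (T (real x + 1) (2 * int a + int b + 2 * int y + int z - 1) y
            * V (2 * real x + 2 * real a + 3) (int b + 2 * int y + int z - 2) y)
        / (T 1 (2 * int a + int b + 2 * int y + int z - 1) y
            * V (2 * real a + 3) (int b + 2 * int y + int z - 2) y)
    in M x y z = M (x + y) 0 z * M 0 y z / M y 0 z * F
     \<and> M x y z = real (K (t_plus x y as bs)) * real (K (t_minus x y z as bs))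
         * (odd_dfact (2 * int a - 1) / odd_dfact (2 * int a + 2 * int y - 1))
         * (H2 (2 * ea + 2 * ob) * H2 (2 * oa + 2 * eb + 2 * z)
            / (H2 (2 * ea + 2 * ob + 2 * y) * H2 (2 * oa + 2 * eb + 2 * y + 2 * z)))
         * (H (2 * a + b + 2 * y + z) * H (b + y + z)
            / (H (2 * a + b + y + z) * H (b + z)))
         * F"
proof -
  define a where "a = sum_list as"
  define b where "b = sum_list bs"
  define h where "h = (H2 (2 * even_sum as + 2 * odd_sum bs) * H2 (2 * odd_sum as + 2 * even_sum bs + 2 * z)
       / (H2 (2 * even_sum as + 2 * odd_sum bs + 2 * y) * H2 (2 * odd_sum as + 2 * even_sum bs + 2 * y + 2 * z)))"
  define g where "g = (\<lambda>x. gap_sum y a (b + z) (a + x + y))"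
  define k where "k = (\<lambda>x y. real (K (t_plus x y as bs)) * real (K (t_minus x y z as bs)))"
  let ?M = "\<lambda>x y. real (num_tilings (R2 x y z as bs))"
  have M: "?M x y = k x y * h * g x" for x
    unfolding num_tilings_R2 k_def h_def g_def a_def b_def by simp
  have M0: "?M w 0 = k w 0" for w
    using H2_pos[of "2 * even_sum as + 2 * odd_sum bs"] H2_pos[of "2 * odd_sum as + 2 * even_sum bs + 2 * z"]
    unfolding num_tilings_R2 k_def by (simp add: gap_sum_0)
  \<comment> \<open>In \<open>t_plus\<close> and \<open>t_minus\<close> the numbers \<open>x\<close>
    and \<open>y\<close> occur only in the sum \<open>x + y\<close>.\<close>
  have k: "k x y = k (x + y) 0" for x y
    by (simp add: k_def t_plus_def t_minus_def Let_def add_ac)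
  have kpos: "k x y > 0" for x y
    unfolding k_def by (intro mult_pos_pos K_pos)
  have g: "g x = odd_dfact (2 * int a - 1) / odd_dfact (2 * int a + 2 * int y - 1)
     * (H (2 * a + b + 2 * y + z) * H (b + y + z) / (H (2 * a + b + y + z) * H (b + z))) * gap_factor x y z a b" for x
    unfolding g_def by (rule gap_sum_gap_factor)
  have gx: "g x = g 0 * gap_factor x y z a b"
    unfolding g[of x] g[of 0] gap_factor_0 by simp
  \<comment> \<open>The quotient of the three counts is \<open>k (x + y) 0 * h * g 0\<close>, and
    \<open>g 0\<close> differs from \<open>g x\<close> by \<open>gap_factor\<close> only.\<close>
  have 1: "?M x y = ?M (x + y) 0 * ?M 0 y / ?M y 0 * gap_factor x y z a b"
    unfolding M M0 k[of x y] k[of 0 y] gx using kpos[of y 0] by simp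
  have 2: "?M x y = real (K (t_plus x y as bs)) * real (K (t_minus x y z as bs))
         * (odd_dfact (2 * int a - 1) / odd_dfact (2 * int a + 2 * int y - 1)) * h
         * (H (2 * a + b + 2 * y + z) * H (b + y + z) / (H (2 * a + b + y + z) * H (b + z)))
         * gap_factor x y z a b"
    unfolding M g k_def by (simp only: mult_ac)
  show ?thesis
    unfolding Let_def a_def[symmetric] b_def[symmetric] gap_factor_def[symmetric] h_def[symmetric]
    using 1 2 by (intro conjI)
qed

end
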